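(* For each of the three families (F1), (F2), (F3) of $32$-dimensional complex pointed Hopf algebras $H(\lambda_1,\lambda_2,\lambda_3)$ described in the context, and for every $(\lambda_1,\lambda_2,\lambda_3)\in\mathbb{C}^3$, there exist a finite group $G$, a finite-dimensional complex representation $V$ of $G$, a central element $u\in G$ of order $2$ acting by $-1$ on $V$, and $B\in S^2V$ (with $G$, $V$, $u$ depending only on the family) such that $H(\lambda_1,\lambda_2,\lambda_3)\cong A(G,V,u,B)^*$ as Hopf algebras.
   Context: The ground field is $\mathbb{C}$. $S^2V$ denotes the space of symmetric tensors in $V\otimes V$, and $H^*$ is the dual Hopf algebra. The three families (Graña's continuous families of $32$-dimensional pointed Hopf algebras). Given a finite abelian group $\Gamma$ of order $8$, elements $g_1,g_2\in\Gamma$ and a character $\psi:\Gamma\to\{\pm1\}$ with $\psi(g_1)=\psi(g_2)=-1$, let $H(\lambda_1,\lambda_2,\lambda_3)$ be the Hopf algebra generated by $\Gamma$ (with its group relations) and $x_1,x_2$, with relations $hx_ih^{-1}=\psi(h)x_i$ ($h\in\Gamma$), $x_i^2=\lambda_i(1-g_i^2)$ ($i=1,2$), $x_1x_2+x_2x_1=\lambda_3(1-g_1g_2)$, and coproduct $\Delta(h)=h\otimes h$ for $h\in\Gamma$, $\Delta(x_i)=g_i\otimes x_i+x_i\otimes1$. The families are: (F1) $\Gamma=\mathbb{Z}_8=\langle g\rangle$, $g_1=g$, $g_2=g^3$, $\psi(g)=-1$; (F2) $\Gamma=\mathbb{Z}_8=\langle g\rangle$, $g_1=g$, $g_2=g^5$,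 $\psi(g)=-1$; (F3) $\Gamma=\mathbb{Z}_4\times\mathbb{Z}_2=\langle g\rangle\times\langle h\rangle$, $g_1=g$, $g_2=gh$, $\psi(g)=-1$, $\psi(h)=1$. Definition of $A(G,V,u,B)$. Let $\mathbb{C}[G\ltimes V]:=\mathbb{C}[G]\ltimes\Lambda V$ be the Hopf superalgebra generated by $G$ (even) and $V$ (odd), with $gvg^{-1}=g\cdot v$, $vw=-wv$, $\Delta(g)=g\otimes g$, $\Delta(v)=v\otimes1+1\otimes v$, $\varepsilon(g)=1$, $\varepsilon(v)=0$ (tensor products of superalgebras have the super multiplication). Let $J:=e^B\in\Lambda V\otimes\Lambda V\subset\mathbb{C}[G\ltimes V]^{\otimes2}$. The twisted Hopf superalgebra $\mathbb{C}[G\ltimes V]^J$ has the same multiplication and counit, and coproduct $\Delta^J(x)=J^{-1}\Delta(x)J$. For $x$ homogeneous of parity $p(x)$ write $\Delta^J(x)=\Delta^J_0(x)+\Delta^J_1(x)$, where the second tensor factor of $\Delta^J_0(x)$ is even and that of $\Delta_1^J(x)$ is odd. Then $A(G,V,u,B)$ is the ordinary Hopf algebra which, as an algebra with counit, is $\mathbb{C}[G]\ltimes\Lambda V$ (grading forgotten), with coproduct $\widetilde{\Delta^J}(x)=\Delta^J_0(x)-(-1)^{p(x)}(u\otimes1)\Delta^J_1(x)$. *)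

theory Defs
  imports
    Complex_Main
    "HOL-Library.Poly_Mapping"
    "HOL-Algebra.QuotRing"
    "HOL-Algebra.Elementary_Groups"
    "HOL-Algebra.Multiplicative_Group"
    "Jordan_Normal_Form.Matrix"
begin

section \<open>Formal linear combinations\<close>

text \<open>\<open>'a \<Rightarrow>\<^sub>0 complex\<close> is the complex vector space with basis \<open>'a\<close>.\<close>

abbreviation basis :: "'a \<Rightarrow> 'a \<Rightarrow>\<^sub>0 complex" where
  "basis a \<equiv> Poly_Mapping.single a 1"

definition cscale :: "complex \<Rightarrow> ('a \<Rightarrow>\<^sub>0 complex) \<Rightarrow> ('a \<Rightarrow>\<^sub>0 complex)" where
  "cscale c p = Poly_Mapping.map (\<lambda>a. c * a) p"

definition lin_form :: "('a \<Rightarrow> complex) \<Rightarrow> ('a \<Rightarrow>\<^sub>0 complex) \<Rightarrow> complex" where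
  "lin_form f p = (\<Sum>a\<in>Poly_Mapping.keys p. Poly_Mapping.lookup p a * f a)"

definition lin_ext :: "('a \<Rightarrow> 'b \<Rightarrow>\<^sub>0 complex) \<Rightarrow> ('a \<Rightarrow>\<^sub>0 complex) \<Rightarrow> ('b \<Rightarrow>\<^sub>0 complex)" where
  "lin_ext f p = (\<Sum>a\<in>Poly_Mapping.keys p. cscale (Poly_Mapping.lookup p a) (f a))"

definition bilin_ext ::
  "('a \<Rightarrow> 'b \<Rightarrow> 'c \<Rightarrow>\<^sub>0 complex) \<Rightarrow> ('a \<Rightarrow>\<^sub>0 complex) \<Rightarrow> ('b \<Rightarrow>\<^sub>0 complex) \<Rightarrow> ('c \<Rightarrow>\<^sub>0 complex)" where
  "bilin_ext f p q = lin_ext (\<lambda>a. lin_ext (\<lambda>b. f a b) q) p"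

definition push :: "('a \<Rightarrow> 'b) \<Rightarrow> ('a \<Rightarrow>\<^sub>0 complex) \<Rightarrow> ('b \<Rightarrow>\<^sub>0 complex)" where
  "push f = lin_ext (\<lambda>a. basis (f a))"

definition pair_tensor :: "('a \<Rightarrow>\<^sub>0 complex) \<Rightarrow> ('b \<Rightarrow>\<^sub>0 complex) \<Rightarrow> ('a \<times> 'b \<Rightarrow>\<^sub>0 complex)" where
  "pair_tensor = bilin_ext (\<lambda>a b. basis (a, b))"


section \<open>Tensor powers of a vector space with carrier\<close>

text \<open>
  An element of the \<open>k\<close>-th tensor power of \<open>M\<close> is represented by a formal linear combination of
  lists \<open>[x\<^sub>1, \<dots>, x\<^sub>k]\<close> over the carrier, the list standing for the pure tensor
  \<open>x\<^sub>1 \<otimes> \<dots> \<otimes> x\<^sub>k\<close>. Two such combinations represent the same tensor iff they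
  differ by an element of the linear span of the multilinearity relations, i.e. iff they
  are related by \<open>tensor_eq M\<close>; equations between tensors are therefore always stated with \<open>tensor_eq\<close>.
\<close>

definition tensors :: "('a, 'm) partial_object_scheme \<Rightarrow> nat \<Rightarrow> ('a list \<Rightarrow>\<^sub>0 complex) set" where
  "tensors M k = {t. \<forall>xs\<in>Poly_Mapping.keys t. length xs = k \<and> set xs \<subseteq> carrier M}"

inductive_set tensor_null ::
  "(complex, 'a, 'm) module_scheme \<Rightarrow> ('a list \<Rightarrow>\<^sub>0 complex) set"
  for M :: "(complex, 'a, 'm) module_scheme" (structure)
where
  "0 \<in> tensor_null M"
| "\<lbrakk>s \<in> tensor_null M; t \<in> tensor_null M\<rbrakk> \<Longrightarrow> s + t \<in> tensor_null M"
| "s \<in> tensor_null M \<Longrightarrow> cscale c s \<in> tensor_null M"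
| "\<lbrakk>set xs \<subseteq> carrier M; set ys \<subseteq> carrier M; x \<in> carrier M; y \<in> carrier M\<rbrakk> \<Longrightarrow>
    basis (xs @ (x \<oplus> y) # ys) - basis (xs @ x # ys) - basis (xs @ y # ys) \<in> tensor_null M"
| "\<lbrakk>set xs \<subseteq> carrier M; set ys \<subseteq> carrier M; x \<in> carrier M\<rbrakk> \<Longrightarrow>
    basis (xs @ (c \<odot> x) # ys) - cscale c (basis (xs @ x # ys)) \<in> tensor_null M"

definition tensor_eq ::
  "(complex, 'a, 'm) module_scheme \<Rightarrow> ('a list \<Rightarrow>\<^sub>0 complex) \<Rightarrow> ('a list \<Rightarrow>\<^sub>0 complex) \<Rightarrow> bool" where
  "tensor_eq M s t \<longleftrightarrow> s - t \<in> tensor_null M"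

text \<open>Factorwise multiplication of tensors.\<close>

definition tensor_mult ::
  "('a, 'm) monoid_scheme \<Rightarrow> ('a list \<Rightarrow>\<^sub>0 complex) \<Rightarrow> ('a list \<Rightarrow>\<^sub>0 complex) \<Rightarrow> ('a list \<Rightarrow>\<^sub>0 complex)" where
  "tensor_mult M = bilin_ext (\<lambda>xs ys. basis (map2 (\<lambda>x y. x \<otimes>\<^bsub>M\<^esub> y) xs ys))"


section \<open>Hopf algebras over the complex numbers\<close>

abbreviation complex_ring :: "complex ring" where
  "complex_ring \<equiv> \<lparr>carrier = UNIV, monoid.mult = (*), one = 1, zero = 0, add = (+)\<rparr>"

text \<open>\<open>comult H x\<close> is some representative of the tensor \<open>\<Delta>(x)\<close>.\<close>

record 'a hopf = "(complex, 'a) module" +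
  comult :: "'a \<Rightarrow> ('a list \<Rightarrow>\<^sub>0 complex)"
  counit :: "'a \<Rightarrow> complex"

locale hopf_algebra =
  Module.module complex_ring H + ring H
  for H :: "('a, 'm) hopf_scheme" (structure) +
  assumes smult_mult_left: "\<lbrakk>x \<in> carrier H; y \<in> carrier H\<rbrakk> \<Longrightarrow> (c \<odot> x) \<otimes> y = c \<odot> (x \<otimes> y)"
    and smult_mult_right: "\<lbrakk>x \<in> carrier H; y \<in> carrier H\<rbrakk> \<Longrightarrow> x \<otimes> (c \<odot> y) = c \<odot> (x \<otimes> y)"
    and comult_closed: "x \<in> carrier H \<Longrightarrow> comult H x \<in> tensors H 2"
    and comult_add: "\<lbrakk>x \<in> carrier H; y \<in> carrier H\<rbrakk> \<Longrightarrow>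
          tensor_eq H (comult H (x \<oplus> y)) (comult H x + comult H y)"
    and comult_smult: "x \<in> carrier H \<Longrightarrow>
          tensor_eq H (comult H (c \<odot> x)) (cscale c (comult H x))"
    and comult_mult: "\<lbrakk>x \<in> carrier H; y \<in> carrier H\<rbrakk> \<Longrightarrow>
          tensor_eq H (comult H (x \<otimes> y)) (tensor_mult H (comult H x) (comult H y))"
    and comult_one: "tensor_eq H (comult H \<one>) (basis [\<one>, \<one>])"
    and counit_add: "\<lbrakk>x \<in> carrier H; y \<in> carrier H\<rbrakk> \<Longrightarrow>
          counit H (x \<oplus> y) = counit H x + counit H y"
    and counit_smult: "x \<in> carrier H \<Longrightarrow> counit H (c \<odot> x) = c * counit H x"
    and counit_mult: "\<lbrakk>x \<in> carrier H; y \<in> carrier H\<rbrakk> \<Longrightarrow>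
          counit H (x \<otimes> y) = counit H x * counit H y"
    and counit_one: "counit H \<one> = 1"
    and coassoc: "x \<in> carrier H \<Longrightarrow>
          tensor_eq H
            (lin_ext (\<lambda>xs. push (\<lambda>ys. ys @ [xs ! 1]) (comult H (xs ! 0))) (comult H x))
            (lin_ext (\<lambda>xs. push (\<lambda>ys. xs ! 0 # ys) (comult H (xs ! 1))) (comult H x))"
    and counit_left: "x \<in> carrier H \<Longrightarrow>
          tensor_eq H (lin_ext (\<lambda>xs. cscale (counit H (xs ! 0)) (basis [xs ! 1])) (comult H x)) (basis [x])"
    and counit_right: "x \<in> carrier H \<Longrightarrow>
          tensor_eq H (lin_ext (\<lambda>xs. cscale (counit H (xs ! 1)) (basis [xs ! 0])) (comult H x)) (basis [x])"
    and antipode: "\<exists>S \<in> carrier H \<rightarrow> carrier H.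
          (\<forall>x\<in>carrier H. \<forall>y\<in>carrier H. S (x \<oplus> y) = S x \<oplus> S y) \<and>
          (\<forall>c. \<forall>x\<in>carrier H. S (c \<odot> x) = c \<odot> S x) \<and>
          (\<forall>x\<in>carrier H.
            tensor_eq H (push (\<lambda>xs. [S (xs ! 0) \<otimes> xs ! 1]) (comult H x)) (basis [counit H x \<odot> \<one>]) \<and>
            tensor_eq H (push (\<lambda>xs. [xs ! 0 \<otimes> S (xs ! 1)]) (comult H x)) (basis [counit H x \<odot> \<one>]))"

text \<open>
  The antipode is unique, and a bialgebra isomorphism between Hopf algebras
  automatically commutes with the antipodes.
\<close>

definition hopf_isomorphic :: "('a, 'm) hopf_scheme \<Rightarrow> ('b, 'n) hopf_scheme \<Rightarrow> bool" where
  "hopf_isomorphic H K \<longleftrightarrow>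
    hopf_algebra H \<and> hopf_algebra K \<and>
    (\<exists>\<phi>. \<phi> \<in> ring_iso H K \<and>
      (\<forall>c. \<forall>x\<in>carrier H. \<phi> (c \<odot>\<^bsub>H\<^esub> x) = c \<odot>\<^bsub>K\<^esub> \<phi> x) \<and>
      (\<forall>x\<in>carrier H. counit K (\<phi> x) = counit H x) \<and>
      (\<forall>x\<in>carrier H. tensor_eq K (comult K (\<phi> x)) (push (map \<phi>) (comult H x))))"

text \<open>
  The dual of a finite-dimensional Hopf algebra: linear forms (normalised to be \<open>0\<close> off the
  carrier), with \<open>(f g)(x) = (f \<otimes> g)(\<Delta> x)\<close> and \<open>(\<Delta> f)(x \<otimes> y) = f (x y)\<close>. In finite dimension
  the tensor \<open>\<Delta> f\<close> exists and is unique, so the choice below is one of a representative.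
\<close>

definition dual_carrier :: "('a, 'm) hopf_scheme \<Rightarrow> ('a \<Rightarrow> complex) set" where
  "dual_carrier H = {f. (\<forall>x\<in>carrier H. \<forall>y\<in>carrier H. f (x \<oplus>\<^bsub>H\<^esub> y) = f x + f y) \<and>
     (\<forall>c. \<forall>x\<in>carrier H. f (c \<odot>\<^bsub>H\<^esub> x) = c * f x) \<and> (\<forall>x. x \<notin> carrier H \<longrightarrow> f x = 0)}"

definition dual_hopf :: "('a, 'm) hopf_scheme \<Rightarrow> ('a \<Rightarrow> complex) hopf" where
  "dual_hopf H = \<lparr>
     carrier = dual_carrier H,
     monoid.mult = (\<lambda>f g x. if x \<in> carrier H
       then lin_form (\<lambda>xs. f (xs ! 0) * g (xs ! 1)) (comult H x) else 0),
     one = (\<lambda>x. if x \<in> carrier H then counit H x else 0),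
     zero = (\<lambda>x. 0),
     add = (\<lambda>f g x. f x + g x),
     smult = (\<lambda>c f x. c * f x),
     comult = (\<lambda>f. SOME t. (\<forall>fs\<in>Poly_Mapping.keys t. length fs = 2 \<and> set fs \<subseteq> dual_carrier H) \<and>
       (\<forall>x\<in>carrier H. \<forall>y\<in>carrier H.
         lin_form (\<lambda>fs. (fs ! 0) x * (fs ! 1) y) t = f (x \<otimes>\<^bsub>H\<^esub> y))),
     counit = (\<lambda>f. f \<one>\<^bsub>H\<^esub>)\<rparr>"


section \<open>Hopf algebras given by generators and relations\<close>

text \<open>
  The free associative unital algebra on \<open>X\<close> has the words over \<open>X\<close> as a basis. The tensor square of
  this algebra has the pairs of words as a basis.
\<close>

definition free_algebra :: "'x set \<Rightarrow> (complex, 'x list \<Rightarrow>\<^sub>0 complex) module" where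
  "free_algebra X = \<lparr>
     carrier = {p. \<forall>w\<in>Poly_Mapping.keys p. set w \<subseteq> X},
     monoid.mult = bilin_ext (\<lambda>v w. basis (v @ w)),
     one = basis [], zero = 0, add = (+), smult = cscale\<rparr>"

definition free_comult ::
  "('x \<Rightarrow> 'x list \<times> 'x list \<Rightarrow>\<^sub>0 complex) \<Rightarrow> ('x list \<Rightarrow>\<^sub>0 complex) \<Rightarrow> ('x list \<times> 'x list \<Rightarrow>\<^sub>0 complex)" where
  "free_comult \<delta> = lin_ext (\<lambda>w. foldr
     (\<lambda>x. bilin_ext (\<lambda>(v, v') (w, w'). basis (v @ w, v' @ w')) (\<delta> x)) w (basis ([], [])))"

text \<open>
  The quotient of the free algebra on \<open>X\<close> by the two-sided ideal generated by \<open>R\<close>, with the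
  coproduct and counit induced by the values \<open>\<delta>\<close> and \<open>\<epsilon>\<close> on generators. When
  the ideal is a biideal, the chosen representative of a coset is immaterial.
\<close>

definition presented_hopf ::
  "'x set \<Rightarrow> ('x list \<Rightarrow>\<^sub>0 complex) set \<Rightarrow> ('x \<Rightarrow> 'x list \<times> 'x list \<Rightarrow>\<^sub>0 complex) \<Rightarrow>
   ('x \<Rightarrow> complex) \<Rightarrow> ('x list \<Rightarrow>\<^sub>0 complex) set hopf" where
  "presented_hopf X R \<delta> \<epsilon> =
    (let F = free_algebra X; I = Idl\<^bsub>F\<^esub> R; Q = F Quot I in \<lparr>
     carrier = carrier Q, monoid.mult = monoid.mult Q, one = monoid.one Q, zero = ring.zero Q, add = ring.add Q,
     smult = (\<lambda>c A. \<Union>p\<in>A. I +>\<^bsub>F\<^esub> (c \<odot>\<^bsub>F\<^esub> p)),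
     comult = (\<lambda>A. push (\<lambda>(v, w). [I +>\<^bsub>F\<^esub> basis v, I +>\<^bsub>F\<^esub> basis w]) (free_comult \<delta> (SOME p. p \<in> A))),
     counit = (\<lambda>A. lin_form (\<lambda>w. prod_list (map \<epsilon> w)) (SOME p. p \<in> A))\<rparr>)"


section \<open>The pointed Hopf algebras $H(\lambda_1,\lambda_2,\lambda_3)$\<close>

datatype 'g hgen = Grp 'g | X1 | X2

definition H_relations ::
  "('g, 'm) monoid_scheme \<Rightarrow> 'g \<Rightarrow> 'g \<Rightarrow> ('g \<Rightarrow> complex) \<Rightarrow> complex \<Rightarrow> complex \<Rightarrow> complex \<Rightarrow>
   ('g hgen list \<Rightarrow>\<^sub>0 complex) set" where
  "H_relations \<Gamma> g1 g2 \<psi> l1 l2 l3 =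
     {basis [Grp a, Grp b] - basis [Grp (a \<otimes>\<^bsub>\<Gamma>\<^esub> b)] | a b. a \<in> carrier \<Gamma> \<and> b \<in> carrier \<Gamma>} \<union>
     {basis [Grp \<one>\<^bsub>\<Gamma>\<^esub>] - basis []} \<union>
     {basis [Grp h, x, Grp (inv\<^bsub>\<Gamma>\<^esub> h)] - cscale (\<psi> h) (basis [x]) | h x. h \<in> carrier \<Gamma> \<and> x \<in> {X1, X2}} \<union>
     {basis [X1, X1] - cscale l1 (basis [] - basis [Grp g1, Grp g1]),
      basis [X2, X2] - cscale l2 (basis [] - basis [Grp g2, Grp g2]),
      basis [X1, X2] + basis [X2, X1] - cscale l3 (basis [] - basis [Grp g1, Grp g2])}"

fun H_comult_gen :: "'g \<Rightarrow> 'g \<Rightarrow> 'g hgen \<Rightarrow> ('g hgen list \<times> 'g hgen list \<Rightarrow>\<^sub>0 complex)" where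
  "H_comult_gen g1 g2 (Grp h) = basis ([Grp h], [Grp h])"
| "H_comult_gen g1 g2 X1 = basis ([Grp g1], [X1]) + basis ([X1], [])"
| "H_comult_gen g1 g2 X2 = basis ([Grp g2], [X2]) + basis ([X2], [])"

fun H_counit_gen :: "'g hgen \<Rightarrow> complex" where
  "H_counit_gen (Grp h) = 1"
| "H_counit_gen X1 = 0"
| "H_counit_gen X2 = 0"

definition grana_hopf ::
  "('g, 'm) monoid_scheme \<Rightarrow> 'g \<Rightarrow> 'g \<Rightarrow> ('g \<Rightarrow> complex) \<Rightarrow> complex \<Rightarrow> complex \<Rightarrow> complex \<Rightarrow>
   ('g hgen list \<Rightarrow>\<^sub>0 complex) set hopf" where
  "grana_hopf \<Gamma> g1 g2 \<psi> l1 l2 l3 =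
     presented_hopf (Grp ` carrier \<Gamma> \<union> {X1, X2}) (H_relations \<Gamma> g1 g2 \<psi> l1 l2 l3)
       (H_comult_gen g1 g2) H_counit_gen"

text \<open>
  The groups are written additively: \<open>k\<close> in the cyclic group of order 8 is $g^k$, and \<open>(a, b)\<close>
  in the product of the cyclic groups of orders 4 and 2 is $g^a h^b$.
\<close>

definition H_F1 :: "complex \<Rightarrow> complex \<Rightarrow> complex \<Rightarrow> (int hgen list \<Rightarrow>\<^sub>0 complex) set hopf" where
  "H_F1 = grana_hopf (integer_mod_group 8) 1 3 (\<lambda>k. (-1) ^ nat k)"

definition H_F2 :: "complex \<Rightarrow> complex \<Rightarrow> complex \<Rightarrow> (int hgen list \<Rightarrow>\<^sub>0 complex) set hopf" where
  "H_F2 = grana_hopf (integer_mod_group 8) 1 5 (\<lambda>k. (-1) ^ nat k)"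

definition H_F3 :: "complex \<Rightarrow> complex \<Rightarrow> complex \<Rightarrow> ((int \<times> int) hgen list \<Rightarrow>\<^sub>0 complex) set hopf" where
  "H_F3 = grana_hopf (integer_mod_group 4 \<times>\<times> integer_mod_group 2) (1, 0) (1, 1)
     (\<lambda>(a, b). (-1) ^ nat a)"


section \<open>The Hopf algebras $A(G,V,u,B)$\<close>

text \<open>
  \<open>V\<close> is $\mathbb{C}^n$ with basis $e_0,\dots,e_{n-1}$, on which \<open>G\<close> acts by the matrices \<open>\<rho> g\<close>.
\<close>

definition representation :: "('g, 'm) monoid_scheme \<Rightarrow> nat \<Rightarrow> ('g \<Rightarrow> complex mat) \<Rightarrow> bool" where
  "representation G n \<rho> \<longleftrightarrow>
     (\<forall>g\<in>carrier G. \<rho> g \<in> carrier_mat n n) \<and> \<rho> \<one>\<^bsub>G\<^esub> = 1\<^sub>m n \<and>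
     (\<forall>g\<in>carrier G. \<forall>h\<in>carrier G. \<rho> (g \<otimes>\<^bsub>G\<^esub> h) = \<rho> g * \<rho> h)"

text \<open>
  The exterior algebra of \<open>V\<close> has the basis $e_S = e_{s_1} \wedge \dots \wedge e_{s_k}$, indexed by the
  subsets $S = \{s_1 < \dots < s_k\}$ of $\{0,\dots,n-1\}$. The sign in the product of $e_S$ and $e_T$ is
  that of the permutation sorting the concatenation of \<open>S\<close> and \<open>T\<close>.
\<close>

definition wedge :: "nat set \<Rightarrow> nat set \<Rightarrow> (nat set \<Rightarrow>\<^sub>0 complex)" where
  "wedge S T = (if S \<inter> T = {}
     then Poly_Mapping.single (S \<union> T) ((-1) ^ card {(s, t). s \<in> S \<and> t \<in> T \<and> t < s}) else 0)"

text \<open>$g \cdot e_T = (g e_{t_1}) \wedge \dots \wedge (g e_{t_k})$, where \<open>g\<close> acts on \<open>V\<close> by the matrix \<open>M\<close>.\<close>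

definition ext_act :: "nat \<Rightarrow> complex mat \<Rightarrow> nat set \<Rightarrow> (nat set \<Rightarrow>\<^sub>0 complex)" where
  "ext_act n M T = foldr
     (\<lambda>t. bilin_ext wedge (\<Sum>j<n. Poly_Mapping.single {j} (M $$ (j, t))))
     (sorted_list_of_set T) (basis {})"

text \<open>
  The key \<open>(S, g)\<close> stands for the element $e_S\,g$ of $\mathbb{C}[G] \ltimes \Lambda V$; these elements form a basis.
  The product is determined by $(e_S\,g)(e_T\,h) = (e_S \wedge g \cdot e_T)\,gh$.
\<close>

type_synonym 'g semi = "nat set \<times> 'g"

definition parity :: "'g semi \<Rightarrow> nat" where
  "parity a = card (fst a)"

definition semi_mult_basis ::
  "('g, 'm) monoid_scheme \<Rightarrow> nat \<Rightarrow> ('g \<Rightarrow> complex mat) \<Rightarrow> 'g semi \<Rightarrow> 'g semi \<Rightarrow> ('g semi \<Rightarrow>\<^sub>0 complex)" where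
  "semi_mult_basis G n \<rho> = (\<lambda>(S, g) (T, h).
     push (\<lambda>U. (U, g \<otimes>\<^bsub>G\<^esub> h)) (lin_ext (wedge S) (ext_act n (\<rho> g) T)))"

text \<open>
  The product of the super tensor square, on the basis of pairs:
  $(a \otimes b)(c \otimes d) = (-1)^{p(b)p(c)}\, ac \otimes bd$.
\<close>

definition super_mult ::
  "('g, 'm) monoid_scheme \<Rightarrow> nat \<Rightarrow> ('g \<Rightarrow> complex mat) \<Rightarrow>
   ('g semi \<times> 'g semi \<Rightarrow>\<^sub>0 complex) \<Rightarrow> ('g semi \<times> 'g semi \<Rightarrow>\<^sub>0 complex) \<Rightarrow> ('g semi \<times> 'g semi \<Rightarrow>\<^sub>0 complex)" where
  "super_mult G n \<rho> = bilin_ext (\<lambda>(a, b) (c, d). cscale ((-1) ^ (parity b * parity c))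
     (pair_tensor (semi_mult_basis G n \<rho> a c) (semi_mult_basis G n \<rho> b d)))"

text \<open>$\Delta(e_S\,g) = \Delta(e_{s_1}) \cdots \Delta(e_{s_k})\,\Delta(g)$ with primitive $e_i$ and group-like \<open>g\<close>.\<close>

definition super_comult_basis ::
  "('g, 'm) monoid_scheme \<Rightarrow> nat \<Rightarrow> ('g \<Rightarrow> complex mat) \<Rightarrow> 'g semi \<Rightarrow> ('g semi \<times> 'g semi \<Rightarrow>\<^sub>0 complex)" where
  "super_comult_basis G n \<rho> = (\<lambda>(S, g). foldr
     (\<lambda>i. super_mult G n \<rho> (basis (({i}, \<one>\<^bsub>G\<^esub>), ({}, \<one>\<^bsub>G\<^esub>)) + basis (({}, \<one>\<^bsub>G\<^esub>), ({i}, \<one>\<^bsub>G\<^esub>))))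
     (sorted_list_of_set S) (basis (({}, g), ({}, g))))"

text \<open>The element $\sum_{i,j} B_{ij}\, e_i \otimes e_j$ of $V \otimes V$ with coefficient matrix \<open>B\<close>.\<close>

definition tensor_of_mat :: "('g, 'm) monoid_scheme \<Rightarrow> nat \<Rightarrow> complex mat \<Rightarrow> ('g semi \<times> 'g semi \<Rightarrow>\<^sub>0 complex)" where
  "tensor_of_mat G n B =
     (\<Sum>i<n. \<Sum>j<n. Poly_Mapping.single (({i}, \<one>\<^bsub>G\<^esub>), ({j}, \<one>\<^bsub>G\<^esub>)) (B $$ (i, j)))"

text \<open>
  The exponential series, applied to elements of $V \otimes V$ only: there the powers with exponent
  greater than \<open>n\<close> vanish, as the \<open>k\<close>-th power lies in $\Lambda^k V \otimes \Lambda^k V$.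
\<close>

definition super_exp ::
  "('g, 'm) monoid_scheme \<Rightarrow> nat \<Rightarrow> ('g \<Rightarrow> complex mat) \<Rightarrow>
   ('g semi \<times> 'g semi \<Rightarrow>\<^sub>0 complex) \<Rightarrow> ('g semi \<times> 'g semi \<Rightarrow>\<^sub>0 complex)" where
  "super_exp G n \<rho> t = (\<Sum>k\<le>n. cscale (1 / fact k)
     ((super_mult G n \<rho> t ^^ k) (basis (({}, \<one>\<^bsub>G\<^esub>), ({}, \<one>\<^bsub>G\<^esub>)))))"

text \<open>$\Delta^J(x) = J^{-1}\Delta(x)J$ for $J = e^B$, so that $J^{-1} = e^{-B}$.\<close>

definition twisted_comult_basis ::
  "('g, 'm) monoid_scheme \<Rightarrow> nat \<Rightarrow> ('g \<Rightarrow> complex mat) \<Rightarrow> complex mat \<Rightarrow>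
   'g semi \<Rightarrow> ('g semi \<times> 'g semi \<Rightarrow>\<^sub>0 complex)" where
  "twisted_comult_basis G n \<rho> B a =
     super_mult G n \<rho> (super_exp G n \<rho> (- tensor_of_mat G n B))
       (super_mult G n \<rho> (super_comult_basis G n \<rho> a) (super_exp G n \<rho> (tensor_of_mat G n B)))"

text \<open>
  The terms of $\Delta^J(a)$ with even second factor are kept; those with odd second factor
  are multiplied by $-(-1)^{p(a)}(u \otimes 1)$.
\<close>

definition A_comult_basis ::
  "('g, 'm) monoid_scheme \<Rightarrow> nat \<Rightarrow> ('g \<Rightarrow> complex mat) \<Rightarrow> 'g \<Rightarrow> complex mat \<Rightarrow>
   'g semi \<Rightarrow> ('g semi \<times> 'g semi \<Rightarrow>\<^sub>0 complex)" where
  "A_comult_basis G n \<rho> u B a = lin_ext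
     (\<lambda>(c, d). if even (parity d) then basis (c, d)
        else cscale (- ((-1) ^ parity a)) (super_mult G n \<rho> (basis (({}, u), ({}, \<one>\<^bsub>G\<^esub>))) (basis (c, d))))
     (twisted_comult_basis G n \<rho> B a)"

definition A_hopf ::
  "('g, 'm) monoid_scheme \<Rightarrow> nat \<Rightarrow> ('g \<Rightarrow> complex mat) \<Rightarrow> 'g \<Rightarrow> complex mat \<Rightarrow> ('g semi \<Rightarrow>\<^sub>0 complex) hopf" where
  "A_hopf G n \<rho> u B = \<lparr>
     carrier = {p. Poly_Mapping.keys p \<subseteq> Pow {..<n} \<times> carrier G},
     monoid.mult = bilin_ext (semi_mult_basis G n \<rho>),
     one = basis ({}, \<one>\<^bsub>G\<^esub>), zero = 0, add = (+), smult = cscale,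
     comult = (\<lambda>p. push (\<lambda>(c, d). [basis c, basis d]) (lin_ext (A_comult_basis G n \<rho> u B) p)),
     counit = lin_form (\<lambda>(S, g). if S = {} then 1 else 0)\<rparr>"

text \<open>
  The data \<open>(G, V, u)\<close>: a finite group, a finite-dimensional representation, and a central element
  of order 2 acting by $-1$.
\<close>

definition super_datum :: "('g, 'm) monoid_scheme \<Rightarrow> nat \<Rightarrow> ('g \<Rightarrow> complex mat) \<Rightarrow> 'g \<Rightarrow> bool" where
  "super_datum G n \<rho> u \<longleftrightarrow>
     group G \<and> finite (carrier G) \<and> representation G n \<rho> \<and>
     u \<in> carrier G \<and> (\<forall>g\<in>carrier G. u \<otimes>\<^bsub>G\<^esub> g = g \<otimes>\<^bsub>G\<^esub> u) \<and>
     group.ord G u = 2 \<and> \<rho> u = - 1\<^sub>m n"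

text \<open>The symmetric tensors in $V \otimes V$, as coefficient matrices.\<close>

definition sym_tensors :: "nat \<Rightarrow> complex mat set" where
  "sym_tensors n = {B \<in> carrier_mat n n. transpose_mat B = B}"

end

theory Submission
  imports Defs
begin

text \<open>
  Let \<open>G\<close> be the dual of \<open>\<Gamma>\<close> with pairing \<open>\<beta>\<close>, let \<open>V\<close> be the sum of the two
  characters \<open>\<chi>\<^sub>i = \<beta> _ g\<^sub>i\<close> of \<open>G\<close>, and let \<open>u\<close> be \<open>\<psi>\<close>, viewed as an element of \<open>G\<close>. The twisted coproduct
  of \<open>g \<in> G\<close> contains the terms \<open>B\<^sub>i\<^sub>j (\<chi>\<^sub>i(g) \<chi>\<^sub>j(g) - 1) e\<^sub>i u g \<otimes> e\<^sub>j g\<close>. Hence the characters of \<open>G\<close> and the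
  linear forms dual to \<open>e\<^sub>1 G\<close> and \<open>e\<^sub>2 G\<close> satisfy the relations of \<open>H(\<lambda>\<^sub>1, \<lambda>\<^sub>2, \<lambda>\<^sub>3)\<close> in the dual
  of \<open>A(G, V, u, B)\<close> when \<open>\<lambda>\<^sub>1 = - B\<^sub>1\<^sub>1\<close>, \<open>\<lambda>\<^sub>2 = - B\<^sub>2\<^sub>2\<close> and \<open>\<lambda>\<^sub>3 = - 2 B\<^sub>1\<^sub>2\<close>. The words \<open>\<gamma>\<close>, \<open>\<gamma> x\<^sub>1\<close>, \<open>\<gamma> x\<^sub>2\<close>,
  \<open>\<gamma> x\<^sub>1 x\<^sub>2\<close> span modulo the relations, and by Fourier inversion on \<open>G\<close> their images form a basis of
  the dual, so the resulting algebra map is an isomorphism. A tensor over either algebra vanishes iff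
  it vanishes at all tuples of basis elements of \<open>A\<close>; this reduces all axioms of a Hopf algebra,
  for both sides, to identities between the structure constants of \<open>A\<close>.
\<close>

section \<open>Linear forms on formal linear combinations\<close>

text \<open>The obstacle is that a presentation gives only an upper bound: rewriting shows that the
  normal words span the quotient, not that they are independent. Independence comes from the dual of
  \<open>A\<close>, where the coefficients of a combination of normal words can be read off from its
  values. This replaces a confluence argument for the relations and identifies the ideal of
  relations with the kernel of evaluation. The second obstacle is that both coproducts involve an
  arbitrary choice: of a representative of a coset in the presented algebra, of a representing
  tensor in the dual. Each chosen tensor is therefore only ever known through its values at pairs
  \<open>(a, b)\<close> of basis elements of \<open>A\<close>, and these equal the value of the
  element at the product of \<open>a\<close> and \<open>b\<close>. This takes the place of a direct
  check that the ideal is a biideal, and the same general argument then serves both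
  algebras.\<close>

lemma lookup_cscale [simp]: "Poly_Mapping.lookup (cscale c p) a = c * Poly_Mapping.lookup p a"
  by (simp add: cscale_def map.rep_eq when_def)

lemma lin_form_superset:
  assumes "finite A" "Poly_Mapping.keys p \<subseteq> A"
  shows "lin_form F p = (\<Sum>a\<in>A. Poly_Mapping.lookup p a * F a)"
  unfolding lin_form_def by (rule sum.mono_neutral_left) (use assms in \<open>auto simp: in_keys_iff\<close>)

lemma lin_form_zero [simp]: "lin_form F 0 = 0"
  by (simp add: lin_form_def)

lemma lin_form_add [simp]: "lin_form F (p + q) = lin_form F p + lin_form F q"
proof -
  have "finite (Poly_Mapping.keys p \<union> Poly_Mapping.keys q)" by simp
  then show ?thesis
    using keys_add[of p q]
    by (simp add: lin_form_superset[of "Poly_Mapping.keys p \<union> Poly_Mapping.keys q"] lookup_add sum.distrib distrib_right)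
qed

lemma lin_form_cscale [simp]: "lin_form F (cscale c p) = c * lin_form F p"
proof -
  have "Poly_Mapping.keys (cscale c p) \<subseteq> Poly_Mapping.keys p"
    by (auto simp: in_keys_iff)
  then show ?thesis
    by (simp add: lin_form_superset[of "Poly_Mapping.keys p"] sum_distrib_left mult.assoc)
qed

lemma lin_form_single [simp]: "lin_form F (Poly_Mapping.single a c) = c * F a"
  by (simp add: lin_form_def)

lemma lin_form_uminus [simp]: "lin_form F (- p) = - lin_form F p"
proof -
  have "lin_form F (- p) + lin_form F p = 0"
    by (simp flip: lin_form_add)
  then show ?thesis
    by (simp add: eq_neg_iff_add_eq_0)
qed

lemma lin_form_diff [simp]: "lin_form F (p - q) = lin_form F p - lin_form F q"
  using lin_form_add[of F p "- q"] by simp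

lemma lin_form_sum [simp]: "lin_form F (\<Sum>i\<in>I. p i) = (\<Sum>i\<in>I. lin_form F (p i))"
  by (induction I rule: infinite_finite_induct) auto

lemma lin_form_lin_ext [simp]: "lin_form F (lin_ext f p) = lin_form (\<lambda>a. lin_form F (f a)) p"
  by (simp add: lin_ext_def) (simp add: lin_form_def)

lemma lin_form_push [simp]: "lin_form F (push f p) = lin_form (\<lambda>a. F (f a)) p"
  by (simp add: push_def)

lemma lin_form_bilin_ext [simp]:
  "lin_form F (bilin_ext f p q) = lin_form (\<lambda>a. lin_form (\<lambda>b. lin_form F (f a b)) q) p"
  by (simp add: bilin_ext_def)

lemma lin_form_fun_add: "lin_form (\<lambda>a. F a + G a) p = lin_form F p + lin_form G p"
  by (simp add: lin_form_def sum.distrib distrib_left)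

lemma lin_form_fun_mult: "lin_form (\<lambda>a. c * F a) p = c * lin_form F p"
  by (simp add: lin_form_def sum_distrib_left mult.left_commute)

lemma lin_form_fun_mult_right: "lin_form (\<lambda>a. F a * c) p = lin_form F p * c"
  by (simp add: lin_form_def sum_distrib_right mult.assoc)

lemma lin_form_swap:
  "lin_form (\<lambda>a. lin_form (\<lambda>b. Q a b) q) p = lin_form (\<lambda>b. lin_form (\<lambda>a. Q a b) p) q"
  unfolding lin_form_def
  by (simp add: sum_distrib_left sum_distrib_right mult_ac) (rule sum.swap)

lemma lin_form_mult:
  "lin_form F p * lin_form G q = lin_form (\<lambda>a. lin_form (\<lambda>b. F a * G b) q) p"
  by (simp add: lin_form_fun_mult lin_form_fun_mult_right)

lemma lin_form_swap3:
  "lin_form (\<lambda>x. lin_form (\<lambda>y. lin_form (\<lambda>z. Q x y z) (r y)) q) p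
    = lin_form (\<lambda>y. lin_form (\<lambda>z. lin_form (\<lambda>x. Q x y z) p) (r y)) q"
  by (subst lin_form_swap) (simp only: lin_form_swap[where p = p])

lemma lin_form_rotate:
  "lin_form (\<lambda>x. lin_form (\<lambda>y. lin_form (\<lambda>z. Q x y z) r) q) p
    = lin_form (\<lambda>z. lin_form (\<lambda>x. lin_form (\<lambda>y. Q x y z) q) p) r"
  by (simp only: lin_form_swap[where p = q and q = r] lin_form_swap[where p = p and q = r])

text \<open>Needed whenever a product is compared with a coproduct: the two sums over factors of
  elements and the two sums over \<open>D a\<close> and \<open>D b\<close> trade places.\<close>

lemma lin_form_swap4:
  "lin_form (\<lambda>x. lin_form (\<lambda>y. lin_form (\<lambda>a. lin_form (\<lambda>b. Q x y a b) q') p') q) p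
    = lin_form (\<lambda>a. lin_form (\<lambda>b. lin_form (\<lambda>x. lin_form (\<lambda>y. Q x y a b) q) p) q') p'"
  by (simp only: lin_form_swap[where p = q and q = p'] lin_form_swap[where p = q and q = q']
      lin_form_swap[where p = p and q = p'] lin_form_swap[where p = p and q = q'])

lemma lin_form_cong:
  "(\<And>a. a \<in> Poly_Mapping.keys p \<Longrightarrow> F a = G a) \<Longrightarrow> lin_form F p = lin_form G p"
  by (simp add: lin_form_def)

lemma lin_form_delta: "lin_form (\<lambda>a. if a = k then 1 else 0) p = Poly_Mapping.lookup p k"
  by (auto simp: lin_form_def if_distrib in_keys_iff cong: if_cong)

text \<open>The coordinate functionals already separate points. Since \<open>lin_form\<close> of
  every linear operation is computed by simp rules, this turns identities of formal combinations
  into identities of complex numbers.\<close>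

lemma poly_mapping_eqI_lin_form:
  assumes "\<And>F. lin_form F p = lin_form F q"
  shows "p = q"
proof (rule poly_mapping_eqI)
  fix k
  show "Poly_Mapping.lookup p k = Poly_Mapping.lookup q k"
    using assms[of "\<lambda>a. if a = k then 1 else 0"] by (simp add: lin_form_delta)
qed

lemma keys_subset_iff_lookup:
  "Poly_Mapping.keys p \<subseteq> A \<longleftrightarrow> (\<forall>k. k \<notin> A \<longrightarrow> Poly_Mapping.lookup p k = 0)"
  by (auto simp: in_keys_iff)

text \<open>Bounds a support through an evaluation formula, so that the closure properties of
  \<open>m\<close>, \<open>D\<close> and \<open>ant\<close> can be read off from their tables of
  structure constants.\<close>

lemma keys_subsetI_lin_form:
  assumes "\<And>F. (\<And>a. a \<in> A \<Longrightarrow> F a = 0) \<Longrightarrow> lin_form F p = 0"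
  shows "Poly_Mapping.keys p \<subseteq> A"
  unfolding keys_subset_iff_lookup
proof (intro allI impI)
  fix k assume "k \<notin> A"
  then have "lin_form (\<lambda>a. if a = k then 1 else 0) p = 0"
    by (intro assms) auto
  then show "Poly_Mapping.lookup p k = 0"
    by (simp add: lin_form_delta)
qed

lemma keys_cscale: "Poly_Mapping.keys p \<subseteq> A \<Longrightarrow> Poly_Mapping.keys (cscale c p) \<subseteq> A"
  by (auto simp: keys_subset_iff_lookup)

lemma keys_add_subset: "Poly_Mapping.keys p \<subseteq> A \<Longrightarrow> Poly_Mapping.keys q \<subseteq> A \<Longrightarrow> Poly_Mapping.keys (p + q) \<subseteq> A"
  by (auto simp: keys_subset_iff_lookup lookup_add)

lemma keys_diff_subset: "Poly_Mapping.keys p \<subseteq> A \<Longrightarrow> Poly_Mapping.keys q \<subseteq> A \<Longrightarrow> Poly_Mapping.keys (p - q) \<subseteq> A"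
  by (auto simp: keys_subset_iff_lookup lookup_minus)

lemma keys_uminus_subset: "Poly_Mapping.keys p \<subseteq> A \<Longrightarrow> Poly_Mapping.keys (- p) \<subseteq> A"
  by (auto simp: keys_subset_iff_lookup)

lemma keys_sum_subset: "(\<And>i. i \<in> I \<Longrightarrow> Poly_Mapping.keys (p i) \<subseteq> A) \<Longrightarrow> Poly_Mapping.keys (\<Sum>i\<in>I. p i) \<subseteq> A"
  by (auto simp: keys_subset_iff_lookup lookup_sum intro!: sum.neutral)

lemma keys_lin_ext_subset:
  "(\<And>a. a \<in> Poly_Mapping.keys p \<Longrightarrow> Poly_Mapping.keys (f a) \<subseteq> A) \<Longrightarrow> Poly_Mapping.keys (lin_ext f p) \<subseteq> A"
  unfolding lin_ext_def by (intro keys_sum_subset keys_cscale)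

lemma keys_bilin_ext_subset:
  "(\<And>a b. a \<in> Poly_Mapping.keys p \<Longrightarrow> b \<in> Poly_Mapping.keys q \<Longrightarrow> Poly_Mapping.keys (f a b) \<subseteq> A) \<Longrightarrow> Poly_Mapping.keys (bilin_ext f p q) \<subseteq> A"
  unfolding bilin_ext_def by (intro keys_lin_ext_subset)

lemma keys_push_subset: "f ` Poly_Mapping.keys p \<subseteq> A \<Longrightarrow> Poly_Mapping.keys (push f p) \<subseteq> A"
  unfolding push_def by (rule keys_lin_ext_subset) (auto split: if_splits)

lemma cscale_one [simp]: "cscale 1 p = p"
  by (rule poly_mapping_eqI_lin_form) simp

lemma cscale_zero [simp]: "cscale 0 p = 0" "cscale c 0 = 0"
  by (rule poly_mapping_eqI_lin_form, simp)+

lemma cscale_minus_one: "cscale (- 1) p = - p"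
  by (rule poly_mapping_eqI_lin_form) simp

lemma push_simps [simp]:
  "push f (p + q) = push f p + push f q" "push f (p - q) = push f p - push f q"
  "push f (cscale c p) = cscale c (push f p)" "push f (basis a) = basis (f a)"
  by (rule poly_mapping_eqI_lin_form, simp)+

lemma poly_mapping_expand: "p = (\<Sum>a\<in>Poly_Mapping.keys p. cscale (Poly_Mapping.lookup p a) (basis a))"
  by (rule poly_mapping_eqI_lin_form) (simp, simp only: lin_form_def)

section \<open>Duals of Hopf algebras given by structure constants\<close>

definition structure_hopf ::
  "'a set \<Rightarrow> ('a \<Rightarrow> 'a \<Rightarrow> 'a \<Rightarrow>\<^sub>0 complex) \<Rightarrow> 'a \<Rightarrow> ('a \<Rightarrow> 'a \<times> 'a \<Rightarrow>\<^sub>0 complex) \<Rightarrow> ('a \<Rightarrow> complex) \<Rightarrow>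
   ('a \<Rightarrow>\<^sub>0 complex) hopf" where
  "structure_hopf X m i D e = \<lparr>
     carrier = {p. Poly_Mapping.keys p \<subseteq> X}, monoid.mult = bilin_ext m, one = basis i, zero = 0, add = (+), smult = cscale,
     comult = (\<lambda>p. push (\<lambda>(c, d). [basis c, basis d]) (lin_ext D p)), counit = lin_form e\<rparr>"

text \<open>The pure tensor of the functionals \<open>E x\<close> for \<open>x\<close> in the first
  list, evaluated at the pure tensor given by the second. The value 0 for lists of different lengths
  is a mere default: the lists always have the same length where it is applied.\<close>

fun tensor_eval :: "('a \<Rightarrow> 'b \<Rightarrow> complex) \<Rightarrow> 'a list \<Rightarrow> 'b list \<Rightarrow> complex" where
  "tensor_eval E [] [] = 1"
| "tensor_eval E (x # xs) (z # zs) = E x z * tensor_eval E xs zs"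
| "tensor_eval E _ _ = 0"

text \<open>
  The axioms are stated by testing against arbitrary functions on the basis, that is, in terms of the
  product of linear forms.
\<close>

locale hopf_structure =
  fixes X :: "'a set" and m :: "'a \<Rightarrow> 'a \<Rightarrow> 'a \<Rightarrow>\<^sub>0 complex" and i :: 'a
    and D :: "'a \<Rightarrow> 'a \<times> 'a \<Rightarrow>\<^sub>0 complex" and e :: "'a \<Rightarrow> complex" and ant :: "'a \<Rightarrow> 'a \<Rightarrow>\<^sub>0 complex"
    and conv :: "('a \<Rightarrow> complex) \<Rightarrow> ('a \<Rightarrow> complex) \<Rightarrow> 'a \<Rightarrow> complex"
  defines "conv \<equiv> \<lambda>F G a. lin_form (\<lambda>(c, d). F c * G d) (D a)"
  assumes finite_X: "finite X" and i_in: "i \<in> X"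
    and keys_m: "\<lbrakk>a \<in> X; b \<in> X\<rbrakk> \<Longrightarrow> Poly_Mapping.keys (m a b) \<subseteq> X"
    and keys_D: "a \<in> X \<Longrightarrow> Poly_Mapping.keys (D a) \<subseteq> X \<times> X"
    and keys_ant: "a \<in> X \<Longrightarrow> Poly_Mapping.keys (ant a) \<subseteq> X"
    and conv_assoc: "a \<in> X \<Longrightarrow> conv (conv F G) H a = conv F (conv G H) a"
    and conv_e: "a \<in> X \<Longrightarrow> conv e F a = F a" "a \<in> X \<Longrightarrow> conv F e a = F a"
    and prod_assoc: "\<lbrakk>a \<in> X; b \<in> X; c \<in> X\<rbrakk> \<Longrightarrow>
          lin_form (\<lambda>x. lin_form F (m x c)) (m a b) = lin_form (\<lambda>x. lin_form F (m a x)) (m b c)"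
    and m_i: "a \<in> X \<Longrightarrow> lin_form F (m i a) = F a" "a \<in> X \<Longrightarrow> lin_form F (m a i) = F a"
    and conv_m: "\<lbrakk>a \<in> X; b \<in> X\<rbrakk> \<Longrightarrow> lin_form (conv F G) (m a b) =
          lin_form (\<lambda>(c, d). lin_form (\<lambda>(c', d'). lin_form F (m c c') * lin_form G (m d d')) (D b)) (D a)"
    and e_m: "\<lbrakk>a \<in> X; b \<in> X\<rbrakk> \<Longrightarrow> lin_form e (m a b) = e a * e b" and e_i: "e i = 1"
    and conv_i: "conv F G i = F i * G i"
    and antipode_left: "a \<in> X \<Longrightarrow>
          lin_form (\<lambda>(c, d). lin_form (\<lambda>x. lin_form F (m x d)) (ant c)) (D a) = e a * F i"
    and antipode_right: "a \<in> X \<Longrightarrow>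
          lin_form (\<lambda>(c, d). lin_form (\<lambda>x. lin_form F (m c x)) (ant d)) (D a) = e a * F i"
begin

abbreviation A where "A \<equiv> structure_hopf X m i D e"
abbreviation K where "K \<equiv> dual_hopf A"

text \<open>The value 0 off the carrier is the normalisation required by
  \<open>dual_carrier\<close>.\<close>

definition func :: "('a \<Rightarrow> complex) \<Rightarrow> ('a \<Rightarrow>\<^sub>0 complex) \<Rightarrow> complex" where
  "func F p = (if Poly_Mapping.keys p \<subseteq> X then lin_form F p else 0)"

lemma A_simps [simp]:
  "carrier A = {p. Poly_Mapping.keys p \<subseteq> X}" "monoid.mult A = bilin_ext m" "monoid.one A = basis i"
  "ring.zero A = 0" "ring.add A = (+)" "module.smult A = cscale"
  "comult A p = push (\<lambda>(c, d). [basis c, basis d]) (lin_ext D p)" "counit A = lin_form e"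
  by (simp_all add: structure_hopf_def)

lemma basis_in [simp]: "a \<in> X \<Longrightarrow> Poly_Mapping.keys (basis a) \<subseteq> X"
  by simp

lemma func_in [simp]: "func F \<in> dual_carrier A"
  by (auto simp: dual_carrier_def func_def keys_add_subset keys_cscale dest: subsetD[OF keys_add_subset] subsetD[OF keys_cscale])

lemma func_basis [simp]: "a \<in> X \<Longrightarrow> func F (basis a) = F a"
  by (simp add: func_def)

text \<open>An element of \<open>dual_carrier\<close> is only known to be additive and homogeneous
  on the carrier, so its value is computed by induction over a finite support.\<close>

lemma dual_eval:
  assumes f: "f \<in> dual_carrier A" and p: "Poly_Mapping.keys p \<subseteq> X"
  shows "f p = lin_form (\<lambda>a. f (basis a)) p"
proof -
  have add: "f (p + q) = f p + f q" if "Poly_Mapping.keys p \<subseteq> X" "Poly_Mapping.keys q \<subseteq> X" for p q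
    using f that by (simp add: dual_carrier_def)
  have scale: "f (cscale c p) = c * f p" if "Poly_Mapping.keys p \<subseteq> X" for c p
    using f that by (simp add: dual_carrier_def)
  have zero: "f 0 = 0"
    using scale[of 0 0] by simp
  have "f (\<Sum>a\<in>Y. cscale (c a) (basis a)) = (\<Sum>a\<in>Y. c a * f (basis a))" if "finite Y" "Y \<subseteq> X" for Y c
    using that
  proof (induction Y rule: finite_induct)
    case (insert y Y)
    then have "Poly_Mapping.keys (\<Sum>a\<in>Y. cscale (c a) (basis a)) \<subseteq> X"
      by (intro keys_sum_subset keys_cscale) auto
    moreover have "Poly_Mapping.keys (cscale (c y) (basis y)) \<subseteq> X"
      using insert by (intro keys_cscale) auto
    ultimately show ?case
      using insert by (simp add: add scale)
  qed (simp add: zero)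
  from this[of "Poly_Mapping.keys p" "Poly_Mapping.lookup p"] p show ?thesis
    by (subst poly_mapping_expand) (simp add: lin_form_def)
qed

lemma dual_ext:
  assumes "f \<in> dual_carrier A" "g \<in> dual_carrier A" "\<And>a. a \<in> X \<Longrightarrow> f (basis a) = g (basis a)"
  shows "f = g"
proof
  fix p
  show "f p = g p"
  proof (cases "Poly_Mapping.keys p \<subseteq> X")
    case True
    then show ?thesis
      using assms(3) unfolding dual_eval[OF assms(1) True] dual_eval[OF assms(2) True]
      by (intro lin_form_cong) auto
  next
    case False
    then show ?thesis
      using assms(1,2) by (simp add: dual_carrier_def)
  qed
qed

lemma K_simps [simp]:
  "carrier K = dual_carrier A" "monoid.one K = func e" "ring.zero K = (\<lambda>x. 0)" "ring.add K = (\<lambda>f g x. f x + g x)"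
  "module.smult K = (\<lambda>c f x. c * f x)" "counit K = (\<lambda>f. f (basis i))"
  by (simp_all add: dual_hopf_def func_def fun_eq_iff)

lemma K_mult [simp]: "f \<otimes>\<^bsub>K\<^esub> g = func (conv (\<lambda>a. f (basis a)) (\<lambda>a. g (basis a)))"
  by (simp add: dual_hopf_def func_def fun_eq_iff conv_def case_prod_unfold)

lemma K_closed [simp]:
  "f \<in> dual_carrier A \<Longrightarrow> g \<in> dual_carrier A \<Longrightarrow> (\<lambda>x. f x + g x) \<in> dual_carrier A"
  "f \<in> dual_carrier A \<Longrightarrow> (\<lambda>x. c * f x) \<in> dual_carrier A"
  "(\<lambda>x. 0) \<in> dual_carrier A"
  by (simp_all add: dual_carrier_def distrib_left)

lemma conv_cong:
  assumes "a \<in> X" "\<And>x. x \<in> X \<Longrightarrow> F x = F' x" "\<And>x. x \<in> X \<Longrightarrow> G x = G' x"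
  shows "conv F G a = conv F' G' a"
  unfolding conv_def using keys_D[of a] assms by (intro lin_form_cong) auto

lemma conv_linear:
  "conv (\<lambda>x. F x + F' x) G a = conv F G a + conv F' G a"
  "conv F (\<lambda>x. G x + G' x) a = conv F G a + conv F G' a"
  "conv (\<lambda>x. c * F x) G a = c * conv F G a"
  "conv F (\<lambda>x. c * G x) a = c * conv F G a"
  by (simp_all add: conv_def case_prod_unfold distrib_left distrib_right lin_form_fun_add mult.assoc
      mult.left_commute[of _ c] lin_form_fun_mult)

lemma ring_K: "ring K"
proof (rule ringI)
  show "abelian_group K"
  proof (rule abelian_groupI)
    fix f assume f: "f \<in> carrier K"
    then show "\<exists>g\<in>carrier K. g \<oplus>\<^bsub>K\<^esub> f = \<zero>\<^bsub>K\<^esub>"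
      by (intro bexI[of _ "\<lambda>x. - 1 * f x"]) (simp_all only: K_simps K_closed, auto)
  qed (auto simp: add_ac)
  show "monoid K"
    by (rule monoidI) (auto intro!: dual_ext simp: conv_e conv_assoc cong: conv_cong)
qed (auto intro!: dual_ext simp: conv_linear)

text \<open>The coproduct of the dual is a \<open>SOME\<close> term, so a witness has to be
  exhibited: the sum over all pairs of basis elements of the value of \<open>f\<close> at their
  product times the tensor of the two coordinate functionals. The proof uses \<open>finite_X\<close>
  here to make this a finite sum.\<close>

lemma comult_K:
  assumes f: "f \<in> dual_carrier A"
  shows "comult K f \<in> tensors K 2"
    and "\<lbrakk>a \<in> X; b \<in> X\<rbrakk> \<Longrightarrow> lin_form (\<lambda>fs. (fs ! 0) (basis a) * (fs ! 1) (basis b)) (comult K f)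
      = lin_form (\<lambda>x. f (basis x)) (m a b)"
proof -
  let ?\<delta> = "\<lambda>x. func (\<lambda>y. if y = x then 1 else 0)"
  let ?P = "\<lambda>t. (\<forall>fs\<in>Poly_Mapping.keys t. length fs = 2 \<and> set fs \<subseteq> dual_carrier A) \<and>
    (\<forall>x\<in>carrier A. \<forall>y\<in>carrier A. lin_form (\<lambda>fs. (fs ! 0) x * (fs ! 1) y) t = f (x \<otimes>\<^bsub>A\<^esub> y))"
  let ?t = "\<Sum>x\<in>X. \<Sum>y\<in>X. cscale (lin_form (\<lambda>z. f (basis z)) (m x y)) (basis [?\<delta> x, ?\<delta> y])"
  have \<delta>: "?\<delta> x p = Poly_Mapping.lookup p x" if "Poly_Mapping.keys p \<subseteq> X" for p x
    using that by (simp add: func_def lin_form_delta)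
  have eval: "lin_form (\<lambda>fs. (fs ! 0) p * (fs ! 1) q) ?t = f (bilin_ext m p q)"
    if p: "Poly_Mapping.keys p \<subseteq> X" and q: "Poly_Mapping.keys q \<subseteq> X" for p q
  proof -
    have "Poly_Mapping.keys (bilin_ext m p q) \<subseteq> X"
      using p q by (intro keys_bilin_ext_subset keys_m) auto
    then have "f (bilin_ext m p q) = lin_form (\<lambda>a. lin_form (\<lambda>b. lin_form (\<lambda>z. f (basis z)) (m a b)) q) p"
      using dual_eval[OF f, of "bilin_ext m p q"] by simp
    also have "\<dots> = (\<Sum>x\<in>X. \<Sum>y\<in>X. lin_form (\<lambda>z. f (basis z)) (m x y)
        * (Poly_Mapping.lookup p x * Poly_Mapping.lookup q y))"
      by (simp add: lin_form_superset[OF finite_X p] lin_form_superset[OF finite_X q] sum_distrib_left mult_ac)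
    finally show ?thesis
      by (simp only: lin_form_sum lin_form_cscale lin_form_single mult_1 nth_Cons_0 nth_Cons_Suc One_nat_def \<delta>[OF p] \<delta>[OF q])
  qed
  have keys: "Poly_Mapping.keys ?t \<subseteq> {fs. length fs = 2 \<and> set fs \<subseteq> dual_carrier A}"
    by (intro keys_sum_subset keys_cscale) simp
  have "?P ?t"
  proof (intro conjI ballI)
    fix x y assume "x \<in> carrier A" "y \<in> carrier A"
    then show "lin_form (\<lambda>fs. (fs ! 0) x * (fs ! 1) y) ?t = f (x \<otimes>\<^bsub>A\<^esub> y)"
      using eval[of x y] by (simp only: A_simps mem_Collect_eq)
  qed (use subsetD[OF keys] in auto)
  then have P': "?P (SOME t. ?P t)"
    by (rule someI[of ?P])
  have eq: "comult K f = (SOME t. ?P t)"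
    by (simp only: dual_hopf_def hopf.select_convs)
  have P: "?P (comult K f)"
    unfolding eq by (rule P')
  then show "comult K f \<in> tensors K 2"
    unfolding tensors_def K_simps mem_Collect_eq by (rule conjunct1)
  assume ab: "a \<in> X" "b \<in> X"
  have "lin_form (\<lambda>fs. (fs ! 0) (basis a) * (fs ! 1) (basis b)) (comult K f) = f (bilin_ext m (basis a) (basis b))"
    using P[THEN conjunct2, rule_format, of "basis a" "basis b"] ab by (simp only: A_simps mem_Collect_eq basis_in)
  also have "bilin_ext m (basis a) (basis b) = m a b"
    by (rule poly_mapping_eqI_lin_form) simp
  finally show "lin_form (\<lambda>fs. (fs ! 0) (basis a) * (fs ! 1) (basis b)) (comult K f)
      = lin_form (\<lambda>x. f (basis x)) (m a b)"
    by (simp add: dual_eval[OF f keys_m[OF ab]])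
qed

end

text \<open>A ring identified with the dual of \<open>A\<close>, whose coproduct is known only
  through its values at pairs of basis elements. It is instantiated by \<open>K\<close> itself with
  the identity and by the presented algebra with the map induced by evaluation; the Hopf axioms are
  then theorems for both.\<close>

locale dual_model = hopf_structure X m i D e ant conv
  for X :: "'a set" and m i D e ant conv +
  fixes M :: "('b, 'm) hopf_scheme" and \<phi> :: "'b \<Rightarrow> ('a \<Rightarrow>\<^sub>0 complex) \<Rightarrow> complex"
    and E :: "'a \<Rightarrow> 'b \<Rightarrow> complex"
  defines "E \<equiv> \<lambda>a z. \<phi> z (basis a)"
  assumes ring_M: "ring M" and iso: "\<phi> \<in> ring_iso M K"
    and M_smult_closed: "z \<in> carrier M \<Longrightarrow> c \<odot>\<^bsub>M\<^esub> z \<in> carrier M"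
    and \<phi>_smult: "z \<in> carrier M \<Longrightarrow> \<phi> (c \<odot>\<^bsub>M\<^esub> z) = c \<odot>\<^bsub>K\<^esub> \<phi> z"
    and M_comult: "z \<in> carrier M \<Longrightarrow> comult M z \<in> tensors M 2"
    and M_comult_eval: "\<lbrakk>z \<in> carrier M; a \<in> X; b \<in> X\<rbrakk> \<Longrightarrow>
          lin_form (\<lambda>zs. E a (zs ! 0) * E b (zs ! 1)) (comult M z) = lin_form (\<lambda>x. E x z) (m a b)"
    and M_counit: "z \<in> carrier M \<Longrightarrow> counit M z = E i z"
begin

sublocale ring M
  by (rule ring_M)

lemma \<phi>_in: "z \<in> carrier M \<Longrightarrow> \<phi> z \<in> dual_carrier A"
  using iso by (auto simp: ring_iso_def dest: ring_hom_closed)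

lemma E_simps [simp]:
  "z \<in> carrier M \<Longrightarrow> w \<in> carrier M \<Longrightarrow> E a (z \<oplus>\<^bsub>M\<^esub> w) = E a z + E a w"
  "z \<in> carrier M \<Longrightarrow> E a (c \<odot>\<^bsub>M\<^esub> z) = c * E a z"
  "a \<in> X \<Longrightarrow> z \<in> carrier M \<Longrightarrow> w \<in> carrier M \<Longrightarrow> E a (z \<otimes>\<^bsub>M\<^esub> w) = conv (\<lambda>x. E x z) (\<lambda>x. E x w) a"
  "a \<in> X \<Longrightarrow> E a \<one>\<^bsub>M\<^esub> = e a"
proof -
  have h: "\<phi> \<in> Ring.ring_hom M K"
    using iso by (simp add: ring_iso_def)
  note [simp] = ring_hom_add[OF h] ring_hom_mult[OF h] ring_hom_one[OF h]
  show "z \<in> carrier M \<Longrightarrow> w \<in> carrier M \<Longrightarrow> E a (z \<oplus>\<^bsub>M\<^esub> w) = E a z + E a w"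
    "z \<in> carrier M \<Longrightarrow> E a (c \<odot>\<^bsub>M\<^esub> z) = c * E a z"
    "a \<in> X \<Longrightarrow> z \<in> carrier M \<Longrightarrow> w \<in> carrier M \<Longrightarrow> E a (z \<otimes>\<^bsub>M\<^esub> w) = conv (\<lambda>x. E x z) (\<lambda>x. E x w) a"
    "a \<in> X \<Longrightarrow> E a \<one>\<^bsub>M\<^esub> = e a"
    by (simp_all add: E_def \<phi>_smult)
qed

lemma E_inj:
  assumes "z \<in> carrier M" "w \<in> carrier M" "\<And>a. a \<in> X \<Longrightarrow> E a z = E a w"
  shows "z = w"
proof -
  have "\<phi> z = \<phi> w"
    using assms by (intro dual_ext) (auto simp: \<phi>_in E_def)
  then show ?thesis
    using iso assms by (auto simp: ring_iso_def bij_betw_def dest: inj_onD)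
qed

definition of_vals :: "('a \<Rightarrow> complex) \<Rightarrow> 'b" where
  "of_vals F = inv_into (carrier M) \<phi> (func F)"

lemma of_vals_in [simp]: "of_vals F \<in> carrier M"
  and E_of_vals [simp]: "a \<in> X \<Longrightarrow> E a (of_vals F) = F a"
proof -
  have "func F \<in> \<phi> ` carrier M"
    using iso by (auto simp: ring_iso_def bij_betw_def)
  then show "of_vals F \<in> carrier M" "a \<in> X \<Longrightarrow> E a (of_vals F) = F a"
    by (auto simp: of_vals_def inv_into_into E_def f_inv_into_f)
qed

section \<open>Tensors are detected by their values on the basis\<close>

abbreviation dual_basis :: "'a \<Rightarrow> 'b" where
  "dual_basis x \<equiv> of_vals (\<lambda>y. if y = x then 1 else 0)"

lemma null_sum: "(\<And>j. j \<in> J \<Longrightarrow> t j \<in> tensor_null M) \<Longrightarrow> (\<Sum>j\<in>J. t j) \<in> tensor_null M"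
  by (induction J rule: infinite_finite_induct) (auto intro: tensor_null.intros)

text \<open>One factor is replaced by its expansion in the dual basis using only the multilinearity
  relations. The induction is on a set \<open>Y\<close> outside of which all coordinates of
  \<open>z\<close> vanish, one coordinate being split off at a time.\<close>

lemma expand_factor:
  assumes "finite Y" "Y \<subseteq> X" "z \<in> carrier M" "\<And>x. x \<in> X - Y \<Longrightarrow> E x z = 0"
    and ps: "set ps \<subseteq> carrier M" and qs: "set qs \<subseteq> carrier M"
  shows "basis (ps @ z # qs) - (\<Sum>x\<in>Y. cscale (E x z) (basis (ps @ dual_basis x # qs))) \<in> tensor_null M"
  using assms(1-4)
proof (induction Y arbitrary: z rule: finite_induct)
  case empty
  \<comment> \<open>All coordinates of \<open>z\<close> vanish, hence \<open>z\<close> is fixed by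
    scaling with 0, and the homogeneity relation for the scalar 0 says that the tensor is
    null.\<close>
  then have "0 \<odot>\<^bsub>M\<^esub> z = z"
    by (intro E_inj) (auto simp: M_smult_closed)
  with tensor_null.intros(5)[OF ps qs empty(2), of 0] show ?case
    by simp
next
  case (insert y Y)
  \<comment> \<open>\<open>z'\<close> is \<open>z\<close> with its coordinate at \<open>y\<close>
    erased.\<close>
  define z' where "z' = of_vals (\<lambda>x. if x = y then 0 else E x z)"
  have z'_in: "z' \<in> carrier M"
    by (simp add: z'_def)
  let ?w = "E y z \<odot>\<^bsub>M\<^esub> dual_basis y"
  let ?b = "\<lambda>x. basis (ps @ x # qs)"
  have w_in: "?w \<in> carrier M"
    by (simp add: M_smult_closed)
  have z: "z' \<oplus>\<^bsub>M\<^esub> ?w = z"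
    using insert.prems z'_in w_in by (intro E_inj) (auto simp: z'_def)
  have "?b z' - (\<Sum>x\<in>Y. cscale (E x z') (?b (dual_basis x))) \<in> tensor_null M"
    using insert.prems z'_in by (intro insert.IH) (auto simp: z'_def)
  moreover have "(\<Sum>x\<in>Y. cscale (E x z') (?b (dual_basis x))) = (\<Sum>x\<in>Y. cscale (E x z) (?b (dual_basis x)))"
    using insert by (intro sum.cong) (auto simp: z'_def)
  moreover have "?b z - ?b z' - ?b ?w \<in> tensor_null M"
    using tensor_null.intros(4)[OF ps qs z'_in w_in] z by simp
  moreover have "?b ?w - cscale (E y z) (?b (dual_basis y)) \<in> tensor_null M"
    by (rule tensor_null.intros(5)[OF ps qs]) simp
  ultimately have "(?b z - ?b z' - ?b ?w) + (?b ?w - cscale (E y z) (?b (dual_basis y)))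
      + (?b z' - (\<Sum>x\<in>Y. cscale (E x z) (?b (dual_basis x)))) \<in> tensor_null M"
    by (intro tensor_null.intros(2)) (assumption | simp only:)+
  then show ?case
    using insert by (simp add: algebra_simps)
qed

text \<open>The prefix \<open>ps\<close> collects the factors that are already expanded. In the
  induction step \<open>?t\<close> adds the expansion of the head to the expansions of the tail
  behind each dual basis vector, with the prefix longer by one.\<close>

lemma expand_tensor:
  assumes "set zs \<subseteq> carrier M" "set ps \<subseteq> carrier M"
  shows "basis (ps @ zs) - (\<Sum>xs | set xs \<subseteq> X \<and> length xs = length zs.
           cscale (tensor_eval E xs zs) (basis (ps @ map dual_basis xs))) \<in> tensor_null M"
  using assms
proof (induction zs arbitrary: ps)
  case Nil
  have "{xs. set xs \<subseteq> X \<and> length xs = 0} = {[]}"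
    by auto
  then show ?case
    by (simp add: tensor_null.intros)
next
  case (Cons z zs)
  let ?L = "{xs. set xs \<subseteq> X \<and> length xs = length zs}"
  let ?b = "\<lambda>x xs. basis (ps @ dual_basis x # map dual_basis xs)"
  have L: "{xs. set xs \<subseteq> X \<and> length xs = length (z # zs)} = (\<lambda>(x, xs). x # xs) ` (X \<times> ?L)"
    by (auto simp: length_Suc_conv image_iff)
  have inj: "inj_on (\<lambda>(x, xs). x # xs) (X \<times> ?L)"
    by (auto simp: inj_on_def)
  let ?t = "(basis (ps @ z # zs) - (\<Sum>x\<in>X. cscale (E x z) (basis (ps @ dual_basis x # zs))))
      + (\<Sum>x\<in>X. cscale (E x z) (basis ((ps @ [dual_basis x]) @ zs)
           - (\<Sum>xs\<in>?L. cscale (tensor_eval E xs zs) (basis ((ps @ [dual_basis x]) @ map dual_basis xs)))))"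
  have null: "?t \<in> tensor_null M"
    using Cons.prems finite_X
    by (intro tensor_null.intros(2) expand_factor null_sum tensor_null.intros(3) Cons.IH) auto
  have eq1: "?t = basis (ps @ z # zs)
      - (\<Sum>x\<in>X. \<Sum>xs\<in>?L. cscale (tensor_eval E (x # xs) (z # zs)) (?b x xs))"
    by (rule poly_mapping_eqI_lin_form) (simp add: sum_subtractf sum_distrib_left algebra_simps)
  have eq2: "(\<Sum>x\<in>X. \<Sum>xs\<in>?L. cscale (tensor_eval E (x # xs) (z # zs)) (?b x xs))
      = (\<Sum>xs | set xs \<subseteq> X \<and> length xs = length (z # zs).
           cscale (tensor_eval E xs (z # zs)) (basis (ps @ map dual_basis xs)))"
    unfolding L by (subst sum.reindex[OF inj]) (simp add: sum.cartesian_product case_prod_unfold)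
  show ?case
    using null unfolding eq1 eq2 .
qed

text \<open>Every list in \<open>t\<close> equals its expansion up to a null element. After
  collecting terms, the coefficient of the dual basis tensor indexed by \<open>xs\<close> is the
  value of \<open>t\<close> at \<open>xs\<close>, hence 0. Membership in an inductively generated
  span thus becomes a numerical condition.\<close>

lemma tensor_nullI:
  assumes t: "t \<in> tensors M k"
    and zero: "\<And>xs. set xs \<subseteq> X \<Longrightarrow> length xs = k \<Longrightarrow> lin_form (tensor_eval E xs) t = 0"
  shows "t \<in> tensor_null M"
proof -
  let ?L = "{xs. set xs \<subseteq> X \<and> length xs = k}"
  let ?l = "Poly_Mapping.lookup t"
  let ?t = "\<Sum>zs\<in>Poly_Mapping.keys t. cscale (?l zs)
      (basis ([] @ zs) - (\<Sum>xs | set xs \<subseteq> X \<and> length xs = length zs.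
           cscale (tensor_eval E xs zs) (basis ([] @ map dual_basis xs))))"
  have null: "?t \<in> tensor_null M"
    using t by (intro null_sum tensor_null.intros(3) expand_tensor) (auto simp: tensors_def)
  have "?t = (\<Sum>zs\<in>Poly_Mapping.keys t. cscale (?l zs)
      (basis zs - (\<Sum>xs\<in>?L. cscale (tensor_eval E xs zs) (basis (map dual_basis xs)))))"
    using t by (intro sum.cong) (auto simp: tensors_def)
  also have "\<dots> = (\<Sum>zs\<in>Poly_Mapping.keys t. cscale (?l zs) (basis zs))
      - (\<Sum>xs\<in>?L. cscale (lin_form (tensor_eval E xs) t) (basis (map dual_basis xs)))"
    by (rule poly_mapping_eqI_lin_form)
      (simp add: lin_form_def[of _ t] right_diff_distrib sum_subtractf sum_distrib_left sum_distrib_right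
        mult_ac sum.swap[of _ "Poly_Mapping.keys t" ?L])
  also have "(\<Sum>xs\<in>?L. cscale (lin_form (tensor_eval E xs) t) (basis (map dual_basis xs))) = 0"
    by (intro sum.neutral) (auto simp: zero)
  finally have "?t = t"
    by (simp flip: poly_mapping_expand)
  with null show ?thesis
    by simp
qed

lemma tensorsI: "Poly_Mapping.keys t \<subseteq> {xs. length xs = k \<and> set xs \<subseteq> carrier M} \<Longrightarrow> t \<in> tensors M k"
  by (auto simp: tensors_def)

lemma tensors_keys: "t \<in> tensors M k \<Longrightarrow> Poly_Mapping.keys t \<subseteq> {xs. length xs = k \<and> set xs \<subseteq> carrier M}"
  by (auto simp: tensors_def)

lemma basis_tensors: "length zs = k \<Longrightarrow> set zs \<subseteq> carrier M \<Longrightarrow> basis zs \<in> tensors M k"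
  by (simp add: tensors_def)

lemma add_tensors: "s \<in> tensors M k \<Longrightarrow> t \<in> tensors M k \<Longrightarrow> s + t \<in> tensors M k"
  by (rule tensorsI[OF keys_add_subset[OF tensors_keys tensors_keys]])

lemma cscale_tensors: "t \<in> tensors M k \<Longrightarrow> cscale c t \<in> tensors M k"
  by (rule tensorsI[OF keys_cscale[OF tensors_keys]])

lemma lin_ext_tensors: "(\<And>a. a \<in> Poly_Mapping.keys p \<Longrightarrow> f a \<in> tensors M k) \<Longrightarrow> lin_ext f p \<in> tensors M k"
  by (rule tensorsI[OF keys_lin_ext_subset[OF tensors_keys]])

lemma push_tensors:
  "(\<And>a. a \<in> Poly_Mapping.keys p \<Longrightarrow> length (f a) = k \<and> set (f a) \<subseteq> carrier M) \<Longrightarrow> push f p \<in> tensors M k"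
  by (intro tensorsI keys_push_subset) auto

lemma diff_tensors: "s \<in> tensors M k \<Longrightarrow> t \<in> tensors M k \<Longrightarrow> s - t \<in> tensors M k"
  by (rule tensorsI[OF keys_diff_subset[OF tensors_keys tensors_keys]])

text \<open>The criterion is restated for one, two and three factors in terms of
  \<open>zs ! j\<close>, the form in which the Hopf axioms access the factors.\<close>

lemma tensor_eqI1:
  assumes "s \<in> tensors M 1" "t \<in> tensors M 1"
    and "\<And>a. a \<in> X \<Longrightarrow> lin_form (\<lambda>zs. E a (zs ! 0)) s = lin_form (\<lambda>zs. E a (zs ! 0)) t"
  shows "tensor_eq M s t"
  unfolding tensor_eq_def
proof (rule tensor_nullI[OF diff_tensors[OF assms(1,2)]])
  fix xs assume xs: "set xs \<subseteq> X" "length xs = 1"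
  then have "\<And>j. j < 1 \<Longrightarrow> xs ! j \<in> X"
    by (metis nth_mem subsetD)
  have "lin_form (tensor_eval E xs) r = lin_form (\<lambda>zs. E (xs ! 0) (zs ! 0)) r" if "r \<in> tensors M 1" for r
    using that xs by (intro lin_form_cong) (auto simp: tensors_def length_Suc_conv)
  with assms \<open>\<And>j. j < 1 \<Longrightarrow> xs ! j \<in> X\<close> show "lin_form (tensor_eval E xs) (s - t) = 0"
    by simp
qed

lemma tensor_eqI2:
  assumes "s \<in> tensors M 2" "t \<in> tensors M 2"
    and "\<And>a b. a \<in> X \<Longrightarrow> b \<in> X \<Longrightarrow>
      lin_form (\<lambda>zs. E a (zs ! 0) * E b (zs ! 1)) s = lin_form (\<lambda>zs. E a (zs ! 0) * E b (zs ! 1)) t"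
  shows "tensor_eq M s t"
  unfolding tensor_eq_def
proof (rule tensor_nullI[OF diff_tensors[OF assms(1,2)]])
  fix xs assume xs: "set xs \<subseteq> X" "length xs = 2"
  then have "\<And>j. j < 2 \<Longrightarrow> xs ! j \<in> X"
    by (metis nth_mem subsetD)
  have "lin_form (tensor_eval E xs) r = lin_form (\<lambda>zs. E (xs ! 0) (zs ! 0) * E (xs ! 1) (zs ! 1)) r"
    if "r \<in> tensors M 2" for r
    using that xs by (intro lin_form_cong) (auto simp: tensors_def length_Suc_conv numeral_2_eq_2)
  with assms \<open>\<And>j. j < 2 \<Longrightarrow> xs ! j \<in> X\<close> show "lin_form (tensor_eval E xs) (s - t) = 0"
    by simp
qed

lemma tensor_eqI3:
  assumes "s \<in> tensors M 3" "t \<in> tensors M 3"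
    and "\<And>a b c. a \<in> X \<Longrightarrow> b \<in> X \<Longrightarrow> c \<in> X \<Longrightarrow>
      lin_form (\<lambda>zs. E a (zs ! 0) * E b (zs ! 1) * E c (zs ! 2)) s
      = lin_form (\<lambda>zs. E a (zs ! 0) * E b (zs ! 1) * E c (zs ! 2)) t"
  shows "tensor_eq M s t"
  unfolding tensor_eq_def
proof (rule tensor_nullI[OF diff_tensors[OF assms(1,2)]])
  fix xs assume xs: "set xs \<subseteq> X" "length xs = 3"
  then have "\<And>j. j < 3 \<Longrightarrow> xs ! j \<in> X"
    by (metis nth_mem subsetD)
  have "lin_form (tensor_eval E xs) r
      = lin_form (\<lambda>zs. E (xs ! 0) (zs ! 0) * E (xs ! 1) (zs ! 1) * E (xs ! 2) (zs ! 2)) r"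
    if "r \<in> tensors M 3" for r
    using that xs by (intro lin_form_cong) (auto simp: tensors_def length_Suc_conv numeral_3_eq_3 numeral_2_eq_2)
  with assms \<open>\<And>j. j < 3 \<Longrightarrow> xs ! j \<in> X\<close> show "lin_form (tensor_eval E xs) (s - t) = 0"
    by simp
qed

section \<open>The Hopf axioms for a model of the dual\<close>

lemma tensors2D:
  assumes "t \<in> tensors M 2" "zs \<in> Poly_Mapping.keys t"
  obtains x y where "zs = [x, y]" "x \<in> carrier M" "y \<in> carrier M"
  using assms by (auto simp: tensors_def length_Suc_conv numeral_2_eq_2)

lemma comult_keys:
  assumes "z \<in> carrier M" "zs \<in> Poly_Mapping.keys (comult M z)"
  obtains x y where "zs = [x, y]" "x \<in> carrier M" "y \<in> carrier M"
  using assms M_comult tensors2D by blast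

lemma comult_cong:
  assumes "z \<in> carrier M" "\<And>x y. x \<in> carrier M \<Longrightarrow> y \<in> carrier M \<Longrightarrow> F [x, y] = G [x, y]"
  shows "lin_form F (comult M z) = lin_form G (comult M z)"
  using assms by (intro lin_form_cong) (auto elim: comult_keys)

text \<open>At \<open>(a, b)\<close> the right-hand side is a fourfold sum. Exchanging the order of
  summation collects the values of the coproducts of \<open>z\<close> and \<open>w\<close> at the
  components of \<open>D a\<close> and \<open>D b\<close>; what remains is \<open>conv_m\<close>,
  the multiplicativity of the coproduct of \<open>A\<close>, which is self-dual.\<close>

lemma tensor_mult_comult:
  assumes z: "z \<in> carrier M" and w: "w \<in> carrier M"
  shows "tensor_eq M (comult M (z \<otimes>\<^bsub>M\<^esub> w)) (tensor_mult M (comult M z) (comult M w))"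
proof (rule tensor_eqI2)
  show "comult M (z \<otimes>\<^bsub>M\<^esub> w) \<in> tensors M 2"
    using z w by (intro M_comult) simp
  show "tensor_mult M (comult M z) (comult M w) \<in> tensors M 2"
    unfolding tensor_mult_def
    by (intro tensorsI keys_bilin_ext_subset) (auto elim!: comult_keys[OF z] comult_keys[OF w])
  fix a b assume a: "a \<in> X" and b: "b \<in> X"
  let ?s = "comult M z" and ?t = "comult M w"
  have "lin_form (\<lambda>zs. E a (zs ! 0) * E b (zs ! 1)) (tensor_mult M ?s ?t)
      = lin_form (\<lambda>xs. lin_form (\<lambda>ys. conv (\<lambda>c. E c (xs ! 0)) (\<lambda>c. E c (ys ! 0)) a
          * conv (\<lambda>c. E c (xs ! 1)) (\<lambda>c. E c (ys ! 1)) b) ?t) ?s"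
    unfolding tensor_mult_def using a b
    by (simp, intro comult_cong[OF z] comult_cong[OF w]) simp
  also have "\<dots> = lin_form (\<lambda>xs. lin_form (\<lambda>ys. lin_form (\<lambda>p. lin_form (\<lambda>q.
      (E (fst p) (xs ! 0) * E (fst q) (xs ! 1)) * (E (snd p) (ys ! 0) * E (snd q) (ys ! 1))) (D b)) (D a)) ?t) ?s"
    by (simp add: conv_def case_prod_unfold lin_form_mult mult_ac)
  also have "\<dots> = lin_form (\<lambda>p. lin_form (\<lambda>q. lin_form (\<lambda>xs. lin_form (\<lambda>ys.
      (E (fst p) (xs ! 0) * E (fst q) (xs ! 1)) * (E (snd p) (ys ! 0) * E (snd q) (ys ! 1))) ?t) ?s) (D b)) (D a)"
    by (rule lin_form_swap4)
  also have "\<dots> = lin_form (\<lambda>p. lin_form (\<lambda>q. lin_form (\<lambda>x. E x z) (m (fst p) (fst q))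
      * lin_form (\<lambda>x. E x w) (m (snd p) (snd q))) (D b)) (D a)"
    by (intro lin_form_cong) (auto simp: M_comult_eval[OF z, simplified] M_comult_eval[OF w, simplified]
        simp flip: lin_form_mult dest!: subsetD[OF keys_D[OF a]] subsetD[OF keys_D[OF b]])
  also have "\<dots> = lin_form (conv (\<lambda>x. E x z) (\<lambda>x. E x w)) (m a b)"
    by (simp add: conv_m[OF a b] case_prod_unfold)
  also have "\<dots> = lin_form (\<lambda>x. E x (z \<otimes>\<^bsub>M\<^esub> w)) (m a b)"
    using keys_m[OF a b] z w by (intro lin_form_cong) auto
  finally show "lin_form (\<lambda>zs. E a (zs ! 0) * E b (zs ! 1)) (comult M (z \<otimes>\<^bsub>M\<^esub> w))
      = lin_form (\<lambda>zs. E a (zs ! 0) * E b (zs ! 1)) (tensor_mult M ?s ?t)"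
    using z w by (simp add: M_comult_eval[OF _ a b, simplified])
qed

text \<open>Evaluated at three basis elements, coassociativity is the associativity of
  \<open>m\<close>.\<close>

lemma coassoc_M:
  assumes z: "z \<in> carrier M"
  shows "tensor_eq M
    (lin_ext (\<lambda>xs. push (\<lambda>ys. ys @ [xs ! 1]) (comult M (xs ! 0))) (comult M z))
    (lin_ext (\<lambda>xs. push (\<lambda>ys. xs ! 0 # ys) (comult M (xs ! 1))) (comult M z))"
proof (rule tensor_eqI3)
  show "lin_ext (\<lambda>xs. push (\<lambda>ys. ys @ [xs ! 1]) (comult M (xs ! 0))) (comult M z) \<in> tensors M 3"
    "lin_ext (\<lambda>xs. push (\<lambda>ys. xs ! 0 # ys) (comult M (xs ! 1))) (comult M z) \<in> tensors M 3"
    by (intro lin_ext_tensors push_tensors; elim comult_keys[OF z]; simp; elim comult_keys[rotated]; simp)+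
  fix a b c assume a: "a \<in> X" and b: "b \<in> X" and c: "c \<in> X"
  have "lin_form (\<lambda>zs. E a (zs ! 0) * E b (zs ! 1) * E c (zs ! 2))
      (lin_ext (\<lambda>xs. push (\<lambda>ys. ys @ [xs ! 1]) (comult M (xs ! 0))) (comult M z))
    = lin_form (\<lambda>xs. lin_form (\<lambda>ys. (E a (ys ! 0) * E b (ys ! 1)) * E c (xs ! 1)) (comult M (xs ! 0))) (comult M z)"
    by (simp, intro comult_cong[OF z], simp, intro comult_cong) simp_all
  also have "\<dots> = lin_form (\<lambda>xs. lin_form (\<lambda>x. E x (xs ! 0) * E c (xs ! 1)) (m a b)) (comult M z)"
    by (intro comult_cong[OF z]) (simp add: lin_form_fun_mult_right M_comult_eval[OF _ a b, simplified])
  also have "\<dots> = lin_form (\<lambda>x. lin_form (\<lambda>x. E x z) (m x c)) (m a b)"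
    using keys_m[OF a b]
    by (subst lin_form_swap) (auto intro!: lin_form_cong simp: M_comult_eval[OF z _ c, simplified])
  also have "\<dots> = lin_form (\<lambda>x. lin_form (\<lambda>x. E x z) (m a x)) (m b c)"
    by (rule prod_assoc[OF a b c])
  also have "\<dots> = lin_form (\<lambda>xs. lin_form (\<lambda>x. E a (xs ! 0) * E x (xs ! 1)) (m b c)) (comult M z)"
    using keys_m[OF b c]
    by (subst lin_form_swap) (auto intro!: lin_form_cong simp: M_comult_eval[OF z a, simplified])
  also have "\<dots> = lin_form (\<lambda>xs. lin_form (\<lambda>ys. E a (xs ! 0) * (E b (ys ! 0) * E c (ys ! 1))) (comult M (xs ! 1))) (comult M z)"
    by (intro comult_cong[OF z]) (simp add: lin_form_fun_mult M_comult_eval[OF _ b c, simplified])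
  also have "\<dots> = lin_form (\<lambda>zs. E a (zs ! 0) * E b (zs ! 1) * E c (zs ! 2))
      (lin_ext (\<lambda>xs. push (\<lambda>ys. xs ! 0 # ys) (comult M (xs ! 1))) (comult M z))"
    by (simp, intro comult_cong[OF z], simp, intro comult_cong) simp_all
  finally show "lin_form (\<lambda>zs. E a (zs ! 0) * E b (zs ! 1) * E c (zs ! 2))
      (lin_ext (\<lambda>xs. push (\<lambda>ys. ys @ [xs ! 1]) (comult M (xs ! 0))) (comult M z))
    = lin_form (\<lambda>zs. E a (zs ! 0) * E b (zs ! 1) * E c (zs ! 2))
      (lin_ext (\<lambda>xs. push (\<lambda>ys. xs ! 0 # ys) (comult M (xs ! 1))) (comult M z))" .
qed

lemma counit_M:
  assumes z: "z \<in> carrier M"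
  shows "tensor_eq M (lin_ext (\<lambda>xs. cscale (counit M (xs ! 0)) (basis [xs ! 1])) (comult M z)) (basis [z])"
    and "tensor_eq M (lin_ext (\<lambda>xs. cscale (counit M (xs ! 1)) (basis [xs ! 0])) (comult M z)) (basis [z])"
proof -
  show "tensor_eq M (lin_ext (\<lambda>xs. cscale (counit M (xs ! 0)) (basis [xs ! 1])) (comult M z)) (basis [z])"
  proof (rule tensor_eqI1)
    fix a assume a: "a \<in> X"
    have "lin_form (\<lambda>zs. E a (zs ! 0)) (lin_ext (\<lambda>xs. cscale (counit M (xs ! 0)) (basis [xs ! 1])) (comult M z))
      = lin_form (\<lambda>zs. E i (zs ! 0) * E a (zs ! 1)) (comult M z)"
      by (simp, intro comult_cong[OF z]) (simp add: M_counit)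
    with a show "lin_form (\<lambda>zs. E a (zs ! 0)) (lin_ext (\<lambda>xs. cscale (counit M (xs ! 0)) (basis [xs ! 1])) (comult M z))
      = lin_form (\<lambda>zs. E a (zs ! 0)) (basis [z])"
      by (simp add: M_comult_eval[OF z i_in a, simplified] m_i)
  qed (use z in \<open>auto intro!: lin_ext_tensors cscale_tensors basis_tensors elim!: comult_keys[OF z]\<close>)
  show "tensor_eq M (lin_ext (\<lambda>xs. cscale (counit M (xs ! 1)) (basis [xs ! 0])) (comult M z)) (basis [z])"
  proof (rule tensor_eqI1)
    fix a assume a: "a \<in> X"
    have "lin_form (\<lambda>zs. E a (zs ! 0)) (lin_ext (\<lambda>xs. cscale (counit M (xs ! 1)) (basis [xs ! 0])) (comult M z))
      = lin_form (\<lambda>zs. E a (zs ! 0) * E i (zs ! 1)) (comult M z)"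
      by (simp, intro comult_cong[OF z]) (simp add: M_counit)
    with a show "lin_form (\<lambda>zs. E a (zs ! 0)) (lin_ext (\<lambda>xs. cscale (counit M (xs ! 1)) (basis [xs ! 0])) (comult M z))
      = lin_form (\<lambda>zs. E a (zs ! 0)) (basis [z])"
      by (simp add: M_comult_eval[OF z a i_in, simplified] m_i)
  qed (use z in \<open>auto intro!: lin_ext_tensors cscale_tensors basis_tensors elim!: comult_keys[OF z]\<close>)
qed

text \<open>The transpose of \<open>ant\<close>; evaluating the antipode axioms at a basis element
  then gives those of \<open>A\<close>.\<close>

definition S where "S z = of_vals (\<lambda>a. lin_form (\<lambda>x. E x z) (ant a))"

lemma S_in [simp]: "S z \<in> carrier M"
  by (simp add: S_def)

lemma E_S [simp]: "a \<in> X \<Longrightarrow> E a (S z) = lin_form (\<lambda>x. E x z) (ant a)"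
  by (simp add: S_def)

lemma antipode_M:
  assumes z: "z \<in> carrier M"
  shows "tensor_eq M (push (\<lambda>xs. [S (xs ! 0) \<otimes>\<^bsub>M\<^esub> xs ! 1]) (comult M z)) (basis [counit M z \<odot>\<^bsub>M\<^esub> \<one>\<^bsub>M\<^esub>])"
    and "tensor_eq M (push (\<lambda>xs. [xs ! 0 \<otimes>\<^bsub>M\<^esub> S (xs ! 1)]) (comult M z)) (basis [counit M z \<odot>\<^bsub>M\<^esub> \<one>\<^bsub>M\<^esub>])"
proof -
  let ?t = "comult M z"
  show "tensor_eq M (push (\<lambda>xs. [S (xs ! 0) \<otimes>\<^bsub>M\<^esub> xs ! 1]) ?t) (basis [counit M z \<odot>\<^bsub>M\<^esub> \<one>\<^bsub>M\<^esub>])"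
  proof (rule tensor_eqI1)
    fix a assume a: "a \<in> X"
    have "lin_form (\<lambda>zs. E a (zs ! 0)) (push (\<lambda>xs. [S (xs ! 0) \<otimes>\<^bsub>M\<^esub> xs ! 1]) ?t)
      = lin_form (\<lambda>xs. conv (\<lambda>c. lin_form (\<lambda>x. E x (xs ! 0)) (ant c)) (\<lambda>d. E d (xs ! 1)) a) ?t"
      using a by (simp, intro comult_cong[OF z]) (auto intro!: conv_cong)
    also have "\<dots> = lin_form (\<lambda>xs. lin_form (\<lambda>p. lin_form (\<lambda>x. E x (xs ! 0) * E (snd p) (xs ! 1)) (ant (fst p))) (D a)) ?t"
      by (simp add: conv_def case_prod_unfold lin_form_fun_mult_right)
    also have "\<dots> = lin_form (\<lambda>p. lin_form (\<lambda>x. lin_form (\<lambda>xs. E x (xs ! 0) * E (snd p) (xs ! 1)) ?t) (ant (fst p))) (D a)"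
      by (rule lin_form_swap3)
    also have "\<dots> = lin_form (\<lambda>(c, d). lin_form (\<lambda>x. lin_form (\<lambda>x. E x z) (m x d)) (ant c)) (D a)"
      unfolding case_prod_unfold
      by (intro lin_form_cong M_comult_eval[OF z]) (auto dest!: subsetD[OF keys_D[OF a]] dest: subsetD[OF keys_ant, rotated])
    finally show "lin_form (\<lambda>zs. E a (zs ! 0)) (push (\<lambda>xs. [S (xs ! 0) \<otimes>\<^bsub>M\<^esub> xs ! 1]) ?t)
      = lin_form (\<lambda>zs. E a (zs ! 0)) (basis [counit M z \<odot>\<^bsub>M\<^esub> \<one>\<^bsub>M\<^esub>])"
      using a z by (simp add: antipode_left M_counit)
  qed (use z in \<open>auto intro!: push_tensors basis_tensors M_smult_closed elim!: comult_keys[OF z]\<close>)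
  show "tensor_eq M (push (\<lambda>xs. [xs ! 0 \<otimes>\<^bsub>M\<^esub> S (xs ! 1)]) ?t) (basis [counit M z \<odot>\<^bsub>M\<^esub> \<one>\<^bsub>M\<^esub>])"
  proof (rule tensor_eqI1)
    fix a assume a: "a \<in> X"
    have "lin_form (\<lambda>zs. E a (zs ! 0)) (push (\<lambda>xs. [xs ! 0 \<otimes>\<^bsub>M\<^esub> S (xs ! 1)]) ?t)
      = lin_form (\<lambda>xs. conv (\<lambda>c. E c (xs ! 0)) (\<lambda>d. lin_form (\<lambda>x. E x (xs ! 1)) (ant d)) a) ?t"
      using a by (simp, intro comult_cong[OF z]) (auto intro!: conv_cong)
    also have "\<dots> = lin_form (\<lambda>xs. lin_form (\<lambda>p. lin_form (\<lambda>x. E (fst p) (xs ! 0) * E x (xs ! 1)) (ant (snd p))) (D a)) ?t"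
      by (simp add: conv_def case_prod_unfold lin_form_fun_mult)
    also have "\<dots> = lin_form (\<lambda>p. lin_form (\<lambda>x. lin_form (\<lambda>xs. E (fst p) (xs ! 0) * E x (xs ! 1)) ?t) (ant (snd p))) (D a)"
      by (rule lin_form_swap3)
    also have "\<dots> = lin_form (\<lambda>(c, d). lin_form (\<lambda>x. lin_form (\<lambda>x. E x z) (m c x)) (ant d)) (D a)"
      unfolding case_prod_unfold
      by (intro lin_form_cong M_comult_eval[OF z]) (auto dest!: subsetD[OF keys_D[OF a]] dest: subsetD[OF keys_ant, rotated])
    finally show "lin_form (\<lambda>zs. E a (zs ! 0)) (push (\<lambda>xs. [xs ! 0 \<otimes>\<^bsub>M\<^esub> S (xs ! 1)]) ?t)
      = lin_form (\<lambda>zs. E a (zs ! 0)) (basis [counit M z \<odot>\<^bsub>M\<^esub> \<one>\<^bsub>M\<^esub>])"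
      using a z by (simp add: antipode_right M_counit)
  qed (use z in \<open>auto intro!: push_tensors basis_tensors M_smult_closed elim!: comult_keys[OF z]\<close>)
qed

lemma hopf_algebra_M: "hopf_algebra M"
proof (intro hopf_algebra.intro hopf_algebra_axioms.intro)
  show "module complex_ring M"
  proof (rule moduleI)
    show "cring complex_ring"
    proof (rule cringI)
      have "\<exists>y. y + x = 0" for x :: complex
        by (rule exI[of _ "- x"]) simp
      then show "abelian_group complex_ring"
        by (intro abelian_groupI) (auto simp: add_ac)
    qed (auto intro!: comm_monoidI simp: distrib_right)
  qed (auto intro!: E_inj M_smult_closed is_abelian_group simp: M_smult_closed distrib_left distrib_right)
  show "ring M"
    by (rule ring_M)
  show "tensor_eq M (comult M (x \<oplus>\<^bsub>M\<^esub> y)) (comult M x + comult M y)" if "x \<in> carrier M" "y \<in> carrier M" for x y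
    using that keys_m
    by (intro tensor_eqI2 add_tensors M_comult)
      (auto simp: M_comult_eval[simplified] lin_form_fun_add)
  show "tensor_eq M (comult M (c \<odot>\<^bsub>M\<^esub> x)) (cscale c (comult M x))" if "x \<in> carrier M" for c x
    using that
    by (intro tensor_eqI2 cscale_tensors M_comult M_smult_closed)
      (auto simp: M_comult_eval[simplified] lin_form_fun_mult M_smult_closed)
  show "tensor_eq M (comult M \<one>\<^bsub>M\<^esub>) (basis [\<one>\<^bsub>M\<^esub>, \<one>\<^bsub>M\<^esub>])"
  proof (intro tensor_eqI2 basis_tensors M_comult)
    fix a b assume ab: "a \<in> X" "b \<in> X"
    have "lin_form (\<lambda>x. E x \<one>\<^bsub>M\<^esub>) (m a b) = lin_form e (m a b)"
      using keys_m[OF ab] by (intro lin_form_cong) auto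
    with ab show "lin_form (\<lambda>zs. E a (zs ! 0) * E b (zs ! 1)) (comult M \<one>\<^bsub>M\<^esub>)
        = lin_form (\<lambda>zs. E a (zs ! 0) * E b (zs ! 1)) (basis [\<one>\<^bsub>M\<^esub>, \<one>\<^bsub>M\<^esub>])"
      by (simp add: M_comult_eval[simplified] e_m)
  qed auto
  show "\<exists>S\<in>carrier M \<rightarrow> carrier M.
      (\<forall>x\<in>carrier M. \<forall>y\<in>carrier M. S (x \<oplus>\<^bsub>M\<^esub> y) = S x \<oplus>\<^bsub>M\<^esub> S y) \<and>
      (\<forall>c. \<forall>x\<in>carrier M. S (c \<odot>\<^bsub>M\<^esub> x) = c \<odot>\<^bsub>M\<^esub> S x) \<and>
      (\<forall>x\<in>carrier M.
        tensor_eq M (push (\<lambda>xs. [S (xs ! 0) \<otimes>\<^bsub>M\<^esub> xs ! 1]) (comult M x)) (basis [counit M x \<odot>\<^bsub>M\<^esub> \<one>\<^bsub>M\<^esub>]) \<and>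
        tensor_eq M (push (\<lambda>xs. [xs ! 0 \<otimes>\<^bsub>M\<^esub> S (xs ! 1)]) (comult M x)) (basis [counit M x \<odot>\<^bsub>M\<^esub> \<one>\<^bsub>M\<^esub>]))"
    by (intro bexI[of _ S] conjI ballI allI antipode_M)
      (auto intro!: E_inj M_smult_closed simp: lin_form_fun_add lin_form_fun_mult)
qed (erule coassoc_M counit_M | (auto intro!: E_inj tensor_mult_comult
    simp: M_smult_closed conv_linear M_comult M_counit i_in conv_i e_i; fail))+

theorem hopf_isomorphic_dual: "hopf_isomorphic M K"
proof -
  \<comment> \<open>The dual is a model of itself via the identity, so \<open>hopf_algebra_M\<close>
    covers the target of the isomorphism as well as its source.\<close>
  interpret K: dual_model X m i D e ant conv K "\<lambda>f. f" "\<lambda>a f. f (basis a)"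
  proof (intro dual_model.intro hopf_structure_axioms dual_model_axioms.intro)
    show "(\<lambda>f. f) \<in> ring_iso K K"
      using ring_iso_set_refl[of K] by (simp add: id_def)
    show "ring K"
      by (rule ring_K)
    fix f assume f: "f \<in> carrier K"
    then show "comult K f \<in> tensors K 2" "c \<odot>\<^bsub>K\<^esub> f \<in> carrier K" "counit K f = f (basis i)" for c
      by (simp_all add: comult_K)
    show "lin_form (\<lambda>fs. (fs ! 0) (basis a) * (fs ! 1) (basis b)) (comult K f) = lin_form (\<lambda>x. f (basis x)) (m a b)"
      if "a \<in> X" "b \<in> X" for a b
      using comult_K(2) f that by simp
  qed (simp_all only: conv_def)
  have comult: "tensor_eq K (comult K (\<phi> z)) (push (map \<phi>) (comult M z))" if z: "z \<in> carrier M" for z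
  proof (rule K.tensor_eqI2)
    show "push (map \<phi>) (comult M z) \<in> tensors K 2"
      by (intro K.push_tensors) (auto simp: \<phi>_in elim!: comult_keys[OF z])
    fix a b assume ab: "a \<in> X" "b \<in> X"
    have "lin_form (\<lambda>fs. (fs ! 0) (basis a) * (fs ! 1) (basis b)) (push (map \<phi>) (comult M z))
        = lin_form (\<lambda>zs. E a (zs ! 0) * E b (zs ! 1)) (comult M z)"
      by (simp, intro comult_cong[OF z]) (simp add: E_def)
    also have "\<dots> = lin_form (\<lambda>x. \<phi> z (basis x)) (m a b)"
      by (simp only: M_comult_eval[OF z ab]) (simp add: E_def)
    finally show "lin_form (\<lambda>fs. (fs ! 0) (basis a) * (fs ! 1) (basis b)) (comult K (\<phi> z))
        = lin_form (\<lambda>fs. (fs ! 0) (basis a) * (fs ! 1) (basis b)) (push (map \<phi>) (comult M z))"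
      using comult_K(2)[OF \<phi>_in[OF z] ab] by simp
  qed (use comult_K(1)[OF \<phi>_in[OF z]] in simp)
  have counit: "counit K (\<phi> z) = counit M z" if "z \<in> carrier M" for z
    using that by (simp only: M_counit E_def K_simps)
  show ?thesis
    unfolding hopf_isomorphic_def
    by (intro conjI exI[of _ \<phi>] allI ballI hopf_algebra_M K.hopf_algebra_M iso \<phi>_smult counit comult; assumption)
qed

end

section \<open>The Hopf algebra $A(G,V,u,B)$ for a diagonal representation of rank two\<close>

text \<open>The four subsets indexing the basis of the exterior algebra of a plane; the numbering is
  shifted, \<open>e1\<close> and \<open>e2\<close> standing for the basis vectors with index 0 and
  1. They stay folded so that simp rules can match on them as on constructors.\<close>

definition "e0 = ({} :: nat set)"
definition "e1 = {0 :: nat}"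
definition "e2 = {1 :: nat}"
definition "e12 = {0, 1 :: nat}"

lemma e_distinct [simp]:
  "e0 \<noteq> e1" "e0 \<noteq> e2" "e0 \<noteq> e12" "e1 \<noteq> e2" "e1 \<noteq> e12" "e2 \<noteq> e12"
  "e1 \<noteq> e0" "e2 \<noteq> e0" "e12 \<noteq> e0" "e2 \<noteq> e1" "e12 \<noteq> e1" "e12 \<noteq> e2"
  by (auto simp: e0_def e1_def e2_def e12_def)

lemma Pow_lessThan_2: "Pow {..<2} = {e0, e1, e2, e12}"
  by (auto simp: e0_def e1_def e2_def e12_def Pow_insert lessThan_Suc numeral_2_eq_2)

lemma parity_e [simp]:
  "parity (e0, g) = 0" "parity (e1, g) = 1" "parity (e2, g) = 1" "parity (e12, g) = 2"
  by (simp_all add: parity_def e0_def e1_def e2_def e12_def)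

lemma wedge_inversions:
  "card {(s, t). s \<in> e1 \<and> t \<in> e2 \<and> t < s} = 0" "card {(s, t). s \<in> e2 \<and> t \<in> e1 \<and> t < s} = 1"
proof -
  have "{(s, t). s \<in> e1 \<and> t \<in> e2 \<and> t < s} = {}" "{(s, t). s \<in> e2 \<and> t \<in> e1 \<and> t < s} = {(1, 0)}"
    by (auto simp: e1_def e2_def)
  then show "card {(s, t). s \<in> e1 \<and> t \<in> e2 \<and> t < s} = 0" "card {(s, t). s \<in> e2 \<and> t \<in> e1 \<and> t < s} = 1"
    by (simp_all only: card.empty) simp
qed

lemma wedge_e0 [simp]: "wedge e0 S = basis S" "wedge S e0 = basis S"
  by (auto simp: wedge_def e0_def)

lemma wedge_e [simp]:
  "wedge e1 e1 = 0" "wedge e2 e2 = 0" "wedge e12 e1 = 0" "wedge e12 e2 = 0" "wedge e1 e12 = 0" "wedge e2 e12 = 0"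
  "wedge e12 e12 = 0" "wedge e1 e2 = basis e12" "wedge e2 e1 = - basis e12"
proof -
  have "e1 \<inter> e2 = {}" "e2 \<inter> e1 = {}" "e1 \<union> e2 = e12" "e2 \<union> e1 = e12"
    by (auto simp: e1_def e2_def e12_def)
  then show "wedge e1 e2 = basis e12" "wedge e2 e1 = - basis e12"
    by (simp_all add: wedge_def wedge_inversions flip: single_uminus)
qed (simp_all add: wedge_def e1_def e2_def e12_def)

lemma sorted_list_of_set_e [simp]:
  "sorted_list_of_set e0 = []" "sorted_list_of_set e1 = [0]" "sorted_list_of_set e2 = [1]"
  "sorted_list_of_set e12 = [0, 1]"
  by (simp_all add: e0_def e1_def e2_def e12_def)

locale rank2_datum = comm_group G
  for G :: "('g, 'k) monoid_scheme" (structure) +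
  fixes \<chi>1 \<chi>2 :: "'g \<Rightarrow> complex" and u :: 'g and b11 b12 b22 :: complex
  assumes finite_G: "finite (carrier G)"
    and \<chi>_mult [simp]: "\<lbrakk>g \<in> carrier G; h \<in> carrier G\<rbrakk> \<Longrightarrow> \<chi>1 (g \<otimes> h) = \<chi>1 g * \<chi>1 h"
      "\<lbrakk>g \<in> carrier G; h \<in> carrier G\<rbrakk> \<Longrightarrow> \<chi>2 (g \<otimes> h) = \<chi>2 g * \<chi>2 h"
    and \<chi>_one [simp]: "\<chi>1 \<one> = 1" "\<chi>2 \<one> = 1"
    and u_in [simp]: "u \<in> carrier G" and u_u [simp]: "u \<otimes> u = \<one>"
    and \<chi>_u [simp]: "\<chi>1 u = -1" "\<chi>2 u = -1"
begin

definition \<rho> :: "'g \<Rightarrow> complex mat" where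
  "\<rho> g = mat 2 2 (\<lambda>(i, j). if i = j then if i = 0 then \<chi>1 g else \<chi>2 g else 0)"

definition B :: "complex mat" where
  "B = mat 2 2 (\<lambda>(i, j). if i = j then if i = 0 then b11 else b22 else b12)"

definition X :: "'g semi set" where
  "X = Pow {..<2} \<times> carrier G"

abbreviation m where "m \<equiv> semi_mult_basis G 2 \<rho>"
abbreviation D where "D \<equiv> A_comult_basis G 2 \<rho> u B"

definition e :: "'g semi \<Rightarrow> complex" where
  "e = (\<lambda>(S, g). if S = {} then 1 else 0)"

text \<open>The formulas follow by antimultiplicativity from sending \<open>g\<close> to its inverse
  and \<open>e\<^sub>i\<close> to \<open>e\<^sub>i u\<close>, the latter because the coproduct of
  \<open>e\<^sub>i\<close> is \<open>e\<^sub>i \<otimes> 1 + u \<otimes> e\<^sub>i\<close>. The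
  twist adds no correction: multiplying the factors of the symmetric tensor \<open>B\<close> in the
  exterior algebra gives 0.\<close>

definition ant :: "'g semi \<Rightarrow> ('g semi \<Rightarrow>\<^sub>0 complex)" where
  "ant = (\<lambda>(S, g). if S = e0 then basis (e0, inv g)
     else if S = e1 then cscale (\<chi>1 (inv g)) (basis (e1, u \<otimes> inv g))
     else if S = e2 then cscale (\<chi>2 (inv g)) (basis (e2, u \<otimes> inv g))
     else cscale (\<chi>1 (inv g) * \<chi>2 (inv g)) (basis (e12, inv g)))"

text \<open>The coefficients of \<open>e\<^sub>i u g \<otimes> e\<^sub>j g\<close> in the coproduct of \<open>g\<close>.\<close>

definition d11 where "d11 g = b11 * (\<chi>1 g * \<chi>1 g - 1)"
definition d12 where "d12 g = b12 * (\<chi>1 g * \<chi>2 g - 1)"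
definition d22 where "d22 g = b22 * (\<chi>2 g * \<chi>2 g - 1)"

lemma X_cases:
  assumes "a \<in> X"
  obtains g where "g \<in> carrier G" "a = (e0, g)" | g where "g \<in> carrier G" "a = (e1, g)"
    | g where "g \<in> carrier G" "a = (e2, g)" | g where "g \<in> carrier G" "a = (e12, g)"
  using assms by (auto simp: X_def Pow_lessThan_2)

lemma X_in [simp]: "(S, g) \<in> X \<longleftrightarrow> S \<in> {e0, e1, e2, e12} \<and> g \<in> carrier G"
  by (auto simp: X_def Pow_lessThan_2)

text \<open>\<open>NO_MATCH\<close> keeps the second rule from rewriting \<open>u \<otimes> (u \<otimes> h)\<close> to itself.\<close>

lemma group_simps [simp]:
  "g \<in> carrier G \<Longrightarrow> u \<otimes> (u \<otimes> g) = g"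
  "\<lbrakk>NO_MATCH u g; g \<in> carrier G; h \<in> carrier G\<rbrakk> \<Longrightarrow> g \<otimes> (u \<otimes> h) = u \<otimes> (g \<otimes> h)"
  "\<lbrakk>g \<in> carrier G; h \<in> carrier G\<rbrakk> \<Longrightarrow> (u \<otimes> g) \<otimes> h = u \<otimes> (g \<otimes> h)"
  by (simp_all add: m_lcomm m_assoc flip: m_assoc[of u u g])

section \<open>The structure constants of A\<close>

lemma lin_form_ext_act [simp]:
  assumes "g \<in> carrier G"
  shows "lin_form F (ext_act 2 (\<rho> g) e0) = F e0" "lin_form F (ext_act 2 (\<rho> g) e1) = \<chi>1 g * F e1"
    "lin_form F (ext_act 2 (\<rho> g) e2) = \<chi>2 g * F e2" "lin_form F (ext_act 2 (\<rho> g) e12) = \<chi>1 g * \<chi>2 g * F e12"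
proof -
  have [simp]: "(\<Sum>j<2. Poly_Mapping.single {j} (\<rho> g $$ (j, 0))) = cscale (\<chi>1 g) (basis e1)"
    "(\<Sum>j<2. Poly_Mapping.single {j} (\<rho> g $$ (j, Suc 0))) = cscale (\<chi>2 g) (basis e2)"
    by (rule poly_mapping_eqI_lin_form, simp add: \<rho>_def numeral_2_eq_2 e1_def e2_def)+
  have [simp]: "basis ({} :: nat set) = basis e0"
    by (simp add: e0_def)
  show "lin_form F (ext_act 2 (\<rho> g) e0) = F e0" "lin_form F (ext_act 2 (\<rho> g) e1) = \<chi>1 g * F e1"
    "lin_form F (ext_act 2 (\<rho> g) e2) = \<chi>2 g * F e2" "lin_form F (ext_act 2 (\<rho> g) e12) = \<chi>1 g * \<chi>2 g * F e12"
    by (simp_all add: ext_act_def)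
qed

lemma lin_form_m [simp]:
  assumes "g \<in> carrier G"
  shows "lin_form F (m (e0, g) (e0, h)) = F (e0, g \<otimes> h)"
    "lin_form F (m (e0, g) (e1, h)) = \<chi>1 g * F (e1, g \<otimes> h)"
    "lin_form F (m (e0, g) (e2, h)) = \<chi>2 g * F (e2, g \<otimes> h)"
    "lin_form F (m (e0, g) (e12, h)) = \<chi>1 g * \<chi>2 g * F (e12, g \<otimes> h)"
    "lin_form F (m (e1, g) (e0, h)) = F (e1, g \<otimes> h)"
    "lin_form F (m (e1, g) (e1, h)) = 0"
    "lin_form F (m (e1, g) (e2, h)) = \<chi>2 g * F (e12, g \<otimes> h)"
    "lin_form F (m (e1, g) (e12, h)) = 0"
    "lin_form F (m (e2, g) (e0, h)) = F (e2, g \<otimes> h)"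
    "lin_form F (m (e2, g) (e1, h)) = - \<chi>1 g * F (e12, g \<otimes> h)"
    "lin_form F (m (e2, g) (e2, h)) = 0"
    "lin_form F (m (e2, g) (e12, h)) = 0"
    "lin_form F (m (e12, g) (e0, h)) = F (e12, g \<otimes> h)"
    "lin_form F (m (e12, g) (e1, h)) = 0"
    "lin_form F (m (e12, g) (e2, h)) = 0"
    "lin_form F (m (e12, g) (e12, h)) = 0"
  using assms by (simp_all add: semi_mult_basis_def)

lemma lin_form_super_mult:
  "lin_form F (super_mult G 2 \<rho> s t) = lin_form (\<lambda>(a, b). lin_form (\<lambda>(c, d).
      (-1) ^ (parity b * parity c) * lin_form (\<lambda>x. lin_form (\<lambda>y. F (x, y)) (m b d)) (m a c)) t) s"
  by (simp add: super_mult_def pair_tensor_def case_prod_unfold)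

text \<open>In rank two the series ends with the square. The super sign makes the product of
  \<open>e\<^sub>1 \<otimes> e\<^sub>1\<close> and \<open>e\<^sub>2 \<otimes> e\<^sub>2\<close>
  equal to minus the top element, and each product occurs in two orders, which cancels the factor
  1/2; so the top coefficient is minus the determinant. It is the same for a tensor and its
  negative.\<close>

lemma lin_form_super_exp:
  assumes t: "\<And>F. lin_form F t = x11 * F ((e1, \<one>), (e1, \<one>)) + x12 * F ((e1, \<one>), (e2, \<one>))
    + x12 * F ((e2, \<one>), (e1, \<one>)) + x22 * F ((e2, \<one>), (e2, \<one>))"
  shows "lin_form F (super_exp G 2 \<rho> t) = F ((e0, \<one>), (e0, \<one>))
    + x11 * F ((e1, \<one>), (e1, \<one>)) + x12 * F ((e1, \<one>), (e2, \<one>))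
    + x12 * F ((e2, \<one>), (e1, \<one>)) + x22 * F ((e2, \<one>), (e2, \<one>))
    - (x11 * x22 - x12 * x12) * F ((e12, \<one>), (e12, \<one>))"
proof -
  have sum: "(\<Sum>k\<le>2. f k) = f 0 + f 1 + f 2" for f :: "nat \<Rightarrow> ('g semi \<times> 'g semi \<Rightarrow>\<^sub>0 complex)"
    by (simp add: numeral_2_eq_2)
  have square: "(f ^^ 2) x = f (f x)" for f and x :: "'g semi \<times> 'g semi \<Rightarrow>\<^sub>0 complex"
    by (simp add: numeral_2_eq_2)
  have [simp]: "({}, h) = (e0, h)" for h :: 'g
    by (simp add: e0_def)
  show ?thesis
    by (simp add: super_exp_def sum square lin_form_super_mult t) (simp add: field_simps)
qed

lemma lin_form_tensor_of_mat:
  "lin_form F (tensor_of_mat G 2 B) = b11 * F ((e1, \<one>), (e1, \<one>)) + b12 * F ((e1, \<one>), (e2, \<one>))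
    + b12 * F ((e2, \<one>), (e1, \<one>)) + b22 * F ((e2, \<one>), (e2, \<one>))"
  by (simp add: tensor_of_mat_def numeral_2_eq_2 B_def e1_def e2_def)

lemma lin_form_exp_pos:
  "lin_form F (super_exp G 2 \<rho> (tensor_of_mat G 2 B)) = F ((e0, \<one>), (e0, \<one>))
    + b11 * F ((e1, \<one>), (e1, \<one>)) + b12 * F ((e1, \<one>), (e2, \<one>))
    + b12 * F ((e2, \<one>), (e1, \<one>)) + b22 * F ((e2, \<one>), (e2, \<one>))
    - (b11 * b22 - b12 * b12) * F ((e12, \<one>), (e12, \<one>))"
  by (rule lin_form_super_exp) (simp add: lin_form_tensor_of_mat)

lemma lin_form_exp_neg:
  "lin_form F (super_exp G 2 \<rho> (- tensor_of_mat G 2 B)) = F ((e0, \<one>), (e0, \<one>))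
    - b11 * F ((e1, \<one>), (e1, \<one>)) - b12 * F ((e1, \<one>), (e2, \<one>))
    - b12 * F ((e2, \<one>), (e1, \<one>)) - b22 * F ((e2, \<one>), (e2, \<one>))
    - (b11 * b22 - b12 * b12) * F ((e12, \<one>), (e12, \<one>))"
  by (subst lin_form_super_exp[of _ "- b11" "- b12" "- b22"]) (simp_all add: lin_form_tensor_of_mat)

lemma lin_form_super_comult:
  assumes "g \<in> carrier G"
  shows "lin_form F (super_comult_basis G 2 \<rho> (e0, g)) = F ((e0, g), (e0, g))"
    "lin_form F (super_comult_basis G 2 \<rho> (e1, g)) = F ((e1, g), (e0, g)) + F ((e0, g), (e1, g))"
    "lin_form F (super_comult_basis G 2 \<rho> (e2, g)) = F ((e2, g), (e0, g)) + F ((e0, g), (e2, g))"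
    "lin_form F (super_comult_basis G 2 \<rho> (e12, g)) = F ((e12, g), (e0, g)) + F ((e1, g), (e2, g))
      - F ((e2, g), (e1, g)) + F ((e0, g), (e12, g))"
proof -
  have [simp]: "{0::nat} = e1" "{Suc 0} = e2" "({}, h) = (e0, h)" for h :: 'g
    by (simp_all add: e0_def e1_def e2_def)
  show "lin_form F (super_comult_basis G 2 \<rho> (e0, g)) = F ((e0, g), (e0, g))"
    "lin_form F (super_comult_basis G 2 \<rho> (e1, g)) = F ((e1, g), (e0, g)) + F ((e0, g), (e1, g))"
    "lin_form F (super_comult_basis G 2 \<rho> (e2, g)) = F ((e2, g), (e0, g)) + F ((e0, g), (e2, g))"
    "lin_form F (super_comult_basis G 2 \<rho> (e12, g)) = F ((e12, g), (e0, g)) + F ((e1, g), (e2, g))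
      - F ((e2, g), (e1, g)) + F ((e0, g), (e12, g))"
    using assms by (simp_all add: super_comult_basis_def lin_form_super_mult)
qed

text \<open>Elements of \<open>V \<otimes> V\<close> commute in the super tensor square, so
  conjugating \<open>g \<otimes> g\<close> gives the exponential of \<open>g B - B\<close> times
  \<open>g \<otimes> g\<close>. Its entries are \<open>d11\<close>, \<open>d12\<close>,
  \<open>d22\<close>, and its top term is again minus a determinant. In the terms with odd second
  factor, \<open>u\<close> is moved to the right of the exterior part; for even \<open>a\<close> the
  sign of \<open>u e\<^sub>i = - e\<^sub>i u\<close> cancels the prescribed sign.\<close>

lemma lin_form_D:
  assumes g: "g \<in> carrier G"
  shows "lin_form F (D (e0, g)) = F ((e0, g), (e0, g))
      + d11 g * F ((e1, u \<otimes> g), (e1, g)) + d12 g * F ((e1, u \<otimes> g), (e2, g))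
      + d12 g * F ((e2, u \<otimes> g), (e1, g)) + d22 g * F ((e2, u \<otimes> g), (e2, g))
      - (d11 g * d22 g - d12 g * d12 g) * F ((e12, g), (e12, g))" (is ?D0)
    and "lin_form F (D (e1, g)) = F ((e1, g), (e0, g)) + F ((e0, u \<otimes> g), (e1, g))
      - d12 g * F ((e1, g), (e12, g)) - d22 g * F ((e2, g), (e12, g))
      + d12 g * F ((e12, u \<otimes> g), (e1, g)) + d22 g * F ((e12, u \<otimes> g), (e2, g))" (is ?D1)
    and "lin_form F (D (e2, g)) = F ((e2, g), (e0, g)) + F ((e0, u \<otimes> g), (e2, g))
      + d11 g * F ((e1, g), (e12, g)) + d12 g * F ((e2, g), (e12, g))
      - d11 g * F ((e12, u \<otimes> g), (e1, g)) - d12 g * F ((e12, u \<otimes> g), (e2, g))" (is ?D2)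
    and "lin_form F (D (e12, g)) = F ((e12, g), (e0, g)) + F ((e0, g), (e12, g))
      + F ((e1, u \<otimes> g), (e2, g)) - F ((e2, u \<otimes> g), (e1, g))" (is ?D3)
proof -
  have [simp]: "({}, h) = (e0, h)" for h :: 'g
    by (simp add: e0_def)
  note defs = A_comult_basis_def twisted_comult_basis_def lin_form_super_mult lin_form_exp_pos lin_form_exp_neg
    lin_form_super_comult d11_def d12_def d22_def
  show ?D0
    using g by (simp add: defs, simp add: algebra_simps)
  show ?D1
    using g by (simp add: defs, simp add: algebra_simps)
  show ?D2
    using g by (simp add: defs, simp add: algebra_simps)
  show ?D3
    using g by (simp add: defs)
qed

lemma A_hopf_eq: "A_hopf G 2 \<rho> u B = structure_hopf X m (e0, \<one>) D e"
  by (simp add: A_hopf_def structure_hopf_def X_def e_def e0_def)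

lemma e_simps [simp]: "e (e0, g) = 1" "e (e1, g) = 0" "e (e2, g) = 0" "e (e12, g) = 0"
  by (simp_all add: e_def e0_def e1_def e2_def e12_def)

lemma lin_form_ant [simp]:
  "lin_form F (ant (e0, g)) = F (e0, inv g)"
  "lin_form F (ant (e1, g)) = \<chi>1 (inv g) * F (e1, u \<otimes> inv g)"
  "lin_form F (ant (e2, g)) = \<chi>2 (inv g) * F (e2, u \<otimes> inv g)"
  "lin_form F (ant (e12, g)) = \<chi>1 (inv g) * \<chi>2 (inv g) * F (e12, inv g)"
  by (simp_all add: ant_def)

lemma \<chi>_inv:
  assumes "g \<in> carrier G"
  shows "\<chi>1 (inv g) = inverse (\<chi>1 g)" "\<chi>2 (inv g) = inverse (\<chi>2 g)" "\<chi>1 g \<noteq> 0" "\<chi>2 g \<noteq> 0"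
proof -
  have "\<chi>1 (inv g) * \<chi>1 g = 1" "\<chi>2 (inv g) * \<chi>2 g = 1"
    using assms by (simp_all flip: \<chi>_mult)
  then show "\<chi>1 (inv g) = inverse (\<chi>1 g)" "\<chi>2 (inv g) = inverse (\<chi>2 g)" "\<chi>1 g \<noteq> 0" "\<chi>2 g \<noteq> 0"
    by (auto simp: inverse_unique[symmetric] mult.commute)
qed

lemma inv_u_mult [simp]: "g \<in> carrier G \<Longrightarrow> inv (u \<otimes> g) = u \<otimes> inv g"
  by (simp add: inv_mult inv_char[OF u_in u_in u_u u_u])

lemma d_simps [simp]:
  "g \<in> carrier G \<Longrightarrow> d11 (u \<otimes> g) = d11 g"
  "g \<in> carrier G \<Longrightarrow> d12 (u \<otimes> g) = d12 g"
  "g \<in> carrier G \<Longrightarrow> d22 (u \<otimes> g) = d22 g"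
  by (simp_all add: d11_def d12_def d22_def)

lemma d_one [simp]: "d11 \<one> = 0" "d12 \<one> = 0" "d22 \<one> = 0"
  by (simp_all add: d11_def d12_def d22_def)

section \<open>The Hopf axioms for the structure constants\<close>

lemma A_conv_assoc:
  assumes "a \<in> X"
  shows "lin_form (\<lambda>(c, d). lin_form (\<lambda>(c, d). F c * F' d) (D c) * F'' d) (D a)
    = lin_form (\<lambda>(c, d). F c * lin_form (\<lambda>(c, d). F' c * F'' d) (D d)) (D a)"
  using assms by (elim X_cases) (simp add: lin_form_D, simp add: algebra_simps)+

text \<open>Here the coefficients must be unfolded, because the coproduct is taken at a product of
  group elements. The identity behind it is
  \<open>d(g h) = d(g) + \<chi>\<^sub>i(g) \<chi>\<^sub>j(g) d(h)\<close> for each of the three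
  coefficients, whereas coassociativity only uses their invariance under multiplication by
  \<open>u\<close>.\<close>

lemma A_conv_mult:
  assumes "a \<in> X" "b \<in> X"
  shows "lin_form (\<lambda>a. lin_form (\<lambda>(c, d). F c * F' d) (D a)) (m a b)
    = lin_form (\<lambda>(c, d). lin_form (\<lambda>(c', d'). lin_form F (m c c') * lin_form F' (m d d')) (D b)) (D a)"
  using assms by (elim X_cases) (simp add: lin_form_D d11_def d12_def d22_def, (simp add: algebra_simps)?)+

lemma A_antipode_left:
  assumes "a \<in> X"
  shows "lin_form (\<lambda>(c, d). lin_form (\<lambda>x. lin_form F (m x d)) (ant c)) (D a) = e a * F (e0, \<one>)"
  using assms by (elim X_cases) (simp add: lin_form_D \<chi>_inv, (simp add: field_simps \<chi>_inv)?)+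

lemma A_antipode_right:
  assumes "a \<in> X"
  shows "lin_form (\<lambda>(c, d). lin_form (\<lambda>x. lin_form F (m c x)) (ant d)) (D a) = e a * F (e0, \<one>)"
  using assms by (elim X_cases) (simp add: lin_form_D \<chi>_inv, (simp add: field_simps \<chi>_inv)?)+

lemma A_mult_assoc:
  assumes "a \<in> X" "b \<in> X" "c \<in> X"
  shows "lin_form (\<lambda>x. lin_form F (m x c)) (m a b) = lin_form (\<lambda>x. lin_form F (m a x)) (m b c)"
  using assms by (elim X_cases) (simp_all add: m_assoc)

lemma keys_m: "a \<in> X \<Longrightarrow> b \<in> X \<Longrightarrow> Poly_Mapping.keys (m a b) \<subseteq> X"
  by (rule keys_subsetI_lin_form) (elim X_cases; simp)

lemma keys_D: "a \<in> X \<Longrightarrow> Poly_Mapping.keys (D a) \<subseteq> X \<times> X"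
  by (rule keys_subsetI_lin_form) (elim X_cases; simp add: lin_form_D)

lemma keys_ant: "a \<in> X \<Longrightarrow> Poly_Mapping.keys (ant a) \<subseteq> X"
  by (rule keys_subsetI_lin_form) (elim X_cases; simp)

lemma A_structure: "hopf_structure X m (e0, \<one>) D e ant"
proof
  show "finite X"
    using finite_G by (simp add: X_def)
  show "(e0, \<one>) \<in> X"
    by simp
  show "lin_form (\<lambda>(c, d). e c * F d) (D a) = F a" "lin_form (\<lambda>(c, d). F c * e d) (D a) = F a"
    "lin_form F (m (e0, \<one>) a) = F a" "lin_form F (m a (e0, \<one>)) = F a" if "a \<in> X" for F a
    using that by (elim X_cases; simp add: lin_form_D)+
  show "lin_form e (m a b) = e a * e b" if "a \<in> X" "b \<in> X" for a b
    using that by (elim X_cases) simp_all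
qed (simp_all add: A_conv_assoc A_conv_mult A_antipode_left A_antipode_right A_mult_assoc lin_form_D
    keys_m keys_D keys_ant)

end

context rank2_datum
begin

definition conv :: "('g semi \<Rightarrow> complex) \<Rightarrow> ('g semi \<Rightarrow> complex) \<Rightarrow> 'g semi \<Rightarrow> complex" where
  "conv = (\<lambda>F G a. lin_form (\<lambda>(c, d). F c * G d) (D a))"

sublocale hs: hopf_structure X m "(e0, \<one>)" D e ant conv
  by (rule A_structure) (simp only: conv_def)

lemma super_datum: "super_datum G 2 \<rho> u"
proof -
  have "\<rho> (g \<otimes> h) = \<rho> g * \<rho> h" if "g \<in> carrier G" "h \<in> carrier G" for g h
    using that by (intro eq_matI) (auto simp: \<rho>_def scalar_prod_def less_Suc_eq numeral_2_eq_2)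
  moreover have "\<rho> \<one> = 1\<^sub>m 2" "\<rho> u = - 1\<^sub>m 2"
    by (rule eq_matI; auto simp: \<rho>_def)+
  moreover have "u \<noteq> \<one>"
    using \<chi>_u(1) \<chi>_one(1) by (metis one_neq_neg_one)
  then have "ord u = 2"
    using ord_eq_1[OF u_in] ord_ge_1[OF finite_G u_in] pow_eq_id[OF u_in, of 2] dvd_imp_le[of "ord u" 2]
    by (simp add: numeral_2_eq_2) 
  ultimately show ?thesis
    using finite_G is_group by (auto simp: super_datum_def representation_def m_comm) (auto simp: \<rho>_def)
qed

lemma B_sym: "B \<in> sym_tensors 2"
  by (auto simp: sym_tensors_def B_def simp del: One_nat_def)

end

section \<open>Free algebras\<close>

lemma free_algebra_simps [simp]:
  "carrier (free_algebra Y) = {p. Poly_Mapping.keys p \<subseteq> {w. set w \<subseteq> Y}}"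
  "monoid.mult (free_algebra Y) = bilin_ext (\<lambda>v w. basis (v @ w))" "monoid.one (free_algebra Y) = basis []"
  "ring.zero (free_algebra Y) = 0" "ring.add (free_algebra Y) = (+)" "module.smult (free_algebra Y) = cscale"
  by (auto simp: free_algebra_def)

lemma ring_free_algebra: "ring (free_algebra Y)"
proof -
  have add: "p + q \<in> carrier (free_algebra Y)"
    if "p \<in> carrier (free_algebra Y)" "q \<in> carrier (free_algebra Y)" for p q
    using that unfolding free_algebra_simps mem_Collect_eq by (rule keys_add_subset)
  have mult: "bilin_ext (\<lambda>v w. basis (v @ w)) p q \<in> carrier (free_algebra Y)"
    if "p \<in> carrier (free_algebra Y)" "q \<in> carrier (free_algebra Y)" for p q
    using that unfolding free_algebra_simps mem_Collect_eq by (intro keys_bilin_ext_subset) auto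
  have neg: "- p \<in> carrier (free_algebra Y)" if "p \<in> carrier (free_algebra Y)" for p
    using that unfolding free_algebra_simps mem_Collect_eq by (rule keys_uminus_subset)
  have group: "abelian_group (free_algebra Y)"
    by (rule abelian_groupI) (use add neg in \<open>auto simp del: free_algebra_simps(1) simp: add_ac intro!: bexI[of _ "- _"], auto\<close>)
  have monoid: "monoid (free_algebra Y)"
    by (rule monoidI) (use mult in \<open>auto simp del: free_algebra_simps(1) intro!: poly_mapping_eqI_lin_form\<close>, auto)
  show ?thesis
    by (rule ringI[OF group monoid]) (auto intro!: poly_mapping_eqI_lin_form simp: lin_form_fun_add)
qed

section \<open>The isomorphism with the presented algebra\<close>

text \<open>The duality of the two groups is encoded by a bimultiplicative pairing with both
  orthogonality relations. The first extracts coefficients of characters, the second gives Fourier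
  inversion; its case \<open>g = h\<close> also says that the groups have the same order.\<close>

locale grana_datum = G?: comm_group G + \<Gamma>: comm_group \<Gamma>
  for G :: "('g, 'k) monoid_scheme" (structure) and \<Gamma> :: "('c, 'l) monoid_scheme" +
  fixes \<beta> :: "'g \<Rightarrow> 'c \<Rightarrow> complex" and u :: 'g and g1 g2 :: 'c and \<psi> :: "'c \<Rightarrow> complex" and l1 l2 l3 :: complex
  assumes finite: "finite (carrier G)" "finite (carrier \<Gamma>)"
    and \<beta>_mult: "\<lbrakk>g \<in> carrier G; h \<in> carrier G; c \<in> carrier \<Gamma>\<rbrakk> \<Longrightarrow> \<beta> (g \<otimes> h) c = \<beta> g c * \<beta> h c"
      "\<lbrakk>g \<in> carrier G; c \<in> carrier \<Gamma>; d \<in> carrier \<Gamma>\<rbrakk> \<Longrightarrow> \<beta> g (c \<otimes>\<^bsub>\<Gamma>\<^esub> d) = \<beta> g c * \<beta> g d"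
    and \<beta>_nonzero: "\<lbrakk>g \<in> carrier G; c \<in> carrier \<Gamma>\<rbrakk> \<Longrightarrow> \<beta> g c \<noteq> 0"
    and orthogonal: "\<lbrakk>c \<in> carrier \<Gamma>; d \<in> carrier \<Gamma>\<rbrakk> \<Longrightarrow>
        (\<Sum>g\<in>carrier G. \<beta> g c / \<beta> g d) = (if c = d then of_nat (card (carrier G)) else 0)"
      "\<lbrakk>g \<in> carrier G; h \<in> carrier G\<rbrakk> \<Longrightarrow>
        (\<Sum>c\<in>carrier \<Gamma>. \<beta> g c / \<beta> h c) = (if g = h then of_nat (card (carrier G)) else 0)"
    and g12: "g1 \<in> carrier \<Gamma>" "g2 \<in> carrier \<Gamma>" and u: "u \<in> carrier G" "u \<otimes> u = \<one>"
    and \<beta>_u: "\<beta> u g1 = -1" "\<beta> u g2 = -1" "c \<in> carrier \<Gamma> \<Longrightarrow> \<beta> u c = \<psi> c"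
begin

lemma \<beta>_one: "c \<in> carrier \<Gamma> \<Longrightarrow> \<beta> \<one> c = 1" "g \<in> carrier G \<Longrightarrow> \<beta> g \<one>\<^bsub>\<Gamma>\<^esub> = 1"
  using \<beta>_mult(1)[of \<one> \<one> c] \<beta>_nonzero[of \<one> c] \<beta>_mult(2)[of g "\<one>\<^bsub>\<Gamma>\<^esub>" "\<one>\<^bsub>\<Gamma>\<^esub>"] \<beta>_nonzero[of g "\<one>\<^bsub>\<Gamma>\<^esub>"]
  by simp_all

sublocale rank2_datum G "\<lambda>g. \<beta> g g1" "\<lambda>g. \<beta> g g2" u "- l1" "- (l3 / 2)" "- l2"
  by unfold_locales (simp_all add: finite \<beta>_mult \<beta>_one g12 u \<beta>_u)

abbreviation gens :: "'c hgen set" where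
  "gens \<equiv> Grp ` carrier \<Gamma> \<union> {X1, X2}"

abbreviation F where "F \<equiv> free_algebra gens"
abbreviation R where "R \<equiv> H_relations \<Gamma> g1 g2 \<psi> l1 l2 l3"
abbreviation K where "K \<equiv> dual_hopf (structure_hopf X m (e0, \<one>) D e)"
abbreviation N :: complex where "N \<equiv> of_nat (card (carrier G))"

definition I where "I = Idl\<^bsub>F\<^esub> R"

primrec gen_val :: "'c hgen \<Rightarrow> 'g semi \<Rightarrow> complex" where
  "gen_val (Grp c) = (\<lambda>(S, g). if S = e0 then \<beta> g c else 0)"
| "gen_val X1 = (\<lambda>(S, g). if S = e1 then 1 else 0)"
| "gen_val X2 = (\<lambda>(S, g). if S = e2 then 1 else 0)"

primrec word_val :: "'c hgen list \<Rightarrow> 'g semi \<Rightarrow> complex" where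
  "word_val [] = e"
| "word_val (x # w) = conv (gen_val x) (word_val w)"

definition val :: "('c hgen list \<Rightarrow>\<^sub>0 complex) \<Rightarrow> 'g semi \<Rightarrow> complex" where
  "val p a = lin_form (\<lambda>w. word_val w a) p"

definition \<Phi> where "\<Phi> p = hs.func (val p)"

lemma val_simps [simp]: "val 0 a = 0" "val (p + q) a = val p a + val q a" "val (p - q) a = val p a - val q a"
  "val (cscale c p) a = c * val p a" "val (Poly_Mapping.single w c) a = c * word_val w a"
  "val (\<Sum>j\<in>J. p' j) a = (\<Sum>j\<in>J. val (p' j) a)"
  by (simp_all add: val_def)

lemma word_val_append: "a \<in> X \<Longrightarrow> word_val (v @ w) a = conv (word_val v) (word_val w) a"
proof (induction v arbitrary: a)
  case Nil
  then show ?case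
    by (simp add: hs.conv_e)
next
  case (Cons x v)
  have "conv (gen_val x) (word_val (v @ w)) a = conv (gen_val x) (conv (word_val v) (word_val w)) a"
    using Cons by (intro hs.conv_cong) auto
  then show ?case
    using Cons.prems by (simp add: hs.conv_assoc)
qed

lemma ring_hom_\<Phi>: "\<Phi> \<in> Ring.ring_hom F K"
proof (rule ring_hom_memI)
  fix p q assume "p \<in> carrier F" "q \<in> carrier F"
  show "\<Phi> p \<in> carrier K"
    by (simp add: \<Phi>_def)
  show "\<Phi> (p \<oplus>\<^bsub>F\<^esub> q) = \<Phi> p \<oplus>\<^bsub>K\<^esub> \<Phi> q"
    by (rule hs.dual_ext) (simp_all add: \<Phi>_def)
  show "\<Phi> (p \<otimes>\<^bsub>F\<^esub> q) = \<Phi> p \<otimes>\<^bsub>K\<^esub> \<Phi> q"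
  proof (rule hs.dual_ext)
    fix a assume a: "a \<in> X"
    have "val (p \<otimes>\<^bsub>F\<^esub> q) a = lin_form (\<lambda>v. lin_form (\<lambda>w. conv (word_val v) (word_val w) a) q) p"
      using a by (simp add: val_def word_val_append)
    also have "\<dots> = lin_form (\<lambda>v. lin_form (\<lambda>w. lin_form (\<lambda>x. word_val v (fst x) * word_val w (snd x)) (D a)) q) p"
      by (simp only: conv_def case_prod_unfold)
    also have "\<dots> = lin_form (\<lambda>x. lin_form (\<lambda>v. lin_form (\<lambda>w. word_val v (fst x) * word_val w (snd x)) q) p) (D a)"
      by (rule lin_form_rotate)
    also have "\<dots> = conv (val p) (val q) a"
      by (simp only: val_def conv_def case_prod_unfold lin_form_mult)
    finally show "\<Phi> (p \<otimes>\<^bsub>F\<^esub> q) (basis a) = (\<Phi> p \<otimes>\<^bsub>K\<^esub> \<Phi> q) (basis a)"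
      using a by (simp add: \<Phi>_def cong: hs.conv_cong)
  qed (simp_all add: \<Phi>_def)
qed (rule hs.dual_ext; simp add: \<Phi>_def)

end

context grana_datum
begin

lemma R_in_F: "R \<subseteq> carrier F"
proof
  fix r assume "r \<in> R"
  then show "r \<in> carrier F"
    unfolding H_relations_def free_algebra_simps mem_Collect_eq using g12
    by (elim UnE CollectE exE conjE insertE emptyE; simp only:;
        intro keys_diff_subset keys_add_subset keys_cscale; auto)
qed

lemma ideal_I: "ideal I F"
  unfolding I_def by (rule ring.genideal_ideal[OF ring_free_algebra R_in_F])

lemma I_in_F: "p \<in> I \<Longrightarrow> p \<in> carrier F"
  using ideal.Icarr[OF ideal_I] .

lemma R_in_I: "R \<subseteq> I"
  unfolding I_def by (rule ring.genideal_self[OF ring_free_algebra R_in_F])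

lemma I_add: "p \<in> I \<Longrightarrow> q \<in> I \<Longrightarrow> p + q \<in> I"
  using additive_subgroup.a_closed[OF ideal.axioms(1)[OF ideal_I]] by simp

lemma I_zero: "0 \<in> I"
  using additive_subgroup.zero_closed[OF ideal.axioms(1)[OF ideal_I]] by simp

lemma I_left: "p \<in> I \<Longrightarrow> q \<in> carrier F \<Longrightarrow> bilin_ext (\<lambda>v w. basis (v @ w)) q p \<in> I"
  using ideal.I_l_closed[OF ideal_I] by simp

lemma I_right: "p \<in> I \<Longrightarrow> q \<in> carrier F \<Longrightarrow> bilin_ext (\<lambda>v w. basis (v @ w)) p q \<in> I"
  using ideal.I_r_closed[OF ideal_I] by simp

lemma I_cscale: "p \<in> I \<Longrightarrow> cscale c p \<in> I"
proof -
  assume p: "p \<in> I"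
  have "cscale c p = bilin_ext (\<lambda>v w. basis (v @ w)) (cscale c (basis [])) p"
    by (rule poly_mapping_eqI_lin_form) simp
  with I_left[OF p, of "cscale c (basis [])"] keys_cscale[of "basis []" "{w. set w \<subseteq> gens}"] show ?thesis
    by simp
qed

lemma I_uminus: "p \<in> I \<Longrightarrow> - p \<in> I"
proof -
  assume p: "p \<in> I"
  have "- p = cscale (- 1) p"
    by (rule poly_mapping_eqI_lin_form) simp
  with I_cscale[OF p] show ?thesis
    by simp
qed

lemma I_diff: "p \<in> I \<Longrightarrow> q \<in> I \<Longrightarrow> p - q \<in> I"
  using I_add[OF _ I_uminus, of p q] by simp

text \<open>Allows every relation to be applied in the middle of a word.\<close>

lemma I_context:
  assumes "p \<in> I" "set v \<subseteq> gens" "set w \<subseteq> gens"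
  shows "push (\<lambda>z. v @ z @ w) p \<in> I"
proof -
  have "push (\<lambda>z. v @ z @ w) p
      = bilin_ext (\<lambda>v w. basis (v @ w)) (basis v) (bilin_ext (\<lambda>v w. basis (v @ w)) p (basis w))"
    by (rule poly_mapping_eqI_lin_form) simp
  with assms show ?thesis
    by (simp add: I_left I_right)
qed

subsection \<open>The relations hold in the dual\<close>

text \<open>The factor \<open>\<psi> c\<close> is the value of the character at \<open>u\<close>: in
  the coproduct of \<open>e\<^sub>i g\<close> the group element paired with
  \<open>e\<^sub>i g\<close> is \<open>u g\<close>.\<close>

lemma conv_gen_val [simp]:
  assumes "g \<in> carrier G" "c \<in> carrier \<Gamma>"
  shows "conv (gen_val (Grp c)) H (e0, g) = \<beta> g c * H (e0, g)"
    "conv (gen_val (Grp c)) H (e1, g) = \<psi> c * \<beta> g c * H (e1, g)"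
    "conv (gen_val (Grp c)) H (e2, g) = \<psi> c * \<beta> g c * H (e2, g)"
    "conv (gen_val (Grp c)) H (e12, g) = \<beta> g c * H (e12, g)"
  using assms by (simp_all add: conv_def lin_form_D \<beta>_mult \<beta>_u(3))

lemma conv_gen_val_X [simp]:
  assumes "g \<in> carrier G"
  shows "conv (gen_val X1) H (e0, g) = d11 g * H (e1, g) + d12 g * H (e2, g)"
    "conv (gen_val X1) H (e1, g) = H (e0, g) - d12 g * H (e12, g)"
    "conv (gen_val X1) H (e2, g) = d11 g * H (e12, g)"
    "conv (gen_val X1) H (e12, g) = H (e2, g)"
    "conv (gen_val X2) H (e0, g) = d12 g * H (e1, g) + d22 g * H (e2, g)"
    "conv (gen_val X2) H (e1, g) = - d22 g * H (e12, g)"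
    "conv (gen_val X2) H (e2, g) = H (e0, g) + d12 g * H (e12, g)"
    "conv (gen_val X2) H (e12, g) = - H (e1, g)"
  using assms by (simp_all add: conv_def lin_form_D)

declare gen_val.simps [simp del]

lemma \<psi>_simps [simp]: "\<psi> \<one>\<^bsub>\<Gamma>\<^esub> = 1" "c \<in> carrier \<Gamma> \<Longrightarrow> d \<in> carrier \<Gamma> \<Longrightarrow> \<psi> (c \<otimes>\<^bsub>\<Gamma>\<^esub> d) = \<psi> c * \<psi> d"
  "c \<in> carrier \<Gamma> \<Longrightarrow> \<psi> c * \<psi> c = 1" "\<psi> g1 = - 1" "\<psi> g2 = - 1"
  using \<beta>_mult(1)[of u u c] \<beta>_mult(2)[of u c d] by (simp_all add: \<beta>_one g12 flip: \<beta>_u(3))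

lemma \<psi>_inv [simp]:
  assumes "c \<in> carrier \<Gamma>"
  shows "\<psi> (inv\<^bsub>\<Gamma>\<^esub> c) = \<psi> c"
proof -
  have "\<psi> c * \<psi> (inv\<^bsub>\<Gamma>\<^esub> c) = 1"
    using \<psi>_simps(2)[of c "inv\<^bsub>\<Gamma>\<^esub> c"] assms by simp
  then have "\<psi> c * \<psi> c * \<psi> (inv\<^bsub>\<Gamma>\<^esub> c) = \<psi> c"
    by (simp add: mult.assoc)
  with assms show ?thesis
    by simp
qed

lemma \<beta>_inv [simp]: "c \<in> carrier \<Gamma> \<Longrightarrow> g \<in> carrier G \<Longrightarrow> \<beta> g (inv\<^bsub>\<Gamma>\<^esub> c) = inverse (\<beta> g c)"
  using \<beta>_mult(2)[of g c "inv\<^bsub>\<Gamma>\<^esub> c"] by (intro inverse_unique[symmetric]) (simp add: \<beta>_one)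

text \<open>This explains the entries of \<open>B\<close>. At \<open>(e0, g)\<close> the word
  \<open>[X1, X1]\<close> has the value \<open>d11 g\<close>, which is \<open>b11\<close> times
  \<open>\<chi>1 g * \<chi>1 g - 1\<close>, opposite in sign to the value of
  \<open>1 - g1 g1\<close>; hence \<open>b11 = - l1\<close>, and similarly for \<open>X2\<close>.
  Both mixed words have the value \<open>d12 g\<close>, whence the half in
  \<open>- (l3 / 2)\<close>. At \<open>(e12, g)\<close> the mixed words have the values 1 and -1,
  which cancel.\<close>

lemma val_R:
  assumes "r \<in> R" "a \<in> X"
  shows "val r a = 0"
  using assms g12
  by (elim X_cases; auto simp: H_relations_def \<beta>_mult \<beta>_one \<beta>_nonzero;
      (simp add: d11_def d12_def d22_def algebra_simps)?)

lemma ring_hom_ring_\<Phi>: "ring_hom_ring F K \<Phi>"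
  by (rule ring_hom_ringI2[OF ring_free_algebra hs.ring_K ring_hom_\<Phi>])

lemma kernel_\<Phi>_iff: "p \<in> a_kernel F K \<Phi> \<longleftrightarrow> p \<in> carrier F \<and> (\<forall>a\<in>X. val p a = 0)"
proof -
  have "\<Phi> p = (\<lambda>x. 0) \<longleftrightarrow> (\<forall>a\<in>X. val p a = 0)"
  proof
    assume "\<Phi> p = (\<lambda>x. 0)"
    then have "\<Phi> p (basis a) = 0" for a
      by (rule fun_cong)
    then show "\<forall>a\<in>X. val p a = 0"
      unfolding \<Phi>_def using hs.func_basis by metis
  next
    assume "\<forall>a\<in>X. val p a = 0"
    then show "\<Phi> p = (\<lambda>x. 0)"
      by (intro hs.dual_ext hs.K_closed) (simp_all only: \<Phi>_def hs.func_in hs.func_basis)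
  qed
  then show ?thesis
    unfolding a_kernel_def' mem_Collect_eq hs.K_simps by (rule conj_cong[OF refl])
qed

lemma val_I:
  assumes "p \<in> I" "a \<in> X"
  shows "val p a = 0"
proof -
  have "R \<subseteq> a_kernel F K \<Phi>"
    using R_in_F val_R kernel_\<Phi>_iff by blast
  then have "I \<subseteq> a_kernel F K \<Phi>"
    unfolding I_def
    by (rule ring.genideal_minimal[OF ring_free_algebra ring_hom_ring.kernel_is_ideal[OF ring_hom_ring_\<Phi>]])
  with assms show ?thesis
    using kernel_\<Phi>_iff by blast
qed

subsection \<open>Normal words\<close>

text \<open>The Fourier transform on \<open>G\<close> recovers the coefficients of the normal words from their values.\<close>

definition hat :: "('g \<Rightarrow> complex) \<Rightarrow> 'c \<Rightarrow> complex" where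
  "hat f c = (\<Sum>g\<in>carrier G. f g / \<beta> g c) / N"

text \<open>A section of \<open>val\<close> with values in combinations of normal words. The word
  \<open>[Grp c, X1, X2]\<close> has, besides its value at \<open>e12\<close>, the value
  \<open>d12 g * \<beta> g c\<close> at \<open>e0\<close>, which is subtracted. The words ending in
  a single \<open>X1\<close> or \<open>X2\<close> carry a factor \<open>\<psi> c\<close>, undone by
  a second one because its square is 1.\<close>

definition \<theta> :: "('g semi \<Rightarrow> complex) \<Rightarrow> 'c hgen list \<Rightarrow>\<^sub>0 complex" where
  "\<theta> H = (\<Sum>c\<in>carrier \<Gamma>.
     cscale (hat (\<lambda>g. H (e0, g) - d12 g * H (e12, g)) c) (basis [Grp c]) +
     cscale (\<psi> c * hat (\<lambda>g. H (e1, g)) c) (basis [Grp c, X1]) +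
     cscale (\<psi> c * hat (\<lambda>g. H (e2, g)) c) (basis [Grp c, X2]) +
     cscale (hat (\<lambda>g. H (e12, g)) c) (basis [Grp c, X1, X2]))"

lemma N_nonzero: "N \<noteq> 0"
  using finite(1) G.one_closed by auto

lemma hat_simps: "hat (\<lambda>g. f g + f' g) c = hat f c + hat f' c" "hat (\<lambda>g. x * f g) c = x * hat f c"
  "hat (\<lambda>g. 0) c = 0"
  by (simp_all add: hat_def add_divide_distrib sum.distrib sum_distrib_left)

lemma hat_cong: "(\<And>g. g \<in> carrier G \<Longrightarrow> f g = f' g) \<Longrightarrow> hat f c = hat f' c"
  by (simp add: hat_def)

lemma hat_\<beta>: "c \<in> carrier \<Gamma> \<Longrightarrow> d \<in> carrier \<Gamma> \<Longrightarrow> hat (\<lambda>g. \<beta> g c) d = (if c = d then 1 else 0)"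
  using N_nonzero by (simp add: hat_def orthogonal)

lemma hat_inversion:
  assumes "g \<in> carrier G"
  shows "(\<Sum>c\<in>carrier \<Gamma>. hat f c * \<beta> g c) = f g"
proof -
  have "(\<Sum>c\<in>carrier \<Gamma>. hat f c * \<beta> g c) = (\<Sum>c\<in>carrier \<Gamma>. \<Sum>h\<in>carrier G. f h * (\<beta> g c / \<beta> h c)) / N"
    by (simp add: hat_def sum_divide_distrib sum_distrib_right)
  also have "\<dots> = (\<Sum>h\<in>carrier G. f h * (\<Sum>c\<in>carrier \<Gamma>. \<beta> g c / \<beta> h c)) / N"
    by (subst sum.swap) (simp add: sum_distrib_left)
  also have "\<dots> = (\<Sum>h\<in>carrier G. if h = g then f h * N else 0) / N"
    using assms by (intro arg_cong[of _ _ "\<lambda>x. x / N"] sum.cong) (auto simp: orthogonal)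
  also have "\<dots> = f g"
    using assms N_nonzero by (simp add: finite)
  finally show ?thesis .
qed

lemma \<theta>_in: "\<theta> H \<in> carrier F"
  unfolding \<theta>_def free_algebra_simps mem_Collect_eq
  by (intro keys_sum_subset keys_add_subset keys_cscale) auto

lemma \<theta>_add: "\<theta> (\<lambda>a. H a + H' a) = \<theta> H + \<theta> H'"
proof -
  have "hat (\<lambda>g. H (e0, g) + H' (e0, g) - d12 g * (H (e12, g) + H' (e12, g))) c
      = hat (\<lambda>g. H (e0, g) - d12 g * H (e12, g)) c + hat (\<lambda>g. H' (e0, g) - d12 g * H' (e12, g)) c" for c
    by (simp add: algebra_simps flip: hat_simps(1))
  then show ?thesis
    by (intro poly_mapping_eqI_lin_form) (simp add: \<theta>_def hat_simps sum.distrib algebra_simps)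
qed

lemma \<theta>_cscale: "\<theta> (\<lambda>a. x * H a) = cscale x (\<theta> H)"
proof -
  have "hat (\<lambda>g. x * H (e0, g) - d12 g * (x * H (e12, g))) c
      = x * hat (\<lambda>g. H (e0, g) - d12 g * H (e12, g)) c" for c
    by (simp add: algebra_simps flip: hat_simps(2))
  then show ?thesis
    by (intro poly_mapping_eqI_lin_form) (simp add: \<theta>_def hat_simps sum_distrib_left algebra_simps)
qed

lemma \<theta>_zero: "(\<And>a. a \<in> X \<Longrightarrow> H a = 0) \<Longrightarrow> \<theta> H = 0"
proof -
  assume H: "\<And>a. a \<in> X \<Longrightarrow> H a = 0"
  then have "hat (\<lambda>g. H (e0, g) - d12 g * H (e12, g)) c = hat (\<lambda>g. 0) c" "hat (\<lambda>g. H (e1, g)) c = hat (\<lambda>g. 0) c"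
    "hat (\<lambda>g. H (e2, g)) c = hat (\<lambda>g. 0) c" "hat (\<lambda>g. H (e12, g)) c = hat (\<lambda>g. 0) c" for c
    by (auto intro!: hat_cong)
  then show ?thesis
    by (simp add: \<theta>_def hat_simps)
qed

lemma val_\<theta>: "a \<in> X \<Longrightarrow> val (\<theta> H) a = H a"
proof -
  assume "a \<in> X"
  then show ?thesis
  proof (cases rule: X_cases)
    case (1 g)
    have "val (\<theta> H) a = (\<Sum>c\<in>carrier \<Gamma>. hat (\<lambda>g. H (e0, g) - d12 g * H (e12, g)) c * \<beta> g c)
        + d12 g * (\<Sum>c\<in>carrier \<Gamma>. hat (\<lambda>g. H (e12, g)) c * \<beta> g c)"
      using 1 by (simp add: \<theta>_def sum_distrib_left sum.distrib algebra_simps)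
    with 1 show ?thesis
      by (simp add: hat_inversion)
  next
    case (2 g)
    have "val (\<theta> H) a = (\<Sum>c\<in>carrier \<Gamma>. (\<psi> c * \<psi> c) * (hat (\<lambda>g. H (e1, g)) c * \<beta> g c))"
      using 2 by (simp add: \<theta>_def mult_ac del: \<psi>_simps)
    with 2 show ?thesis
      by (simp add: hat_inversion)
  next
    case (3 g)
    have "val (\<theta> H) a = (\<Sum>c\<in>carrier \<Gamma>. (\<psi> c * \<psi> c) * (hat (\<lambda>g. H (e2, g)) c * \<beta> g c))"
      using 3 by (simp add: \<theta>_def mult_ac del: \<psi>_simps)
    with 3 show ?thesis
      by (simp add: hat_inversion)
  next
    case (4 g)
    then show ?thesis
      by (simp add: \<theta>_def hat_inversion)
  qed
qed

end

context grana_datum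
begin

text \<open>The hypotheses describe the values of a combination of normal words with a fixed group
  part \<open>c\<close>, including the term with \<open>d12\<close> at \<open>e0\<close>. The first
  orthogonality relation leaves only the summand for \<open>c\<close>.\<close>

lemma \<theta>_normal:
  assumes c: "c \<in> carrier \<Gamma>"
    and H: "\<And>g. g \<in> carrier G \<Longrightarrow> H (e0, g) = (x0 + d12 g * x3) * \<beta> g c"
      "\<And>g. g \<in> carrier G \<Longrightarrow> H (e1, g) = x1 * \<beta> g c" "\<And>g. g \<in> carrier G \<Longrightarrow> H (e2, g) = x2 * \<beta> g c"
      "\<And>g. g \<in> carrier G \<Longrightarrow> H (e12, g) = x3 * \<beta> g c"
  shows "\<theta> H = cscale x0 (basis [Grp c]) + cscale (\<psi> c * x1) (basis [Grp c, X1])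
    + cscale (\<psi> c * x2) (basis [Grp c, X2]) + cscale x3 (basis [Grp c, X1, X2])"
proof (rule poly_mapping_eqI_lin_form)
  fix L
  have hat: "hat (\<lambda>g. H (e0, g) - d12 g * H (e12, g)) d = hat (\<lambda>g. x0 * \<beta> g c) d"
    "hat (\<lambda>g. H (e1, g)) d = hat (\<lambda>g. x1 * \<beta> g c) d" "hat (\<lambda>g. H (e2, g)) d = hat (\<lambda>g. x2 * \<beta> g c) d"
    "hat (\<lambda>g. H (e12, g)) d = hat (\<lambda>g. x3 * \<beta> g c) d" for d
    by (auto intro!: hat_cong simp: H algebra_simps)
  have "lin_form L (\<theta> H) = (\<Sum>d\<in>carrier \<Gamma>. if c = d then x0 * L [Grp c] + \<psi> c * x1 * L [Grp c, X1]
      + \<psi> c * x2 * L [Grp c, X2] + x3 * L [Grp c, X1, X2] else 0)"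
    unfolding \<theta>_def lin_form_sum using c by (intro sum.cong) (simp_all add: hat hat_simps hat_\<beta>)
  with c show "lin_form L (\<theta> H) = lin_form L (cscale x0 (basis [Grp c]) + cscale (\<psi> c * x1) (basis [Grp c, X1])
    + cscale (\<psi> c * x2) (basis [Grp c, X2]) + cscale x3 (basis [Grp c, X1, X2]))"
    by (simp add: finite)
qed

text \<open>Says that \<open>p\<close> is congruent modulo \<open>I\<close> to the normal
  combination with the same values. Once this holds for all \<open>p\<close>, vanishing values force
  \<open>p\<close> into \<open>I\<close>.\<close>

definition nf :: "('c hgen list \<Rightarrow>\<^sub>0 complex) \<Rightarrow> bool" where
  "nf p \<longleftrightarrow> p \<in> carrier F \<and> \<theta> (val p) - p \<in> I"

lemma val_eta: "val (p + q) = (\<lambda>a. val p a + val q a)" "val (cscale x p) = (\<lambda>a. x * val p a)"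
  by (simp_all add: fun_eq_iff)

lemma nf_add: "nf p \<Longrightarrow> nf q \<Longrightarrow> nf (p + q)"
proof -
  assume p: "nf p" and q: "nf q"
  have "\<theta> (val (p + q)) - (p + q) = (\<theta> (val p) - p) + (\<theta> (val q) - q)"
    by (simp add: val_eta \<theta>_add)
  moreover have "p + q \<in> carrier F"
    using p q by (simp add: nf_def keys_add_subset)
  ultimately show ?thesis
    using p q unfolding nf_def by (simp only: I_add)
qed

lemma nf_cscale: "nf p \<Longrightarrow> nf (cscale x p)"
proof -
  assume p: "nf p"
  have "\<theta> (val (cscale x p)) - cscale x p = cscale x (\<theta> (val p) - p)"
    by (rule poly_mapping_eqI_lin_form) (simp add: val_eta \<theta>_cscale right_diff_distrib)
  with p show ?thesis
    by (simp add: nf_def I_cscale keys_cscale)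
qed

lemma nf_zero: "nf 0"
  by (simp add: nf_def \<theta>_zero I_zero)

lemma nf_sum: "(\<And>j. j \<in> J \<Longrightarrow> nf (p j)) \<Longrightarrow> nf (sum p J)"
  by (induction J rule: infinite_finite_induct) (auto intro: nf_zero nf_add)

text \<open>Values vanish on \<open>I\<close>, so congruent elements have the same normal
  combination. This makes \<open>nf\<close> invariant under rewriting.\<close>

lemma nf_I:
  assumes "p - q \<in> I" "nf q"
  shows "nf p"
proof -
  have "val p = (\<lambda>a. val q a + val (p - q) a)"
    by (simp add: fun_eq_iff)
  then have "\<theta> (val p) = \<theta> (val q) + \<theta> (val (p - q))"
    by (simp only: \<theta>_add)
  moreover have "\<theta> (val (p - q)) = 0"
    using assms(1) val_I by (intro \<theta>_zero)
  ultimately have "\<theta> (val p) - p = (\<theta> (val q) - q) - (p - q)"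
    by simp
  moreover have "(p - q) + q \<in> carrier F"
    using assms I_in_F[OF assms(1)] by (simp only: nf_def free_algebra_simps mem_Collect_eq keys_add_subset)
  then have "p \<in> carrier F"
    by (simp only: diff_add_cancel)
  ultimately show ?thesis
    using assms unfolding nf_def by (simp only: I_diff)
qed

lemma nf_normal:
  assumes "c \<in> carrier \<Gamma>"
  shows "nf (basis [Grp c])" "nf (basis [Grp c, X1])" "nf (basis [Grp c, X2])" "nf (basis [Grp c, X1, X2])"
proof -
  note [simp] = assms
  have val: "val (basis w) = word_val w" for w
    by (simp add: fun_eq_iff)
  \<comment> \<open>The instantiations below list \<open>x0\<close>, \<open>x3\<close>,
    \<open>x1\<close>, \<open>x2\<close> in this order, and they are values rather than
    coefficients: a single \<open>X1\<close> or \<open>X2\<close> gives \<open>\<psi> c\<close>,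
    which the factor \<open>\<psi> c\<close> in \<open>\<theta>\<close> turns into the coefficient
    1.\<close>
  have "\<theta> (word_val [Grp c]) = basis [Grp c]"
    by (subst \<theta>_normal[of c _ 1 0 0 0]) simp_all
  moreover have "\<theta> (word_val [Grp c, X1]) = basis [Grp c, X1]"
    by (subst \<theta>_normal[of c _ 0 0 "\<psi> c" 0]) simp_all
  moreover have "\<theta> (word_val [Grp c, X2]) = basis [Grp c, X2]"
    by (subst \<theta>_normal[of c _ 0 0 0 "\<psi> c"]) simp_all
  moreover have "\<theta> (word_val [Grp c, X1, X2]) = basis [Grp c, X1, X2]"
    by (subst \<theta>_normal[of c _ 0 1 0 0]) simp_all
  ultimately show "nf (basis [Grp c])" "nf (basis [Grp c, X1])" "nf (basis [Grp c, X2])" "nf (basis [Grp c, X1, X2])"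
    by (simp_all add: nf_def val I_zero del: word_val.simps)
qed

section \<open>Rewriting words modulo the relations\<close>

context
  fixes v w assumes v: "set v \<subseteq> gens" and w: "set w \<subseteq> gens"
begin

lemma R_context: "r \<in> R \<Longrightarrow> push (\<lambda>z. v @ z @ w) r \<in> I"
  using R_in_I I_context[OF _ v w] by blast

lemma I_one: "basis (v @ Grp \<one>\<^bsub>\<Gamma>\<^esub> # w) - basis (v @ w) \<in> I"
  using R_context[of "basis [Grp \<one>\<^bsub>\<Gamma>\<^esub>] - basis []"] by (simp add: H_relations_def)

lemma I_mult:
  assumes "a \<in> carrier \<Gamma>" "b \<in> carrier \<Gamma>"
  shows "basis (v @ Grp a # Grp b # w) - basis (v @ Grp (a \<otimes>\<^bsub>\<Gamma>\<^esub> b) # w) \<in> I"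
proof -
  have "basis [Grp a, Grp b] - basis [Grp (a \<otimes>\<^bsub>\<Gamma>\<^esub> b)] \<in> R"
    using assms unfolding H_relations_def by blast
  from R_context[OF this] show ?thesis
    by simp
qed

lemma I_conj:
  assumes "h \<in> carrier \<Gamma>" "x \<in> {X1, X2}"
  shows "basis (v @ Grp h # x # Grp (inv\<^bsub>\<Gamma>\<^esub> h) # w) - cscale (\<psi> h) (basis (v @ x # w)) \<in> I"
proof -
  have "basis [Grp h, x, Grp (inv\<^bsub>\<Gamma>\<^esub> h)] - cscale (\<psi> h) (basis [x]) \<in> R"
    using assms unfolding H_relations_def by blast
  from R_context[OF this] show ?thesis
    by simp
qed

lemma I_X:
  "basis (v @ X1 # X1 # w) - cscale l1 (basis (v @ w) - basis (v @ Grp g1 # Grp g1 # w)) \<in> I"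
  "basis (v @ X2 # X2 # w) - cscale l2 (basis (v @ w) - basis (v @ Grp g2 # Grp g2 # w)) \<in> I"
  "basis (v @ X1 # X2 # w) + basis (v @ X2 # X1 # w)
    - cscale l3 (basis (v @ w) - basis (v @ Grp g1 # Grp g2 # w)) \<in> I"
  using R_context[of "basis [X1, X1] - cscale l1 (basis [] - basis [Grp g1, Grp g1])"]
    R_context[of "basis [X2, X2] - cscale l2 (basis [] - basis [Grp g2, Grp g2])"]
    R_context[of "basis [X1, X2] + basis [X2, X1] - cscale l3 (basis [] - basis [Grp g1, Grp g2])"]
  by (simp_all add: H_relations_def)

lemma nf_diff: "nf p \<Longrightarrow> nf q \<Longrightarrow> nf (p - q)"
  using nf_add[OF _ nf_cscale[of q "- 1"], of p] by (simp add: cscale_minus_one)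

lemma nf_mult:
  "\<lbrakk>a \<in> carrier \<Gamma>; b \<in> carrier \<Gamma>; nf (basis (v @ Grp (a \<otimes>\<^bsub>\<Gamma>\<^esub> b) # w))\<rbrakk> \<Longrightarrow> nf (basis (v @ Grp a # Grp b # w))"
  by (rule nf_I[OF I_mult])

lemma nf_X1_X1: "nf (basis (v @ w)) \<Longrightarrow> nf (basis (v @ Grp g1 # Grp g1 # w)) \<Longrightarrow> nf (basis (v @ X1 # X1 # w))"
  by (rule nf_I[OF I_X(1) nf_cscale[OF nf_diff]])

lemma nf_X2_X2: "nf (basis (v @ w)) \<Longrightarrow> nf (basis (v @ Grp g2 # Grp g2 # w)) \<Longrightarrow> nf (basis (v @ X2 # X2 # w))"
  by (rule nf_I[OF I_X(2) nf_cscale[OF nf_diff]])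

lemma nf_X2_X1:
  assumes "nf (basis (v @ w))" "nf (basis (v @ Grp g1 # Grp g2 # w))" "nf (basis (v @ X1 # X2 # w))"
  shows "nf (basis (v @ X2 # X1 # w))"
proof (rule nf_I)
  show "basis (v @ X2 # X1 # w) - (cscale l3 (basis (v @ w) - basis (v @ Grp g1 # Grp g2 # w)) - basis (v @ X1 # X2 # w)) \<in> I"
    using I_X(3) by (simp add: algebra_simps)
qed (intro nf_diff nf_cscale assms)

end

text \<open>The relation conjugates a generator by \<open>c\<close>. Appending \<open>c\<close> and
  cancelling it against its inverse, by \<open>?B\<close> and \<open>?C\<close>, gives the
  commutation rule; multiplying by \<open>\<psi> c\<close> solves it for the word to be rewritten,
  since the square of \<open>\<psi> c\<close> is 1.\<close>

lemma nf_swap: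
  assumes v: "set v \<subseteq> gens" and w: "set w \<subseteq> gens" and c: "c \<in> carrier \<Gamma>" and x: "x \<in> {X1, X2}"
    and nf: "nf (basis (v @ Grp c # x # w))"
  shows "nf (basis (v @ x # Grp c # w))"
proof (rule nf_I)
  let ?A = "basis (v @ Grp c # x # Grp (inv\<^bsub>\<Gamma>\<^esub> c) # Grp c # w) - cscale (\<psi> c) (basis (v @ x # Grp c # w))"
  let ?B = "basis ((v @ [Grp c, x]) @ Grp (inv\<^bsub>\<Gamma>\<^esub> c) # Grp c # w) - basis ((v @ [Grp c, x]) @ Grp (inv\<^bsub>\<Gamma>\<^esub> c \<otimes>\<^bsub>\<Gamma>\<^esub> c) # w)"
  let ?C = "basis ((v @ [Grp c, x]) @ Grp \<one>\<^bsub>\<Gamma>\<^esub> # w) - basis ((v @ [Grp c, x]) @ w)"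
  have v': "set (v @ [Grp c, x]) \<subseteq> gens" and w': "set (Grp c # w) \<subseteq> gens"
    using v w c x by auto
  have "?A \<in> I" "?B \<in> I" "?C \<in> I"
    using I_conj[OF v w' c x] I_mult[OF v' w, of "inv\<^bsub>\<Gamma>\<^esub> c" c] I_one[OF v' w] c by auto
  then have "cscale (\<psi> c) (?B + ?C - ?A) \<in> I"
    by (simp only: I_cscale I_diff I_add)
  also have "cscale (\<psi> c) (?B + ?C - ?A) = basis (v @ x # Grp c # w) - cscale (\<psi> c) (basis (v @ Grp c # x # w))"
    using c by (intro poly_mapping_eqI_lin_form) (simp add: algebra_simps flip: mult.assoc)
  finally show "basis (v @ x # Grp c # w) - cscale (\<psi> c) (basis (v @ Grp c # x # w)) \<in> I" .
qed (intro nf_cscale nf)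

text \<open>Generators from the left suffice to build all words. The generator is first moved behind
  \<open>Grp c\<close>, which leaves products of few \<open>X1\<close> and \<open>X2\<close>. The
  longest cases are \<open>X1 X1 X2\<close>, reduced by the square relation, and
  \<open>X2 X1 X2\<close>, which the mixed relation turns into \<open>X1 X2 X2\<close> and shorter
  words.\<close>

lemma nf_generator_normal:
  assumes c: "c \<in> carrier \<Gamma>" and x: "x \<in> gens" and s: "s \<in> {[], [X1], [X2], [X1, X2]}"
  shows "nf (basis (x # Grp c # s))"
proof -
  note [simp] = c g12
  have normal: "nf (basis (Grp d # s))" if "d \<in> carrier \<Gamma>" "s \<in> {[], [X1], [X2], [X1, X2]}" for d s
    using that nf_normal by auto
  have mult: "nf (basis (Grp a # Grp d # s))"
    if "a \<in> carrier \<Gamma>" "d \<in> carrier \<Gamma>" "s \<in> {[], [X1], [X2], [X1, X2]}" for a d s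
    using that nf_mult[of "[]" s a d] normal[of "a \<otimes>\<^bsub>\<Gamma>\<^esub> d" s] by auto
  have mult3: "nf (basis (Grp a # Grp b # Grp d # s))"
    if "a \<in> carrier \<Gamma>" "b \<in> carrier \<Gamma>" "d \<in> carrier \<Gamma>" "s \<in> {[], [X1], [X2], [X1, X2]}" for a b d s
    using that nf_mult[of "[]" "Grp d # s" a b] mult[of "a \<otimes>\<^bsub>\<Gamma>\<^esub> b" d s] by auto
  have X1_X1: "nf (basis (Grp c # X1 # X1 # s))" if "s \<in> {[], [X2]}" for s
    using that nf_X1_X1[of "[Grp c]" s] normal[of c s] mult3[of c g1 g1 s] by auto
  have X2_X2: "nf (basis [Grp c, X2, X2])"
    using nf_X2_X2[of "[Grp c]" "[]"] normal[of c "[]"] mult3[of c g2 g2 "[]"] by auto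
  have X2_X1: "nf (basis [Grp c, X2, X1])"
    using nf_X2_X1[of "[Grp c]" "[]"] normal[of c "[]"] normal[of c "[X1, X2]"] mult3[of c g1 g2 "[]"] by auto
  \<comment> \<open>Squaring \<open>X2\<close> behind \<open>X1\<close> produces two copies of
    \<open>g2\<close> to the right of \<open>X1\<close>; they are moved to its left one at a
    time.\<close>
  have "nf (basis [Grp c, Grp g2, X1, Grp g2])"
    using nf_swap[of "[Grp c, Grp g2]" "[]" g2 X1] mult3[of c g2 g2 "[X1]"] by auto
  then have "nf (basis [Grp c, X1, Grp g2, Grp g2])"
    using nf_swap[of "[Grp c]" "[Grp g2]" g2 X1] by auto
  then have "nf (basis [Grp c, X1, X2, X2])"
    using nf_X2_X2[of "[Grp c, X1]" "[]"] normal[of c "[X1]"] by auto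
  then have X2_X1_X2: "nf (basis [Grp c, X2, X1, X2])"
    using nf_X2_X1[of "[Grp c]" "[X2]"] normal[of c "[X2]"] mult3[of c g1 g2 "[X2]"] by auto
  consider a where "a \<in> carrier \<Gamma>" "x = Grp a" | "x = X1" | "x = X2"
    using x by auto
  then show ?thesis
  proof cases
    case 1
    with mult[of _ c s] s show ?thesis
      by simp
  next
    case 2
    have "nf (basis (Grp c # X1 # s))"
      using s normal[of c "[X1]"] normal[of c "[X1, X2]"] X1_X1[of "[]"] X1_X1[of "[X2]"] by auto
    with 2 s nf_swap[of "[]" s c X1] show ?thesis
      by auto
  next
    case 3
    have "nf (basis (Grp c # X2 # s))"
      using s normal[of c "[X2]"] X2_X1 X2_X2 X2_X1_X2 by auto
    with 3 s nf_swap[of "[]" s c X2] show ?thesis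
      by auto
  qed
qed

text \<open>By hypothesis \<open>p\<close> may be replaced modulo \<open>I\<close> by a combination
  of normal words, and the previous lemma applies to each of them.\<close>

lemma nf_generator:
  assumes p: "nf p" and x: "x \<in> gens"
  shows "nf (push (Cons x) p)"
proof (rule nf_I)
  have "- (\<theta> (val p) - p) \<in> I"
    using p by (simp only: nf_def I_uminus)
  then have "push (\<lambda>z. [x] @ z @ []) (- (\<theta> (val p) - p)) \<in> I"
    using x by (intro I_context) auto
  then show "push (Cons x) p - push (Cons x) (\<theta> (val p)) \<in> I"
    by simp
  have "push (Cons x) (\<theta> H) = (\<Sum>c\<in>carrier \<Gamma>.
     cscale (hat (\<lambda>g. H (e0, g) - d12 g * H (e12, g)) c) (basis [x, Grp c]) +
     cscale (\<psi> c * hat (\<lambda>g. H (e1, g)) c) (basis [x, Grp c, X1]) +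
     cscale (\<psi> c * hat (\<lambda>g. H (e2, g)) c) (basis [x, Grp c, X2]) +
     cscale (hat (\<lambda>g. H (e12, g)) c) (basis [x, Grp c, X1, X2]))" for H
    by (rule poly_mapping_eqI_lin_form) (simp add: \<theta>_def)
  then show "nf (push (Cons x) (\<theta> (val p)))"
    using nf_generator_normal[OF _ x] by (simp only:) (intro nf_sum nf_add nf_cscale; simp)
qed

lemma nf_word: "set w \<subseteq> gens \<Longrightarrow> nf (basis w)"
proof (induction w)
  case Nil
  \<comment> \<open>The empty word is not itself normal; its normal form is the word of the group
    unit.\<close>
  have "basis [] - basis [Grp \<one>\<^bsub>\<Gamma>\<^esub>] \<in> I"
    using I_uminus[OF I_one[of "[]" "[]"]] by simp
  then show ?case
    by (rule nf_I) (simp add: nf_normal)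
next
  case (Cons x w)
  then show ?case
    using nf_generator[of "basis w" x] by simp
qed

lemma nf_all:
  assumes "p \<in> carrier F"
  shows "nf p"
proof -
  have "nf (\<Sum>w\<in>Poly_Mapping.keys p. cscale (Poly_Mapping.lookup p w) (basis w))"
    using assms by (intro nf_sum nf_cscale nf_word) auto
  then show ?thesis
    by (simp flip: poly_mapping_expand)
qed

lemma kernel_\<Phi>: "a_kernel F K \<Phi> = I"
proof -
  have "p \<in> I" if p: "p \<in> carrier F" and "\<forall>a\<in>X. val p a = 0" for p
  proof -
    have "\<theta> (val p) = 0"
      using that by (intro \<theta>_zero) auto
    then have "- p \<in> I"
      using nf_all[OF p] by (simp add: nf_def)
    then show ?thesis
      using I_uminus[of "- p"] by simp
  qed
  with val_I I_in_F have "p \<in> a_kernel F K \<Phi> \<longleftrightarrow> p \<in> I" for p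
    unfolding kernel_\<Phi>_iff by metis
  then show ?thesis
    by (rule Set.set_eqI)
qed

lemma surj_\<Phi>: "\<Phi> ` carrier F = carrier K"
proof
  show "\<Phi> ` carrier F \<subseteq> carrier K"
    using ring_hom_closed[OF ring_hom_\<Phi>] by blast
  show "carrier K \<subseteq> \<Phi> ` carrier F"
  proof
    fix f assume f: "f \<in> carrier K"
    have *: "\<Phi> (\<theta> (\<lambda>a. f (basis a))) = f"
      using f by (intro hs.dual_ext) (simp_all only: \<Phi>_def hs.func_in hs.func_basis val_\<theta> hs.K_simps)
    show "f \<in> \<Phi> ` carrier F"
      by (rule image_eqI[where x = "\<theta> (\<lambda>a. f (basis a))"], rule *[symmetric], rule \<theta>_in)
  qed
qed

end

section \<open>The presented quotient as a model of the dual\<close>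

context grana_datum
begin

abbreviation Q where "Q \<equiv> F Quot I"
abbreviation H where "H \<equiv> grana_hopf \<Gamma> g1 g2 \<psi> l1 l2 l3"
abbreviation coset where "coset p \<equiv> I +>\<^bsub>F\<^esub> p"

definition \<phi> where "\<phi> A = the_elem (\<Phi> ` A)"

lemma H_simps [simp]:
  "carrier H = carrier Q" "monoid.mult H = monoid.mult Q" "monoid.one H = monoid.one Q"
  "ring.zero H = ring.zero Q" "ring.add H = ring.add Q"
  "c \<odot>\<^bsub>H\<^esub> A = (\<Union>p\<in>A. coset (cscale c p))"
  "comult H A = push (\<lambda>(v, w). [coset (basis v), coset (basis w)])
     (free_comult (H_comult_gen g1 g2) (SOME p. p \<in> A))"
  "counit H A = lin_form (\<lambda>w. prod_list (map H_counit_gen w)) (SOME p. p \<in> A)"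
  by (simp_all add: grana_hopf_def presented_hopf_def Let_def I_def)

lemma iso_Q: "\<phi> \<in> ring_iso Q K"
  using ring_hom_ring.FactRing_iso_set[OF ring_hom_ring_\<Phi> surj_\<Phi>] unfolding kernel_\<Phi> \<phi>_def[abs_def] .

lemma iso_H: "\<phi> \<in> ring_iso H K"
  using iso_Q unfolding ring_iso_def Ring.ring_hom_def by (simp only: H_simps)

lemma ring_Q: "ring Q"
  by (rule ideal.quotient_is_ring[OF ideal_I])

lemma ring_H: "ring H"
proof -
  interpret Q: ring Q
    by (rule ring_Q)
  have inverse: "\<exists>B\<in>carrier Q. B \<oplus>\<^bsub>Q\<^esub> A = \<zero>\<^bsub>Q\<^esub>" if "A \<in> carrier Q" for A
    using that by (intro bexI[of _ "\<ominus>\<^bsub>Q\<^esub> A"] Q.l_neg Q.a_inv_closed)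
  have group: "abelian_group H"
    by (rule abelian_groupI; unfold H_simps)
      (fact Q.add.m_closed Q.zero_closed Q.a_assoc Q.a_comm Q.l_zero inverse)+
  have monoid: "monoid H"
    by (rule monoidI; unfold H_simps) (fact Q.m_closed Q.one_closed Q.m_assoc Q.l_one Q.r_one)+
  show ?thesis
    by (rule ringI[OF group monoid]; unfold H_simps) (fact Q.l_distr Q.r_distr)+
qed

lemma coset_in: "p \<in> carrier F \<Longrightarrow> coset p \<in> carrier Q"
  using ring_hom_closed[OF ideal.rcos_ring_hom[OF ideal_I]] by blast

lemma \<phi>_coset: "p \<in> carrier F \<Longrightarrow> \<phi> (coset p) = \<Phi> p"
  using ring_hom_ring.the_elem_simp[OF ring_hom_ring_\<Phi>, of p] unfolding kernel_\<Phi> \<phi>_def .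

lemma carrier_Q_cases:
  assumes "A \<in> carrier Q"
  obtains p where "p \<in> carrier F" "A = coset p"
  using assms by (auto simp: FactRing_def A_RCOSETS_def')

text \<open>Independence of the representative, obtained from evaluation: members of a coset have
  equal values, and \<open>\<phi>\<close> is injective. It handles the \<open>SOME\<close> in the
  coproduct and counit and the union in the scalar multiplication.\<close>

lemma coset_memD:
  assumes "A \<in> carrier Q" "p \<in> A"
  shows "p \<in> carrier F" "coset p = A"
proof -
  obtain q where q: "q \<in> carrier F" "A = coset q"
    using carrier_Q_cases[OF assms(1)] .
  then obtain i where i: "i \<in> I" "p = i + q"
    using assms(2) by (auto simp: a_r_coset_def')
  show p: "p \<in> carrier F"
    using i q I_in_F[OF i(1)] by (simp add: keys_add_subset)
  have "\<Phi> p = \<Phi> q"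
    by (rule hs.dual_ext) (simp_all add: \<Phi>_def i val_I)
  then have "\<phi> (coset p) = \<phi> (coset q)"
    by (simp only: \<phi>_coset[OF p] \<phi>_coset[OF q(1)])
  moreover have "inj_on \<phi> (carrier Q)"
    using iso_Q by (simp add: ring_iso_def bij_betw_def)
  ultimately show "coset p = A"
    unfolding q(2) using coset_in[OF p] coset_in[OF q(1)] by (simp only: inj_on_eq_iff)
qed

lemma some_in:
  assumes "A \<in> carrier Q"
  shows "(SOME p. p \<in> A) \<in> A"
proof -
  obtain q where q: "q \<in> carrier F" "A = coset q"
    using carrier_Q_cases[OF assms] .
  then have "0 + q \<in> A"
    using I_zero unfolding q(2) a_r_coset_def' by auto
  then show ?thesis
    by (rule someI)
qed

lemma \<phi>_some:
  assumes "A \<in> carrier Q" "a \<in> X"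
  shows "\<phi> A (basis a) = val (SOME p. p \<in> A) a"
  using \<phi>_coset[OF coset_memD(1)[OF assms(1) some_in[OF assms(1)]]]
    coset_memD(2)[OF assms(1) some_in[OF assms(1)]] assms(2)
  by (simp only: \<Phi>_def hs.func_basis)

text \<open>All sets in the defining union coincide, and the union is over a nonempty set.\<close>

lemma smult_coset:
  assumes "p \<in> carrier F"
  shows "c \<odot>\<^bsub>H\<^esub> coset p = coset (cscale c p)"
proof -
  have "coset (cscale c q) = coset (cscale c p)" if q: "q \<in> coset p" for q
  proof -
    have qF: "q \<in> carrier F" and eq: "coset q = coset p"
      using coset_memD[OF coset_in[OF assms] q] by simp_all
    have scale: "cscale c r \<in> carrier F" if "r \<in> carrier F" for r
      using that by (simp add: keys_cscale)
    have "\<Phi> q = \<Phi> p"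
      using \<phi>_coset[OF qF] \<phi>_coset[OF assms] eq by simp
    then have "val q a = val p a" if "a \<in> X" for a
      unfolding \<Phi>_def using that hs.func_basis by metis
    then have "\<Phi> (cscale c q) = \<Phi> (cscale c p)"
      by (intro hs.dual_ext) (simp_all add: \<Phi>_def)
    then have "\<phi> (coset (cscale c q)) = \<phi> (coset (cscale c p))"
      by (simp only: \<phi>_coset scale qF assms)
    moreover have "inj_on \<phi> (carrier Q)"
      using iso_Q by (simp add: ring_iso_def bij_betw_def)
    ultimately show ?thesis
      using coset_in[OF scale[OF qF]] coset_in[OF scale[OF assms]] by (simp only: inj_on_eq_iff)
  qed
  moreover have "coset p \<noteq> {}"
    using some_in[OF coset_in[OF assms]] by blast
  ultimately show ?thesis
    unfolding H_simps by blast
qed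

text \<open>The duality of coproduct and product on generators. The term \<open>Grp g1\<close>
  tensor \<open>X1\<close> matches \<open>g e\<^sub>1 = \<chi>\<^sub>1(g) e\<^sub>1 g\<close>, which
  is why \<open>V\<close> must consist of the characters given by \<open>g1\<close> and
  \<open>g2\<close>.\<close>

lemma gen_val_product:
  assumes "x \<in> gens" "c \<in> X" "d \<in> X"
  shows "lin_form (\<lambda>(v, v'). word_val v c * word_val v' d) (H_comult_gen g1 g2 x) = lin_form (gen_val x) (m c d)"
proof -
  have [simp]: "gen_val (Grp h) (e0, g) = \<beta> g h" "gen_val (Grp h) (e1, g) = 0" "gen_val (Grp h) (e2, g) = 0"
    "gen_val (Grp h) (e12, g) = 0" "gen_val X1 (e0, g) = 0" "gen_val X1 (e1, g) = 1" "gen_val X1 (e2, g) = 0"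
    "gen_val X1 (e12, g) = 0" "gen_val X2 (e0, g) = 0" "gen_val X2 (e1, g) = 0" "gen_val X2 (e2, g) = 1"
    "gen_val X2 (e12, g) = 0" for g h
    by (simp_all add: gen_val.simps)
  show ?thesis
    using assms g12 by (elim X_cases; auto simp: \<beta>_mult)
qed

text \<open>Passes from generators to words: both coproducts are multiplicative, so the same
  exchange of sums as in \<open>tensor_mult_comult\<close> splits off the first letter.\<close>

lemma word_val_comult:
  assumes "set w \<subseteq> gens" "a \<in> X" "b \<in> X"
  shows "lin_form (\<lambda>(v, v'). word_val v a * word_val v' b) (free_comult (H_comult_gen g1 g2) (basis w))
    = lin_form (word_val w) (m a b)"
  using assms
proof (induction w arbitrary: a b)
  case Nil
  then show ?case
    by (simp add: free_comult_def hs.e_m)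
next
  case (Cons x w)
  let ?d = "H_comult_gen g1 g2 x" and ?w = "free_comult (H_comult_gen g1 g2) (basis w)"
  note a = Cons.prems(2) and b = Cons.prems(3)
  have "free_comult (H_comult_gen g1 g2) (basis (x # w))
      = bilin_ext (\<lambda>(v, v') (w, w'). basis (v @ w, v' @ w')) ?d ?w"
    by (rule poly_mapping_eqI_lin_form) (simp add: free_comult_def)
  then have "lin_form (\<lambda>(v, v'). word_val v a * word_val v' b) (free_comult (H_comult_gen g1 g2) (basis (x # w)))
      = lin_form (\<lambda>p. lin_form (\<lambda>q. conv (word_val (fst p)) (word_val (fst q)) a
          * conv (word_val (snd p)) (word_val (snd q)) b) ?w) ?d"
    using a b by (simp add: case_prod_unfold word_val_append)
  also have "\<dots> = lin_form (\<lambda>p. lin_form (\<lambda>q. lin_form (\<lambda>r. lin_form (\<lambda>s.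
      (word_val (fst p) (fst r) * word_val (snd p) (fst s))
      * (word_val (fst q) (snd r) * word_val (snd q) (snd s))) (D b)) (D a)) ?w) ?d"
    by (simp add: conv_def case_prod_unfold lin_form_mult mult_ac)
  also have "\<dots> = lin_form (\<lambda>r. lin_form (\<lambda>s. lin_form (\<lambda>p. lin_form (\<lambda>q.
      (word_val (fst p) (fst r) * word_val (snd p) (fst s))
      * (word_val (fst q) (snd r) * word_val (snd q) (snd s))) ?w) ?d) (D b)) (D a)"
    by (rule lin_form_swap4)
  also have "\<dots> = lin_form (\<lambda>r. lin_form (\<lambda>s. lin_form (gen_val x) (m (fst r) (fst s))
      * lin_form (word_val w) (m (snd r) (snd s))) (D b)) (D a)"
  proof (intro lin_form_cong)
    fix r s assume "r \<in> Poly_Mapping.keys (D a)" "s \<in> Poly_Mapping.keys (D b)"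
    then have rs: "fst r \<in> X" "snd r \<in> X" "fst s \<in> X" "snd s \<in> X"
      using subsetD[OF keys_D[OF a]] subsetD[OF keys_D[OF b]] by (auto simp: mem_Times_iff)
    have "lin_form (\<lambda>p. word_val (fst p) (fst r) * word_val (snd p) (fst s)) ?d = lin_form (gen_val x) (m (fst r) (fst s))"
      using gen_val_product[of x "fst r" "fst s"] rs Cons.prems(1) by (simp add: case_prod_unfold)
    moreover have "lin_form (\<lambda>q. word_val (fst q) (snd r) * word_val (snd q) (snd s)) ?w = lin_form (word_val w) (m (snd r) (snd s))"
      using Cons.IH[of "snd r" "snd s"] rs Cons.prems(1) by (simp add: case_prod_unfold)
    ultimately show "lin_form (\<lambda>p. lin_form (\<lambda>q. (word_val (fst p) (fst r) * word_val (snd p) (fst s))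
        * (word_val (fst q) (snd r) * word_val (snd q) (snd s))) ?w) ?d
      = lin_form (gen_val x) (m (fst r) (fst s)) * lin_form (word_val w) (m (snd r) (snd s))"
      by (simp only: lin_form_mult[symmetric])
  qed
  also have "\<dots> = lin_form (conv (gen_val x) (word_val w)) (m a b)"
    using hs.conv_m[OF a b, of "gen_val x" "word_val w"] by (simp add: case_prod_unfold)
  finally show ?case
    by simp
qed

lemma keys_free_comult:
  assumes "p \<in> carrier F"
  shows "Poly_Mapping.keys (free_comult (H_comult_gen g1 g2) p) \<subseteq> {w. set w \<subseteq> gens} \<times> {w. set w \<subseteq> gens}"
  unfolding free_comult_def
proof (rule keys_lin_ext_subset)
  fix w assume "w \<in> Poly_Mapping.keys p"
  with assms have "set w \<subseteq> gens"
    by auto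
  then show "Poly_Mapping.keys (foldr (\<lambda>x. bilin_ext (\<lambda>(v, v') (w, w'). basis (v @ w, v' @ w')) (H_comult_gen g1 g2 x)) w (basis ([], [])))
      \<subseteq> {w. set w \<subseteq> gens} \<times> {w. set w \<subseteq> gens}"
  proof (induction w)
    case (Cons x w)
    have gen: "Poly_Mapping.keys (H_comult_gen g1 g2 x) \<subseteq> {w. set w \<subseteq> gens} \<times> {w. set w \<subseteq> gens}"
      using Cons.prems g12 by (cases x) (simp_all add: keys_add_subset)
    show ?case
      unfolding foldr_Cons comp_def
    proof (rule keys_bilin_ext_subset)
      fix a b
      assume a: "a \<in> Poly_Mapping.keys (H_comult_gen g1 g2 x)"
        and b: "b \<in> Poly_Mapping.keys (foldr (\<lambda>x. bilin_ext (\<lambda>(v, v') (w, w'). basis (v @ w, v' @ w')) (H_comult_gen g1 g2 x)) w (basis ([], [])))"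
      have "set w \<subseteq> gens"
        using Cons.prems by simp
      with Cons.IH b have "b \<in> {w. set w \<subseteq> gens} \<times> {w. set w \<subseteq> gens}"
        by blast
      moreover have "a \<in> {w. set w \<subseteq> gens} \<times> {w. set w \<subseteq> gens}"
        using gen a by blast
      ultimately show "Poly_Mapping.keys ((case a of (v, v') \<Rightarrow> \<lambda>(w, w'). basis (v @ w, v' @ w')) b)
          \<subseteq> {w. set w \<subseteq> gens} \<times> {w. set w \<subseteq> gens}"
        by (cases a; cases b) simp
    qed
  qed simp
qed

lemma val_counit: "val p (e0, \<one>) = lin_form (\<lambda>w. prod_list (map H_counit_gen w)) p" if p: "p \<in> carrier F" for p
proof -
  have "word_val w (e0, \<one>) = prod_list (map H_counit_gen w)" if "set w \<subseteq> gens" for w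
    using that
  proof (induction w)
    case (Cons x w)
    then have "gen_val x (e0, \<one>) = H_counit_gen x"
      by (auto simp: gen_val.simps \<beta>_one)
    with Cons show ?case
      by (simp add: hs.conv_i)
  qed simp
  with p show ?thesis
    unfolding val_def by (intro lin_form_cong) auto
qed

text \<open>The key point is the coproduct: on a chosen representative it is evaluated word by word,
  giving the value of the representative at a product in \<open>A\<close>, and this depends only on
  \<open>\<phi> A\<close>.\<close>

lemma model: "dual_model X m (e0, \<one>) D e ant H \<phi>"
proof (intro dual_model.intro A_structure dual_model_axioms.intro)
  show "ring H" "\<phi> \<in> ring_iso H K"
    by (rule ring_H iso_H)+
  fix A c assume "A \<in> carrier H"
  then have A: "A \<in> carrier Q"
    by (simp only: H_simps)
  then obtain p where p: "p \<in> carrier F" "A = coset p"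
    by (rule carrier_Q_cases)
  then have cp: "cscale c p \<in> carrier F"
    by (simp add: keys_cscale)
  show "c \<odot>\<^bsub>H\<^esub> A \<in> carrier H"
    unfolding p(2) smult_coset[OF p(1)] using coset_in[OF cp] by (simp only: H_simps)
  show "\<phi> (c \<odot>\<^bsub>H\<^esub> A) = c \<odot>\<^bsub>K\<^esub> \<phi> A"
    unfolding p(2) smult_coset[OF p(1)] \<phi>_coset[OF p(1)] \<phi>_coset[OF cp]
    by (rule hs.dual_ext) (simp_all add: \<Phi>_def)
  let ?p = "SOME p. p \<in> A"
  have pF: "?p \<in> carrier F"
    by (rule coset_memD(1)[OF A some_in[OF A]])
  show "counit H A = \<phi> A (basis (e0, \<one>))"
    using \<phi>_some[OF A, of "(e0, \<one>)"] val_counit[OF pF] by (simp only: H_simps) simp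
  have word: "basis w \<in> carrier F" if "set w \<subseteq> gens" for w
    using that by simp
  have "Poly_Mapping.keys (push (\<lambda>(v, w). [coset (basis v), coset (basis w)]) (free_comult (H_comult_gen g1 g2) ?p))
      \<subseteq> {zs. length zs = 2 \<and> set zs \<subseteq> carrier Q}"
  proof (intro keys_push_subset image_subsetI)
    fix q assume "q \<in> Poly_Mapping.keys (free_comult (H_comult_gen g1 g2) ?p)"
    then obtain v w where "q = (v, w)" "set v \<subseteq> gens" "set w \<subseteq> gens"
      using keys_free_comult[OF pF] by blast
    then show "(case q of (v, w) \<Rightarrow> [coset (basis v), coset (basis w)]) \<in> {zs. length zs = 2 \<and> set zs \<subseteq> carrier Q}"
      using coset_in[OF word[of v]] coset_in[OF word[of w]] by simp
  qed
  then show "comult H A \<in> tensors H 2"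
    unfolding H_simps tensors_def by blast
  fix a b assume ab: "a \<in> X" "b \<in> X"
  have "lin_form (\<lambda>zs. \<phi> (zs ! 0) (basis a) * \<phi> (zs ! 1) (basis b)) (comult H A)
      = lin_form (\<lambda>(v, w). \<phi> (coset (basis v)) (basis a) * \<phi> (coset (basis w)) (basis b)) (free_comult (H_comult_gen g1 g2) ?p)"
    unfolding H_simps lin_form_push by (simp only: case_prod_unfold nth_Cons_0 nth_Cons_Suc One_nat_def)
  also have "\<dots> = lin_form (\<lambda>(v, w). word_val v a * word_val w b) (free_comult (H_comult_gen g1 g2) ?p)"
  proof (intro lin_form_cong)
    fix q assume "q \<in> Poly_Mapping.keys (free_comult (H_comult_gen g1 g2) ?p)"
    then obtain v w where q: "q = (v, w)" "set v \<subseteq> gens" "set w \<subseteq> gens"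
      using keys_free_comult[OF pF] by blast
    show "(case q of (v, w) \<Rightarrow> \<phi> (coset (basis v)) (basis a) * \<phi> (coset (basis w)) (basis b))
        = (case q of (v, w) \<Rightarrow> word_val v a * word_val w b)"
      using ab by (simp only: q(1) prod.case \<phi>_coset[OF word[OF q(2)]] \<phi>_coset[OF word[OF q(3)]] \<Phi>_def hs.func_basis val_simps mult_1)
  qed
  also have "\<dots> = lin_form (\<lambda>w. lin_form (\<lambda>(v, w). word_val v a * word_val w b) (free_comult (H_comult_gen g1 g2) (basis w))) ?p"
    by (simp add: free_comult_def)
  also have "\<dots> = lin_form (\<lambda>w. lin_form (word_val w) (m a b)) ?p"
    using pF by (intro lin_form_cong word_val_comult ab) auto
  also have "\<dots> = lin_form (val ?p) (m a b)"
    unfolding val_def by (rule lin_form_swap)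
  also have "\<dots> = lin_form (\<lambda>x. \<phi> A (basis x)) (m a b)"
    using \<phi>_some[OF A] subsetD[OF keys_m[OF ab]] by (intro lin_form_cong) simp
  finally show "lin_form (\<lambda>zs. \<phi> (zs ! 0) (basis a) * \<phi> (zs ! 1) (basis b)) (comult H A)
      = lin_form (\<lambda>x. \<phi> A (basis x)) (m a b)" .
qed

theorem hopf_isomorphic_A: "hopf_isomorphic H (dual_hopf (A_hopf G 2 \<rho> u B))"
  unfolding A_hopf_eq by (rule dual_model.hopf_isomorphic_dual[OF model])

end

section \<open>The three families\<close>

definition unity_root :: "nat \<Rightarrow> complex" where
  "unity_root n = cis (2 * pi / real n)"

lemma unity_root_power: "unity_root n ^ k = cis (2 * pi * real k / real n)"
  by (simp add: unity_root_def DeMoivre mult_ac)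

lemma unity_root_nonzero [simp]: "unity_root n \<noteq> 0"
  by (simp add: unity_root_def)

lemma unity_root_power_order: "n > 0 \<Longrightarrow> unity_root n ^ n = 1"
  by (simp add: unity_root_power)

lemma unity_root_power_mod:
  assumes "n > 0"
  shows "unity_root n ^ (k mod n) = unity_root n ^ k"
proof -
  have "unity_root n ^ k = unity_root n ^ (n * (k div n) + k mod n)"
    by simp
  also have "\<dots> = unity_root n ^ (k mod n)"
    unfolding power_add power_mult by (simp add: unity_root_power_order[OF assms])
  finally show ?thesis ..
qed

lemma unity_root_power_eq: "n > 0 \<Longrightarrow> k mod n = l mod n \<Longrightarrow> unity_root n ^ k = unity_root n ^ l"
  using unity_root_power_mod by metis

lemma unity_root_half: "n > 0 \<Longrightarrow> unity_root (2 * n) ^ n = -1"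
  by (simp add: unity_root_power)

text \<open>For different exponents this is a geometric sum whose ratio is an n-th root of unity
  other than 1, because the powers of the root below n are distinct.\<close>

lemma unity_root_orthogonal:
  assumes "c < n" "d < n"
  shows "(\<Sum>k<n. unity_root n ^ (k * c) / unity_root n ^ (k * d)) = (if c = d then of_nat n else 0)"
proof (cases "c = d")
  case False
  have n: "n > 0"
    using assms by simp
  let ?r = "unity_root n ^ c / unity_root n ^ d"
  have "inj_on (\<lambda>k. cis (2 * pi * real k / real n)) {..<n}"
    using bij_betw_roots_unity[OF n] by (simp add: bij_betw_def)
  then have "unity_root n ^ c \<noteq> unity_root n ^ d"
    using assms False unfolding unity_root_power by (auto dest: inj_onD)
  then have "?r \<noteq> 1"
    by simp
  moreover have "?r ^ n = 1"
    by (simp add: power_divide flip: power_mult) (simp add: mult.commute[of _ n] power_mult unity_root_power_order[OF n])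
  ultimately have "(\<Sum>k<n. ?r ^ k) = 0"
    by (simp add: geometric_sum)
  moreover have "unity_root n ^ (k * c) / unity_root n ^ (k * d) = ?r ^ k" for k
    by (simp add: power_divide mult.commute[of k] power_mult)
  ultimately show ?thesis
    using False by simp
qed simp

lemma sum_int_interval: "(\<Sum>c\<in>{0..<int n}. f (nat c)) = (\<Sum>k<n. f k)"
  by (rule sum.reindex_bij_witness[of _ int nat]) auto

text \<open>A copy of the dual of the cyclic group of order 8 on natural numbers, as the theorem
  asks for a \<open>nat monoid\<close>.\<close>

definition cyclic8 :: "nat monoid" where
  "cyclic8 = \<lparr>carrier = {..<8}, monoid.mult = (\<lambda>a b. (a + b) mod 8), one = 0\<rparr>"

lemma cyclic8_simps [simp]:
  "carrier cyclic8 = {..<8}" "a \<otimes>\<^bsub>cyclic8\<^esub> b = (a + b) mod 8" "\<one>\<^bsub>cyclic8\<^esub> = 0"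
  by (simp_all add: cyclic8_def)

lemma comm_group_cyclic8: "comm_group cyclic8"
proof (rule comm_groupI)
  fix a assume "a \<in> carrier cyclic8"
  \<comment> \<open>The outer reduction modulo 8 covers \<open>a = 0\<close>.\<close>
  then show "\<exists>b\<in>carrier cyclic8. b \<otimes>\<^bsub>cyclic8\<^esub> a = \<one>\<^bsub>cyclic8\<^esub>"
    by (intro bexI[of _ "(8 - a) mod 8"]) (simp_all add: mod_add_left_eq)
qed (auto simp: mod_simps add_ac)

text \<open>Pairing with 4 raises a primitive eighth root of unity to the power \<open>4 c\<close>,
  which is the sign of \<open>c\<close>; so 4 plays the role of \<open>\<psi>\<close>. Both
  admissible \<open>r\<close> are odd, as the sign at \<open>g2\<close> requires, so (F1) and (F2)
  are treated together.\<close>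

lemma grana_datum_cyclic8:
  assumes r: "r = 3 \<or> r = 5"
  shows "grana_datum cyclic8 (integer_mod_group 8) (\<lambda>g c. unity_root 8 ^ (g * nat c)) 4 1 r (\<lambda>k. (-1) ^ nat k)"
proof (intro grana_datum.intro grana_datum_axioms.intro comm_group_cyclic8 abelian_integer_mod_group)
  have u: "unity_root 8 ^ (4 * k) = (-1) ^ k" for k
    using unity_root_half[of 4] by (simp add: power_mult)
  show "unity_root 8 ^ (4 * nat c) = (-1) ^ nat c" for c
    by (rule u)
  show "unity_root 8 ^ (4 * nat 1) = -1" "unity_root 8 ^ (4 * nat r) = -1"
    using r u[of 1] u[of 3] u[of 5] by auto
  show "(\<Sum>c\<in>carrier (integer_mod_group 8). unity_root 8 ^ (g * nat c) / unity_root 8 ^ (h * nat c))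
      = (if g = h then of_nat (card (carrier cyclic8)) else 0)"
    if "g \<in> carrier cyclic8" "h \<in> carrier cyclic8" for g h
    using unity_root_orthogonal[of g 8 h] sum_int_interval[of "\<lambda>k. unity_root 8 ^ (g * k) / unity_root 8 ^ (h * k)" 8] that
    by (simp add: carrier_integer_mod_group mult.commute)
  fix c d assume c: "c \<in> carrier (integer_mod_group 8)" and d: "d \<in> carrier (integer_mod_group 8)"
  then have cd: "nat c < 8" "nat d < 8" "c = d \<longleftrightarrow> nat c = nat d" "nat ((c + d) mod 8) = (nat c + nat d) mod 8"
    by (auto simp: carrier_integer_mod_group nat_add_distrib nat_mod_distrib)
  show "(\<Sum>g\<in>carrier cyclic8. unity_root 8 ^ (g * nat c) / unity_root 8 ^ (g * nat d))
      = (if c = d then of_nat (card (carrier cyclic8)) else 0)"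
    using cd unity_root_orthogonal[of "nat c" 8 "nat d"] by simp
  fix g h assume "g \<in> carrier cyclic8" "h \<in> carrier cyclic8"
  then have gh: "g < 8" "h < 8"
    by auto
  show "unity_root 8 ^ (g \<otimes>\<^bsub>cyclic8\<^esub> h * nat c) = unity_root 8 ^ (g * nat c) * unity_root 8 ^ (h * nat c)"
    unfolding power_add[symmetric] by (rule unity_root_power_eq) (simp_all add: mod_simps distrib_right)
  show "unity_root 8 ^ (g * nat (c \<otimes>\<^bsub>integer_mod_group 8\<^esub> d)) = unity_root 8 ^ (g * nat c) * unity_root 8 ^ (g * nat d)"
    unfolding power_add[symmetric] using cd(4) by (intro unity_root_power_eq) (simp_all add: mod_simps distrib_left)
qed (use r in \<open>auto simp: carrier_integer_mod_group\<close>)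

text \<open>The number \<open>2 i + j\<close> with \<open>i < 4\<close> and \<open>j < 2\<close> encodes the element \<open>(i, j)\<close> of $\mathbb{Z}_4 \times \mathbb{Z}_2$.\<close>

definition cyclic42 :: "nat monoid" where
  "cyclic42 = \<lparr>carrier = {..<8},
     monoid.mult = (\<lambda>a b. 2 * ((a div 2 + b div 2) mod 4) + (a + b) mod 2), one = 0\<rparr>"

lemma cyclic42_simps [simp]:
  "carrier cyclic42 = {..<8}" "a \<otimes>\<^bsub>cyclic42\<^esub> b = 2 * ((a div 2 + b div 2) mod 4) + (a + b) mod 2"
  "\<one>\<^bsub>cyclic42\<^esub> = 0"
  by (simp_all add: cyclic42_def)

lemma cyclic42_mult_lt: "2 * ((i :: nat) mod 4) + j mod 2 < 8"
proof -
  have "i mod 4 < 4" "j mod 2 < 2"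
    by simp_all
  then show ?thesis
    by linarith
qed

lemma comm_group_cyclic42: "comm_group cyclic42"
proof (rule comm_groupI)
  fix a assume "a \<in> carrier cyclic42"
  then have a: "a div 2 \<le> 4"
    by simp
  \<comment> \<open>The first component is negated modulo 4, again reduced to cover 0; the second is
    its own inverse modulo 2.\<close>
  let ?b = "2 * ((4 - a div 2) mod 4) + a mod 2"
  have "(2 * i + a mod 2) div 2 = i" "(2 * i + a mod 2 + a) mod 2 = 0" for i
    by presburger+
  moreover have "((4 - a div 2) mod 4 + a div 2) mod 4 = 0"
    using a by (simp only: mod_add_left_eq le_add_diff_inverse2 mod_self)
  ultimately have "?b \<otimes>\<^bsub>cyclic42\<^esub> a = \<one>\<^bsub>cyclic42\<^esub>"
    by (simp only: cyclic42_simps mult_0_right add_0)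
  then show "\<exists>b\<in>carrier cyclic42. b \<otimes>\<^bsub>cyclic42\<^esub> a = \<one>\<^bsub>cyclic42\<^esub>"
    using cyclic42_mult_lt by (intro bexI[of _ ?b]) simp_all
next
  fix a b c
  have "(2 * i + j mod 2) div 2 = i" "(2 * i + (j mod 2 + k)) mod 2 = (j + k) mod 2"
    "(k + (2 * i + j mod 2)) mod 2 = (k + j) mod 2" for i j k :: nat
    by (simp, simp only: mod_mult_self4 mod_add_left_eq,
        simp only: add.left_commute[of k] mod_mult_self4 mod_add_right_eq)
  then show "a \<otimes>\<^bsub>cyclic42\<^esub> b \<otimes>\<^bsub>cyclic42\<^esub> c = a \<otimes>\<^bsub>cyclic42\<^esub> (b \<otimes>\<^bsub>cyclic42\<^esub> c)"
    by (simp only: cyclic42_simps mod_add_left_eq mod_add_right_eq add.assoc)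
  show "a \<otimes>\<^bsub>cyclic42\<^esub> b = b \<otimes>\<^bsub>cyclic42\<^esub> a" "a \<otimes>\<^bsub>cyclic42\<^esub> b \<in> carrier cyclic42"
    "\<one>\<^bsub>cyclic42\<^esub> \<in> carrier cyclic42"
    by (simp_all only: cyclic42_simps lessThan_iff cyclic42_mult_lt add.commute[of a b] add.commute[of "a div 2" "b div 2"])
  assume "a \<in> carrier cyclic42"
  then show "\<one>\<^bsub>cyclic42\<^esub> \<otimes>\<^bsub>cyclic42\<^esub> a = a"
    by auto
qed

lemma sum_cyclic42: "(\<Sum>k<8. f (k div 2) (k mod 2)) = (\<Sum>i<4. \<Sum>j<2. f i j)" for f :: "nat \<Rightarrow> nat \<Rightarrow> complex"
  unfolding sum.cartesian_product
  by (rule sum.reindex_bij_witness[of _ "\<lambda>(i, j). 2 * i + j" "\<lambda>k. (k div 2, k mod 2)"]) auto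

text \<open>The pairing is the product of the pairings of the two cyclic factors, so each
  orthogonality sum factors. The number 4 encodes \<open>(2, 0)\<close>, whose pairing with
  \<open>(a, b)\<close> is the sign of \<open>a\<close>.\<close>

lemma grana_datum_cyclic42:
  "grana_datum cyclic42 (integer_mod_group 4 \<times>\<times> integer_mod_group 2)
     (\<lambda>g (a, b). unity_root 4 ^ (g div 2 * nat a) * unity_root 2 ^ (g mod 2 * nat b)) 4 (1, 0) (1, 1) (\<lambda>(a, b). (-1) ^ nat a)"
  (is "grana_datum _ ?\<Gamma> ?\<beta> _ _ _ _")
proof (intro grana_datum.intro grana_datum_axioms.intro comm_group_cyclic42)
  show "comm_group ?\<Gamma>"
    by (rule group.group_comm_groupI) (auto simp: DirProd_group add.commute)
  have u: "unity_root 4 ^ (2 * k) = (-1) ^ k" for k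
    using unity_root_half[of 2] by (simp add: power_mult)
  show "?\<beta> 4 (1, 0) = -1" "?\<beta> 4 (1, 1) = -1"
    using u[of 1] by simp_all
  show "?\<beta> 4 c = (case c of (a, b) \<Rightarrow> (-1) ^ nat a)" for c
    using u by (cases c) simp
  { fix g h assume "g \<in> carrier cyclic42" "h \<in> carrier cyclic42"
    then have gh: "g div 2 < 4" "h div 2 < 4" "g mod 2 < 2" "h mod 2 < 2"
      by auto
    have eq: "g = h \<longleftrightarrow> g div 2 = h div 2 \<and> g mod 2 = h mod 2"
      by (metis div_mult_mod_eq)
    have "(\<Sum>c\<in>carrier ?\<Gamma>. ?\<beta> g c / ?\<beta> h c)
        = (\<Sum>a\<in>{0..<int 4}. unity_root 4 ^ (g div 2 * nat a) / unity_root 4 ^ (h div 2 * nat a))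
          * (\<Sum>b\<in>{0..<int 2}. unity_root 2 ^ (g mod 2 * nat b) / unity_root 2 ^ (h mod 2 * nat b))"
      by (simp add: carrier_integer_mod_group sum_product sum.cartesian_product case_prod_unfold)
    also have "\<dots> = (\<Sum>k<4. unity_root 4 ^ (k * (g div 2)) / unity_root 4 ^ (k * (h div 2)))
          * (\<Sum>k<2. unity_root 2 ^ (k * (g mod 2)) / unity_root 2 ^ (k * (h mod 2)))"
      using sum_int_interval[of "\<lambda>k. unity_root 4 ^ (g div 2 * k) / unity_root 4 ^ (h div 2 * k)" 4]
        sum_int_interval[of "\<lambda>k. unity_root 2 ^ (g mod 2 * k) / unity_root 2 ^ (h mod 2 * k)" 2]
      by (simp only: mult.commute)
    finally show "(\<Sum>c\<in>carrier ?\<Gamma>. ?\<beta> g c / ?\<beta> h c) = (if g = h then of_nat (card (carrier cyclic42)) else 0)"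
      using unity_root_orthogonal[OF gh(1,2)] unity_root_orthogonal[OF gh(3,4)] by (simp add: eq)
  }
  fix c d assume "c \<in> carrier ?\<Gamma>" "d \<in> carrier ?\<Gamma>"
  then obtain a b a' b' where cd: "c = (a, b)" "d = (a', b')" and ab: "0 \<le> a" "a < 4" "0 \<le> b" "b < 2"
      "0 \<le> a'" "a' < 4" "0 \<le> b'" "b' < 2"
    by (cases c; cases d) (auto simp: carrier_integer_mod_group)
  then have eqs: "a = a' \<longleftrightarrow> nat a = nat a'" "b = b' \<longleftrightarrow> nat b = nat b'"
    and lt: "nat a < 4" "nat a' < 4" "nat b < 2" "nat b' < 2"
    and add: "nat ((a + a') mod 4) = (nat a + nat a') mod 4" "nat ((b + b') mod 2) = (nat b + nat b') mod 2"
    by (auto simp: nat_add_distrib nat_mod_distrib)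
  have "(\<Sum>g\<in>carrier cyclic42. ?\<beta> g c / ?\<beta> g d)
      = (\<Sum>i<4. unity_root 4 ^ (i * nat a) / unity_root 4 ^ (i * nat a')) * (\<Sum>j<2. unity_root 2 ^ (j * nat b) / unity_root 2 ^ (j * nat b'))"
    using sum_cyclic42[of "\<lambda>i j. (unity_root 4 ^ (i * nat a) / unity_root 4 ^ (i * nat a')) * (unity_root 2 ^ (j * nat b) / unity_root 2 ^ (j * nat b'))"]
    by (simp add: cd sum_product)
  then show "(\<Sum>g\<in>carrier cyclic42. ?\<beta> g c / ?\<beta> g d) = (if c = d then of_nat (card (carrier cyclic42)) else 0)"
    using unity_root_orthogonal[OF lt(1,2)] unity_root_orthogonal[OF lt(3,4)] eqs by (simp add: cd)
  fix g h assume "g \<in> carrier cyclic42" "h \<in> carrier cyclic42"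
  have "unity_root 4 ^ ((g div 2 + h div 2) mod 4 * nat a) = unity_root 4 ^ (g div 2 * nat a + h div 2 * nat a)"
    "unity_root 2 ^ ((g + h) mod 2 * nat b) = unity_root 2 ^ (g mod 2 * nat b + h mod 2 * nat b)"
    by (rule unity_root_power_eq, simp, metis distrib_right mod_mult_left_eq)
      (rule unity_root_power_eq, simp, metis distrib_right mod_add_eq mod_mult_left_eq)
  then show "?\<beta> (g \<otimes>\<^bsub>cyclic42\<^esub> h) c = ?\<beta> g c * ?\<beta> h c"
    by (simp add: cd power_add)
  have "unity_root 4 ^ (g div 2 * ((nat a + nat a') mod 4)) = unity_root 4 ^ (g div 2 * nat a + g div 2 * nat a')"
    "unity_root 2 ^ (g mod 2 * ((nat b + nat b') mod 2)) = unity_root 2 ^ (g mod 2 * nat b + g mod 2 * nat b')"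
    by (rule unity_root_power_eq, simp, metis distrib_left mod_mult_right_eq)+
  then show "?\<beta> g (c \<otimes>\<^bsub>?\<Gamma>\<^esub> d) = ?\<beta> g c * ?\<beta> g d"
    by (simp add: cd add power_add)
qed (auto simp: carrier_integer_mod_group)

lemma (in grana_datum) family:
  "super_datum G 2 \<rho> u" "B \<in> sym_tensors 2"
  "hopf_isomorphic (grana_hopf \<Gamma> g1 g2 \<psi> l1 l2 l3) (dual_hopf (A_hopf G 2 \<rho> u B))"
  by (rule super_datum B_sym hopf_isomorphic_A)+

text \<open>The locale assumptions do not involve \<open>l1\<close>, \<open>l2\<close>,
  \<open>l3\<close>, and \<open>\<rho>\<close> is built from the pairing, \<open>g1\<close> and
  \<open>g2\<close>. One instance therefore serves all parameters, which enter through
  \<open>B\<close> only, as the order of the quantifiers demands.\<close>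

lemma grana_datum_exists:
  fixes G :: "nat monoid"
  assumes "grana_datum G \<Gamma> \<beta> u g1 g2 \<psi>"
  shows "\<exists>(G :: nat monoid) n \<rho> u. super_datum G n \<rho> u \<and>
    (\<forall>l1 l2 l3. \<exists>B\<in>sym_tensors n. hopf_isomorphic (grana_hopf \<Gamma> g1 g2 \<psi> l1 l2 l3) (dual_hopf (A_hopf G n \<rho> u B)))"
  using grana_datum.family[OF assms] by blast

theorem theorem4p1:
  shows
    "(\<exists>(G :: nat monoid) n \<rho> u. super_datum G n \<rho> u \<and>
        (\<forall>l1 l2 l3. \<exists>B\<in>sym_tensors n. hopf_isomorphic (H_F1 l1 l2 l3) (dual_hopf (A_hopf G n \<rho> u B)))) \<and>
     (\<exists>(G :: nat monoid) n \<rho> u. super_datum G n \<rho> u \<and>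
        (\<forall>l1 l2 l3. \<exists>B\<in>sym_tensors n. hopf_isomorphic (H_F2 l1 l2 l3) (dual_hopf (A_hopf G n \<rho> u B)))) \<and>
     (\<exists>(G :: nat monoid) n \<rho> u. super_datum G n \<rho> u \<and>
        (\<forall>l1 l2 l3. \<exists>B\<in>sym_tensors n. hopf_isomorphic (H_F3 l1 l2 l3) (dual_hopf (A_hopf G n \<rho> u B))))"
  unfolding H_F1_def H_F2_def H_F3_def
  by (intro conjI grana_datum_exists[OF grana_datum_cyclic8] grana_datum_exists[OF grana_datum_cyclic42]) simp_all

end
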